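(* Let $n\ge 3$ and $p_n=\frac{n+2}{n-2}$. Let $S\subset\mathbb{S}^n$ be an isoparametric hypersurface of the round sphere $(\mathbb{S}^n,g_0)$ with focal submanifolds $M_-$ and $M_+$ satisfying $\dim M_->0$ and $\dim M_+>0$. Then there exists a sequence $(u_k)$ of sign-changing solutions to the Yamabe problem on the sphere $$-\Delta_{g_0}u+\frac{n(n-2)}{4}u=\frac{n(n-2)}{4}|u|^{p_n-1}u\qquad\text{on }\mathbb{S}^n$$ such that $$\lim_{k\to\infty}u_k(x)=\infty\ \text{ for every }x\in M_-\qquad\text{and}\qquad\lim_{k\to\infty}u_k(x)=-\infty\ \text{ for every }x\in M_+.$$
   Context: A smooth function $f:(M,g)\to\mathbb{R}$ on a Riemannian manifold is isoparametric if there are smooth functions $a,b:\mathbb{R}\to\mathbb{R}$ with $|\nabla f|_g^2=b(f)$ and $\Delta f=a(f)$; its regular level sets are called isoparametric hypersurfaces. On $\mathbb{S}^n$, isoparametric hypersurfaces are taken to be connected. Each isoparametric hypersurface $S$ of $\mathbb{S}^n$ is a regular level set of the restriction $f:\mathbb{S}^n\to[-1,1]$ to $\mathbb{S}^n$ of a Cartan–Münzner polynomial, that is, a homogeneous polynomial $F$ on $\mathbb{R}^{n+1}$ of degree $\ell$ with $|\nabla F|^2=\ell^2|x|^{2\ell-2}$ and $\Delta F=c|x|^{\ell-2}$ for some constant $c$, whose restriction to the sphere is nonconstant. The only critical values of $f$ are $\pm1$, and the focal submanifolds of $S$ are the smooth submanifolds $M_-=f^{-1}(-1)$ and $M_+=f^{-1}(1)$.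 *)

theory Defs
  imports "HOL-Analysis.Analysis"
begin

section \<open>Differentiability classes\<close>

text \<open>\<open>Ck_on k f U\<close> is meant for open \<open>U\<close>: all directional derivatives of order at most \<open>k\<close>
  exist and are continuous on \<open>U\<close>.\<close>

primrec Ck_on :: "nat \<Rightarrow> ('a::euclidean_space \<Rightarrow> 'b::real_normed_vector) \<Rightarrow> 'a set \<Rightarrow> bool" where
  "Ck_on 0 f U \<longleftrightarrow> continuous_on U f"
| "Ck_on (Suc k) f U \<longleftrightarrow>
     f differentiable_on U \<and> (\<forall>v. Ck_on k (\<lambda>x. frechet_derivative f (at x) v) U)"

definition smooth_on :: "('a::euclidean_space \<Rightarrow> 'b::real_normed_vector) \<Rightarrow> 'a set \<Rightarrow> bool" where
  "smooth_on f U \<longleftrightarrow> (\<forall>k. Ck_on k f U)"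

text \<open>The round sphere is the unit sphere \<open>sphere 0 1\<close> of a Euclidean space of dimension
  \<open>n + 1\<close>, with the induced metric.  Functions on the sphere are represented by functions on the
  ambient space; only their values on the sphere matter.  Regularity of a function on the sphere
  means, as for any embedded submanifold, that it extends with this regularity to an open
  neighbourhood.\<close>

definition Ck_on_sphere :: "nat \<Rightarrow> ('a::euclidean_space \<Rightarrow> real) \<Rightarrow> bool" where
  "Ck_on_sphere k u \<longleftrightarrow>
     (\<exists>U f. open U \<and> sphere 0 1 \<subseteq> U \<and> Ck_on k f U \<and> (\<forall>x\<in>sphere 0 1. f x = u x))"

definition smooth_on_sphere :: "('a::euclidean_space \<Rightarrow> real) \<Rightarrow> bool" where
  "smooth_on_sphere u \<longleftrightarrow>
     (\<exists>U f. open U \<and> sphere 0 1 \<subseteq> U \<and> smooth_on f U \<and> (\<forall>x\<in>sphere 0 1. f x = u x))"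

text \<open>A \<open>k\<close>-dimensional smooth submanifold of Euclidean space, by local straightening
  diffeomorphisms onto open sets of the model.  A subset of the sphere is a smooth submanifold of
  the sphere iff it is one of the ambient space, with the same dimension.\<close>

definition smooth_submanifold :: "nat \<Rightarrow> 'a::euclidean_space set \<Rightarrow> bool" where
  "smooth_submanifold k M \<longleftrightarrow>
     (\<forall>p\<in>M. \<exists>U V T \<phi> \<psi>. open U \<and> p \<in> U \<and> open (V :: 'a set) \<and> subspace T \<and> dim T = k \<and>
        homeomorphism U V \<phi> \<psi> \<and> smooth_on \<phi> U \<and> smooth_on \<psi> V \<and> \<phi> ` (U \<inter> M) = V \<inter> T)"


section \<open>Differential operators of the round metric\<close>

text \<open>The derivative within the sphere at \<open>x\<close> is only determined on the tangent space
  \<open>{v. v \<bullet> x = 0}\<close>; requiring the gradient to be tangent makes it unique.\<close>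

definition sphere_grad :: "('a::euclidean_space \<Rightarrow> real) \<Rightarrow> 'a \<Rightarrow> 'a" where
  "sphere_grad u x =
     (THE v. v \<bullet> x = 0 \<and> (u has_derivative (\<lambda>h. h \<bullet> v)) (at x within sphere 0 1))"

text \<open>The Levi-Civita connection of the induced metric is the tangential part of the ambient
  derivative, so the divergence of a tangent field \<open>X\<close> at \<open>x\<close> is the trace over the tangent space
  of the bilinear form \<open>(v, w) \<mapsto> D v \<bullet> w\<close>, where \<open>D\<close> is the derivative of \<open>X\<close>.  The sum below is
  that trace, with \<open>b - (b \<bullet> x) x\<close> the orthogonal projection of \<open>b\<close> to the tangent space.  It
  involves \<open>D\<close> on tangent vectors only, where \<open>D\<close> is determined by \<open>X\<close>.\<close>

definition sphere_div :: "('a::euclidean_space \<Rightarrow> 'a) \<Rightarrow> 'a \<Rightarrow> real" where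
  "sphere_div X x =
     (THE d. \<exists>D. (X has_derivative D) (at x within sphere 0 1) \<and>
        d = (\<Sum>b\<in>Basis. D (b - (b \<bullet> x) *\<^sub>R x) \<bullet> (b - (b \<bullet> x) *\<^sub>R x)))"

definition sphere_laplacian :: "('a::euclidean_space \<Rightarrow> real) \<Rightarrow> 'a \<Rightarrow> real" where
  "sphere_laplacian u x = sphere_div (sphere_grad u) x"


section \<open>Differential operators of Euclidean space\<close>

definition gradient :: "('a::euclidean_space \<Rightarrow> real) \<Rightarrow> 'a \<Rightarrow> 'a" where
  "gradient F x = (THE v. GDERIV F x :> v)"

definition laplacian :: "('a::euclidean_space \<Rightarrow> real) \<Rightarrow> 'a \<Rightarrow> real" where
  "laplacian F x =
     (\<Sum>b\<in>Basis. frechet_derivative (\<lambda>y. frechet_derivative F (at y) b) (at x) b)"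


section \<open>Isoparametric hypersurfaces of the sphere\<close>

definition isoparametric_function :: "('a::euclidean_space \<Rightarrow> real) \<Rightarrow> bool" where
  "isoparametric_function f \<longleftrightarrow> smooth_on_sphere f \<and>
     (\<exists>a b :: real \<Rightarrow> real. smooth_on a UNIV \<and> smooth_on b UNIV \<and>
        (\<forall>x\<in>sphere 0 1. (norm (sphere_grad f x))\<^sup>2 = b (f x) \<and> sphere_laplacian f x = a (f x)))"

definition regular_level_set :: "('a::euclidean_space \<Rightarrow> real) \<Rightarrow> 'a set \<Rightarrow> bool" where
  "regular_level_set f S \<longleftrightarrow>
     (\<exists>t. S = {x \<in> sphere 0 1. f x = t}) \<and> S \<noteq> {} \<and> (\<forall>x\<in>S. sphere_grad f x \<noteq> 0)"

definition isoparametric_hypersurface :: "'a::euclidean_space set \<Rightarrow> bool" where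
  "isoparametric_hypersurface S \<longleftrightarrow>
     (\<exists>f. isoparametric_function f \<and> regular_level_set f S) \<and> connected S"

text \<open>The integer power makes sense of \<open>|x|\<^sup>l\<^sup>-\<^sup>2\<close> also for \<open>l = 1\<close>, where both
  sides of the equation for the Laplacian vanish (so that \<open>c = 0\<close>).\<close>

definition cartan_muenzner_polynomial :: "nat \<Rightarrow> ('a::euclidean_space \<Rightarrow> real) \<Rightarrow> bool" where
  "cartan_muenzner_polynomial l F \<longleftrightarrow>
     real_polynomial_function F \<and> (\<forall>r x. F (r *\<^sub>R x) = r ^ l * F x) \<and>
     (\<forall>x. (norm (gradient F x))\<^sup>2 = (real l)\<^sup>2 * norm x powi (2 * int l - 2)) \<and>
     (\<exists>c. \<forall>x. laplacian F x = c * norm x powi (int l - 2)) \<and>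
     \<not> F constant_on sphere 0 1"

text \<open>\<open>M\<^sub>-\<close> and \<open>M\<^sub>+\<close> are the focal submanifolds of \<open>S\<close>, named according to the choice of a
  Cartan-Muenzner polynomial having \<open>S\<close> as a regular level set; replacing \<open>F\<close> by \<open>- F\<close>
  interchanges them.\<close>

definition focal_submanifolds :: "'a::euclidean_space set \<Rightarrow> 'a set \<Rightarrow> 'a set \<Rightarrow> bool" where
  "focal_submanifolds S Mminus Mplus \<longleftrightarrow>
     (\<exists>l F. cartan_muenzner_polynomial l F \<and> regular_level_set F S \<and>
        Mminus = {x \<in> sphere 0 1. F x = -1} \<and> Mplus = {x \<in> sphere 0 1. F x = 1})"


section \<open>The Yamabe problem on the sphere\<close>

definition critical_exponent :: "nat \<Rightarrow> real" where
  "critical_exponent n = (real n + 2) / (real n - 2)"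

text \<open>Classical solutions; at zeros of \<open>u\<close> the right-hand side is \<open>0\<close>.\<close>

definition yamabe_solution :: "nat \<Rightarrow> ('a::euclidean_space \<Rightarrow> real) \<Rightarrow> bool" where
  "yamabe_solution n u \<longleftrightarrow> Ck_on_sphere 2 u \<and>
     (\<forall>x\<in>sphere 0 1.
        - sphere_laplacian u x + real n * (real n - 2) / 4 * u x =
          real n * (real n - 2) / 4 * (\<bar>u x\<bar> powr (critical_exponent n - 1) * u x))"

definition sign_changing_on_sphere :: "('a::euclidean_space \<Rightarrow> real) \<Rightarrow> bool" where
  "sign_changing_on_sphere u \<longleftrightarrow> (\<exists>x\<in>sphere 0 1. u x > 0) \<and> (\<exists>x\<in>sphere 0 1. u x < 0)"

end

theory Submission
  imports Defs
begin

text \<open>The solutions are constant on the level sets of the Cartan-Muenzner polynomial \<open>F\<close>, of degree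
  \<open>l\<close>: they have the form \<open>u = y ((1 - F) / 2)\<close>.  By Euler's identity,
  \<open>\<bar>\<nabla>F\<bar>\<^sup>2 = l\<^sup>2 (1 - F\<^sup>2)\<close> and \<open>\<Delta>F = c - l (l + n - 1) F\<close> on the sphere (\<open>laplacian_of_profile\<close>), so that
  the Yamabe equation for \<open>u\<close> becomes
  \<open>z (1 - z) y'' + (\<alpha> - (\<alpha> + \<beta>) z) y' + \<kappa> (\<bar>y\<bar>\<^sup>r y - y) = 0\<close> with \<open>r = 4 / (n - 2)\<close>, an equation for \<open>y\<close> on
  \<open>{0..1}\<close>, where \<open>z = 0\<close> corresponds to the focal submanifold \<open>F = 1\<close> and \<open>z = 1\<close> to \<open>F = - 1\<close>.
  What is needed are solutions regular at both end points, with \<open>y 0\<close> arbitrarily negative and \<open>y 1\<close>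
  arbitrarily large (\<open>sign_changing_profile\<close>).  The equation is invariant under \<open>y \<mapsto> - y\<close>, and
  \<open>z \<mapsto> 1 - z\<close> exchanges \<open>\<alpha>\<close> and \<open>\<beta>\<close>, so it suffices to study solutions from one end point and to match
  two of them at \<open>z = 1/2\<close>.

  The numbers \<open>2 \<alpha>\<close> and \<open>2 \<beta>\<close> are the codimensions in the sphere of the two focal submanifolds: at a point of
  \<open>F = 1\<close> the Hessian of \<open>F\<close> on the sphere is \<open>- l\<^sup>2\<close> times an orthogonal projection with trace \<open>2 \<alpha>\<close>
  (\<open>symmetric_projection_focal\<close>, \<open>trace_focal_projection\<close>).  At boundary points of the focal set this
  projection is not zero (\<open>focal_projection_nonzero\<close>), hence \<open>2 \<alpha> \<ge> 1\<close>.  A vector tangent to a focal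
  submanifold of positive dimension lies in its kernel, as does the position vector, hence \<open>2 \<alpha> \<le> n - 1\<close>.
  The last inequality is where the hypothesis on the dimensions enters: near \<open>z = 0\<close> the equation is a
  radial equation in dimension \<open>2 \<alpha> < n\<close>, in which the power \<open>r + 1\<close>, critical in dimension \<open>n\<close>, is
  subcritical.

  For every \<open>a\<close> there is a solution \<open>Y a\<close> on \<open>{0..1/2}\<close>, regular at \<open>0\<close>, with \<open>Y a 0 = a\<close>, and it depends
  continuously on \<open>a\<close>.  Subcriticality and a Pohozaev identity show that its energy on
  \<open>{z0..1/2}\<close>, for a fixed \<open>z0 > 0\<close>, tends to infinity with \<open>a\<close> (\<open>energy_at_top\<close>).  High energy means a
  strong restoring force and therefore fast rotation in the phase plane (\<open>rotation_speed\<close>).  So \<open>a \<mapsto> (Y a, (Y a)')\<close>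
  at \<open>z = 1/2\<close> is a spiral whose radius and angle both tend to infinity (\<open>shooting_curve\<close>).  The reflection
  \<open>z \<mapsto> 1 - z\<close> reverses slopes, so the solutions from the other end point give a spiral that turns the other
  way; a change of sign only rotates a spiral by \<open>pi\<close>.  Two spirals of opposite orientation intersect arbitrarily
  far out (\<open>spirals_meet\<close>, by the Fashoda theorem in logarithmic polar coordinates), and an intersection of
  the spirals of \<open>- Y a\<close> and of the reflected \<open>Y b\<close> gives a solution on all of \<open>{0..1}\<close> with \<open>y 0 = - a\<close> and
  \<open>y 1 = b\<close>.\<close>

section \<open>Real functions\<close>

text \<open>First exit: at the first point where \<open>f\<close> is at most \<open>m\<close>, the weak bound would still hold up to
  that point, and \<open>step\<close> would make it strict there.\<close>

lemma barrier_principle: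
  fixes f :: "real \<Rightarrow> real"
  assumes cont: "continuous_on {0..Z} f" and start: "m < f 0"
    and step: "\<And>z. \<lbrakk>0 \<le> z; z \<le> Z; \<And>t. 0 \<le> t \<Longrightarrow> t \<le> z \<Longrightarrow> m \<le> f t\<rbrakk> \<Longrightarrow> m < f z"
    and z: "0 \<le> z" "z \<le> Z"
  shows "m < f z"
proof (rule ccontr)
  assume "\<not> m < f z"
  define B where "B = {t \<in> {0..Z}. f t \<le> m}"
  have "B = {0..Z} \<inter> f -` {..m}" by (auto simp: B_def)
  then have "closed B" using cont
    by (metis closed_atLeastAtMost closed_atMost continuous_closed_preimage)
  moreover have "bounded B" by (rule bounded_subset[of "{0..Z}"]) (auto simp: B_def)
  ultimately have "compact B" by (simp add: compact_eq_bounded_closed)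
  moreover have "z \<in> B" using z \<open>\<not> m < f z\<close> by (auto simp: B_def)
  ultimately obtain z1 where z1: "z1 \<in> B" "\<And>t. t \<in> B \<Longrightarrow> z1 \<le> t"
    by (metis compact_attains_inf empty_iff)
  have "m \<le> f t" if t: "0 \<le> t" "t \<le> z1" for t
  proof (cases "t < z1")
    case True
    then have "t \<notin> B" using z1(2) by force
    then show ?thesis using t z1(1) by (auto simp: B_def)
  next
    case False
    then have [simp]: "t = z1" using t by simp
    show ?thesis
    proof (rule ccontr)
      assume "\<not> m \<le> f t"
      then have "f z1 \<le> m" "m \<le> f 0" using start by auto
      moreover have "continuous_on {0..z1} f"
        by (rule continuous_on_subset[OF cont]) (use z1(1) in \<open>auto simp: B_def\<close>)
      ultimately obtain s where s: "0 \<le> s" "s \<le> z1" "f s = m"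
        using IVT2'[of f z1 m 0] t by auto
      then have "s \<in> B" using z1(1) by (auto simp: B_def)
      then have "s = z1" using z1(2) s by force
      then show False using s \<open>\<not> m \<le> f t\<close> by simp
    qed
  qed
  then have "m < f z1" using step[of z1] z1(1) by (auto simp: B_def)
  then show False using z1(1) by (auto simp: B_def)
qed

text \<open>At \<open>s = 0\<close> the difference quotient is \<open>\<bar>h\<bar> powr r\<close>, which tends to \<open>0\<close> because \<open>r > 0\<close>.\<close>

lemma DERIV_abs_powr_times:
  fixes r s :: real
  assumes "0 < r"
  shows "((\<lambda>s. \<bar>s\<bar> powr r * s) has_real_derivative (r + 1) * \<bar>s\<bar> powr r) (at s)"
proof (cases "s = 0")
  case True
  have "((\<lambda>h. \<bar>h\<bar> powr r) \<longlongrightarrow> 0) (at (0::real))"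
  proof -
    have "((\<lambda>h::real. \<bar>h\<bar> powr r) \<longlongrightarrow> \<bar>0\<bar> powr r) (at 0)"
      by (rule tendsto_powr'[OF tendsto_rabs[OF tendsto_ident_at] tendsto_const]) (use assms in auto)
    moreover have "\<bar>0::real\<bar> powr r = 0" by simp
    ultimately show ?thesis by (simp only:)
  qed
  then have "((\<lambda>h. (\<bar>0 + h\<bar> powr r * (0 + h) - \<bar>0\<bar> powr r * 0) / h) \<longlongrightarrow> 0) (at (0::real))"
    by (rule Lim_transform_eventually) (auto simp: eventually_at_filter)
  then show ?thesis using True assms by (simp add: DERIV_def)
next
  case False
  then consider "s > 0" | "s < 0" by linarith
  then show ?thesis
  proof cases
    case 1
    have "((\<lambda>s. s powr r * s) has_real_derivative (r + 1) * \<bar>s\<bar> powr r) (at s)"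
      using 1 by (auto intro!: derivative_eq_intros simp: powr_diff field_simps)
    moreover have ev: "\<forall>\<^sub>F x in nhds s. x powr r * x = \<bar>x\<bar> powr r * x"
      using eventually_nhds_in_open[of "{0<..}" s] 1 by (auto elim: eventually_mono)
    ultimately show ?thesis by (simp only: DERIV_cong_ev[OF refl ev refl])
  next
    case 2
    have "((\<lambda>s. (-s) powr r * s) has_real_derivative (r + 1) * \<bar>s\<bar> powr r) (at s)"
      using 2 by (auto intro!: derivative_eq_intros simp: powr_diff field_simps)
    moreover have ev: "\<forall>\<^sub>F x in nhds s. (-x) powr r * x = \<bar>x\<bar> powr r * x"
      using eventually_nhds_in_open[of "{..<0}" s] 2 by (auto elim: eventually_mono)
    ultimately show ?thesis by (simp only: DERIV_cong_ev[OF refl ev refl])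
  qed
qed

lemma DERIV_abs_powr_times_square:
  fixes r s :: real
  assumes "0 < r"
  shows "((\<lambda>s. \<bar>s\<bar> powr r * s\<^sup>2) has_real_derivative (r + 2) * (\<bar>s\<bar> powr r * s)) (at s)"
proof -
  have "((\<lambda>s. (\<bar>s\<bar> powr r * s) * s) has_real_derivative
      (r + 1) * \<bar>s\<bar> powr r * s + (\<bar>s\<bar> powr r * s)) (at s)"
    using DERIV_mult[OF DERIV_abs_powr_times[OF assms, of s] DERIV_ident] by simp
  then show ?thesis by (simp add: algebra_simps power2_eq_square)
qed

lemma continuous_abs_powr [continuous_intros]:
  fixes f :: "'a::topological_space \<Rightarrow> real"
  assumes "continuous_on S f" "0 < r"
  shows "continuous_on S (\<lambda>x. \<bar>f x\<bar> powr r)"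
  using assms by (intro continuous_on_powr' continuous_on_rabs continuous_on_const) auto

text \<open>Quadratic terms are absorbed by the higher power: either \<open>C \<le> \<epsilon> * \<bar>s\<bar> powr r\<close>, or \<open>\<bar>s\<bar>\<close> is bounded
  by \<open>(C / \<epsilon>) powr (1/r)\<close>.\<close>

lemma square_le_abs_powr:
  fixes C r s \<epsilon> :: real
  assumes "0 < r" "0 < \<epsilon>" "0 \<le> C"
  shows "C * s\<^sup>2 \<le> \<epsilon> * \<bar>s\<bar> powr r * s\<^sup>2 + C * ((C / \<epsilon>) powr (1/r))\<^sup>2"
proof (cases "C / \<epsilon> \<le> \<bar>s\<bar> powr r")
  case True
  then have "C \<le> \<epsilon> * \<bar>s\<bar> powr r" using assms by (simp add: field_simps)
  then have "C * s\<^sup>2 \<le> \<epsilon> * \<bar>s\<bar> powr r * s\<^sup>2" by (intro mult_right_mono) auto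
  then show ?thesis using assms by (simp add: add_increasing2)
next
  case False
  have "\<bar>s\<bar> = (\<bar>s\<bar> powr r) powr (1/r)" using assms by (simp add: powr_powr)
  also have "\<dots> \<le> (C / \<epsilon>) powr (1/r)" using False assms by (intro powr_mono2) auto
  finally have "s\<^sup>2 \<le> ((C / \<epsilon>) powr (1/r))\<^sup>2"
    by (metis abs_ge_zero power2_abs power_mono)
  then have "C * s\<^sup>2 \<le> C * ((C / \<epsilon>) powr (1/r))\<^sup>2" using assms by (simp add: mult_left_mono)
  moreover have "0 \<le> \<epsilon> * \<bar>s\<bar> powr r * s\<^sup>2" using assms by simp
  ultimately show ?thesis by linarith
qed

section \<open>Volterra equations with averages\<close>

text \<open>Integrating a radial equation with a singularity of the form \<open>\<alpha> / z\<close> produces integrals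
  \<open>z\<^sup>-\<^sup>\<alpha> \<integral>\<^sub>0\<^sup>z t\<^sup>\<alpha>\<^sup>-\<^sup>1 h(t) dt\<close>.  The substitution \<open>t = z * s powr (1/\<alpha>)\<close> turns them into averages
  of \<open>h (z * e s)\<close> over \<open>s \<in> {0..1}\<close>, in which nothing is singular any more.  The weight \<open>k\<close> stands for
  the remaining coefficients, which are regular as long as \<open>z\<close> stays away from the other
  singular point \<open>1\<close>; hence the bound \<open>z \<le> 1/2\<close>.\<close>

locale volterra_average =
  fixes k :: "real \<Rightarrow> real \<Rightarrow> real" and e :: "real \<Rightarrow> real" and C :: real
  assumes k_cont: "continuous_on ({0..1/2} \<times> {0..1}) (\<lambda>(z, s). k z s)"
    and k_bound: "\<And>z s. \<lbrakk>0 \<le> z; z \<le> 1/2; 0 \<le> s; s \<le> 1\<rbrakk> \<Longrightarrow> \<bar>k z s\<bar> \<le> C"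
    and e_cont: "continuous_on {0..1} e"
    and e_range: "\<And>s. \<lbrakk>0 \<le> s; s \<le> 1\<rbrakk> \<Longrightarrow> 0 \<le> e s \<and> e s \<le> 1"
begin

definition avg :: "(real \<Rightarrow> real) \<Rightarrow> real \<Rightarrow> real" where
  "avg h z = integral {0..1} (\<lambda>s. k z s * h (z * e s))"

lemma scaled_arg: "\<lbrakk>0 \<le> z; z \<le> Z; 0 \<le> s; s \<le> 1\<rbrakk> \<Longrightarrow> 0 \<le> z * e s \<and> z * e s \<le> Z"
  using e_range[of s] mult_mono[of z Z "e s" 1] by auto

lemma C_nonneg: "0 \<le> C" using k_bound[of 0 0] by auto

lemma avg_integrand_cont:
  assumes "continuous_on {0..Z} h" "Z \<le> 1/2"
  shows "continuous_on ({0..Z} \<times> {0..1}) (\<lambda>(z, s). k z s * h (z * e s))"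
proof -
  have 1: "continuous_on ({0..Z} \<times> {0..1}) (\<lambda>p. e (snd p))"
    by (rule continuous_on_compose2[OF e_cont]) (auto intro!: continuous_intros)
  have 2: "continuous_on ({0..Z} \<times> {0..1}) (\<lambda>p. h (fst p * e (snd p)))"
    by (rule continuous_on_compose2[OF assms(1)]) (use 1 scaled_arg in \<open>auto intro!: continuous_intros\<close>)
  have 3: "continuous_on ({0..Z} \<times> {0..1}) (\<lambda>p. k (fst p) (snd p))"
    by (rule continuous_on_subset[OF k_cont[unfolded case_prod_beta]]) (use assms in auto)
  show ?thesis using 2 3 unfolding case_prod_beta by (intro continuous_intros)
qed

lemma avg_cont:
  assumes "continuous_on {0..Z} h" "Z \<le> 1/2"
  shows "continuous_on {0..Z} (avg h)"
  using integral_continuous_on_param[of "{0..Z}" "0::real" 1 "\<lambda>z s. k z s * h (z * e s)"]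
    avg_integrand_cont[OF assms] by (simp add: avg_def[abs_def])

lemma avg_slice_cont:
  assumes "continuous_on {0..Z} h" "Z \<le> 1/2" "0 \<le> z" "z \<le> Z"
  shows "continuous_on {0..1} (\<lambda>s. k z s * h (z * e s))"
proof -
  have "continuous_on {0..1} (Pair z)" by (intro continuous_intros)
  moreover have "Pair z ` {0..1} \<subseteq> {0..Z} \<times> {0..1}" using assms by auto
  ultimately show ?thesis
    using continuous_on_compose2[OF avg_integrand_cont[OF assms(1,2)], of "{0..1}" "Pair z"]
    by (simp only: prod.case)
qed

lemma avg_integrable:
  assumes "continuous_on {0..Z} h" "Z \<le> 1/2" "0 \<le> z" "z \<le> Z"
  shows "(\<lambda>s. k z s * h (z * e s)) integrable_on {0..1}"
  by (rule integrable_continuous_interval[OF avg_slice_cont[OF assms]])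

lemma avg_diff_bound:
  assumes "continuous_on {0..Z} h1" "continuous_on {0..Z} h2" "Z \<le> 1/2" "0 \<le> z" "z \<le> Z"
    and d: "\<And>t. \<lbrakk>0 \<le> t; t \<le> z\<rbrakk> \<Longrightarrow> \<bar>h1 t - h2 t\<bar> \<le> m"
  shows "\<bar>avg h1 z - avg h2 z\<bar> \<le> C * m"
proof -
  have "avg h1 z - avg h2 z = integral {0..1} (\<lambda>s. k z s * h1 (z * e s) - k z s * h2 (z * e s))"
    unfolding avg_def
    by (rule integral_diff[OF avg_integrable[OF assms(1,3-5)] avg_integrable[OF assms(2,3-5)], symmetric])
  also have "\<bar>\<dots>\<bar> \<le> C * m * (1 - 0)"
  proof (subst real_norm_def[symmetric], rule integral_bound)
    show "continuous_on {0..1} (\<lambda>s. k z s * h1 (z * e s) - k z s * h2 (z * e s))"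
      by (intro continuous_on_diff avg_slice_cont[OF assms(1,3-5)] avg_slice_cont[OF assms(2,3-5)])
    fix s :: real assume "s \<in> {0..1}"
    then have s: "0 \<le> s" "s \<le> 1" by auto
    have "\<bar>k z s\<bar> * \<bar>h1 (z * e s) - h2 (z * e s)\<bar> \<le> C * m"
      using k_bound[of z s] d[of "z * e s"] scaled_arg[of z z s] s assms C_nonneg
      by (intro mult_mono) auto
    then show "norm (k z s * h1 (z * e s) - k z s * h2 (z * e s)) \<le> C * m"
      by (simp add: abs_mult[symmetric] algebra_simps)
  qed auto
  finally show ?thesis by simp
qed

definition solves :: "(real \<Rightarrow> real) \<Rightarrow> real \<Rightarrow> real \<Rightarrow> (real \<Rightarrow> real) \<Rightarrow> bool" where
  "solves G Z a y \<longleftrightarrow> continuous_on {0..Z} y \<and>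
     (\<forall>z\<in>{0..Z}. y z = a + integral {0..z} (avg (\<lambda>t. G (y t))))"

text \<open>The average does not increase the weight \<open>exp (\<mu> * t)\<close>, and the integration gains the factor
  \<open>1/\<mu>\<close>.  So for large \<open>\<mu>\<close> the integral operator is a contraction for the supremum norm
  weighted by \<open>exp (- \<mu> * t)\<close>, on the whole interval and for every Lipschitz constant of the
  nonlinearity.\<close>

lemma volterra_estimate:
  assumes c1: "continuous_on {0..Z} h1" and c2: "continuous_on {0..Z} h2" and "Z \<le> 1/2"
    and z: "0 \<le> z" "z \<le> Z" and "0 < \<mu>" "0 \<le> m"
    and d: "\<And>t. \<lbrakk>0 \<le> t; t \<le> z\<rbrakk> \<Longrightarrow> \<bar>h1 t - h2 t\<bar> \<le> m * exp (\<mu> * t)"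
  shows "\<bar>integral {0..z} (avg h1) - integral {0..z} (avg h2)\<bar> \<le> C * m / \<mu> * exp (\<mu> * z)"
proof -
  have sub: "continuous_on {0..z} (avg h1)" "continuous_on {0..z} (avg h2)"
    using avg_cont[OF c1] avg_cont[OF c2] assms(3) z by (auto intro: continuous_on_subset)
  then have i: "avg h1 integrable_on {0..z}" "avg h2 integrable_on {0..z}"
    by (auto intro: integrable_continuous_interval)
  have e: "((\<lambda>t. C * m * exp (\<mu> * t)) has_integral
      (C * m / \<mu> * exp (\<mu> * z) - C * m / \<mu> * exp (\<mu> * 0))) {0..z}"
    using z \<open>0 < \<mu>\<close>
    by (intro fundamental_theorem_of_calculus)
       (auto intro!: derivative_eq_intros simp: has_real_derivative_iff_has_vector_derivative[symmetric])
  have "norm (integral {0..z} (\<lambda>t. avg h1 t - avg h2 t)) \<le> integral {0..z} (\<lambda>t. C * m * exp (\<mu> * t))"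
  proof (rule integral_norm_bound_integral)
    show "(\<lambda>t. avg h1 t - avg h2 t) integrable_on {0..z}" using i by (rule integrable_diff)
    show "(\<lambda>t. C * m * exp (\<mu> * t)) integrable_on {0..z}" using e by blast
    fix t assume "t \<in> {0..z}"
    then have t: "0 \<le> t" "t \<le> z" by auto
    have "\<bar>avg h1 t - avg h2 t\<bar> \<le> C * (m * exp (\<mu> * t))"
    proof (rule avg_diff_bound[OF c1 c2])
      fix u assume u: "0 \<le> u" "u \<le> t"
      then have "m * exp (\<mu> * u) \<le> m * exp (\<mu> * t)" using assms by (intro mult_left_mono) auto
      then show "\<bar>h1 u - h2 u\<bar> \<le> m * exp (\<mu> * t)" using d[of u] u t by linarith
    qed (use assms t in auto)
    then show "norm (avg h1 t - avg h2 t) \<le> C * m * exp (\<mu> * t)" by (simp add: mult.assoc)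
  qed
  then have "\<bar>integral {0..z} (avg h1) - integral {0..z} (avg h2)\<bar>
      \<le> C * m / \<mu> * exp (\<mu> * z) - C * m / \<mu> * exp (\<mu> * 0)"
    using i integral_unique[OF e] by (simp add: integral_diff)
  moreover have "0 \<le> C * m / \<mu> * exp (\<mu> * 0)" using assms C_nonneg by simp
  ultimately show ?thesis by linarith
qed

lemma lipschitz_cont:
  fixes G :: "real \<Rightarrow> real"
  assumes "\<And>s t. \<bar>G s - G t\<bar> \<le> L * \<bar>s - t\<bar>" "continuous_on S y"
  shows "continuous_on S (\<lambda>t. G (y t))"
proof -
  have "0 \<le> L" using assms(1)[of 0 1] by simp
  then have "L-lipschitz_on UNIV G" using assms by (auto intro!: lipschitz_onI simp: dist_real_def)
  then have "continuous_on UNIV G" by (rule lipschitz_on_continuous_on)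
  then show ?thesis using assms(2) continuous_on_compose2 by blast
qed

text \<open>The choice of \<open>\<mu>\<close> makes the contraction factor at most \<open>1/2\<close>.  So the maximum \<open>D x\<close> of the weighted
  difference satisfies \<open>D x \<le> \<bar>a - b\<bar> + D x / 2\<close>, up to the weight at \<open>x\<close>.\<close>

lemma solutions_stable:
  assumes lip: "\<And>s t. \<bar>G s - G t\<bar> \<le> L * \<bar>s - t\<bar>"
    and "0 \<le> Z" "Z \<le> 1/2"
    and s1: "solves G Z a y1" and s2: "solves G Z b y2" and z: "0 \<le> z" "z \<le> Z"
  shows "\<bar>y1 z - y2 z\<bar> \<le> 2 * \<bar>a - b\<bar> * exp (2 * (C + 1) * (L + 1) * z)"
proof -
  define \<mu> where "\<mu> = 2 * (C + 1) * (L + 1)"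
  have L0: "0 \<le> L" using lip[of 0 1] by simp
  have "\<mu> > 0" using C_nonneg L0 by (simp add: \<mu>_def)
  have lam: "C * L / \<mu> \<le> 1/2"
    using C_nonneg L0 \<open>\<mu> > 0\<close> by (simp add: \<mu>_def field_simps)
  have c: "continuous_on {0..Z} y1" "continuous_on {0..Z} y2" using s1 s2 by (auto simp: solves_def)
  define D where "D z = \<bar>y1 z - y2 z\<bar> * exp (- \<mu> * z)" for z
  have "continuous_on {0..Z} D" unfolding D_def using c by (intro continuous_intros)
  then obtain x where x: "0 \<le> x" "x \<le> Z" and mx: "\<And>t. \<lbrakk>0 \<le> t; t \<le> Z\<rbrakk> \<Longrightarrow> D t \<le> D x"
    using continuous_attains_sup[of "{0..Z}" D] \<open>0 \<le> Z\<close> by auto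
  have D0: "0 \<le> D x" by (simp add: D_def)
  have "\<bar>integral {0..x} (avg (\<lambda>t. G (y1 t))) - integral {0..x} (avg (\<lambda>t. G (y2 t)))\<bar>
      \<le> C * (L * D x) / \<mu> * exp (\<mu> * x)"
  proof (rule volterra_estimate)
    fix t assume t: "0 \<le> t" "t \<le> x"
    have "\<bar>y1 t - y2 t\<bar> = D t * exp (\<mu> * t)" by (simp add: D_def exp_minus)
    also have "\<dots> \<le> D x * exp (\<mu> * t)" using mx[of t] t x by simp
    finally have "L * \<bar>y1 t - y2 t\<bar> \<le> L * (D x * exp (\<mu> * t))" by (rule mult_left_mono[OF _ L0])
    then show "\<bar>G (y1 t) - G (y2 t)\<bar> \<le> L * D x * exp (\<mu> * t)"
      using lip[of "y1 t" "y2 t"] by (simp add: mult.assoc)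
  qed (use lip c lipschitz_cont x \<open>\<mu> > 0\<close> assms L0 D0 in auto)
  also have "C * (L * D x) / \<mu> * exp (\<mu> * x) = (C * L / \<mu>) * (D x * exp (\<mu> * x))" by simp
  also have "\<dots> \<le> 1/2 * (D x * exp (\<mu> * x))" using lam D0 by (intro mult_right_mono) auto
  finally have h: "\<bar>integral {0..x} (avg (\<lambda>t. G (y1 t))) - integral {0..x} (avg (\<lambda>t. G (y2 t)))\<bar>
      \<le> 1/2 * (D x * exp (\<mu> * x))" .
  have "\<bar>y1 x - y2 x\<bar> \<le> \<bar>a - b\<bar> + 1/2 * (D x * exp (\<mu> * x))"
  proof -
    have "y1 x = a + integral {0..x} (avg (\<lambda>t. G (y1 t)))"
      "y2 x = b + integral {0..x} (avg (\<lambda>t. G (y2 t)))"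
      using s1 s2 x by (auto simp: solves_def)
    then show ?thesis using h by linarith
  qed
  moreover have "\<bar>y1 x - y2 x\<bar> = D x * exp (\<mu> * x)" by (simp add: D_def exp_minus)
  ultimately have "D x * exp (\<mu> * x) \<le> 2 * \<bar>a - b\<bar>" by (simp add: field_simps)
  moreover have "D x * 1 \<le> D x * exp (\<mu> * x)" using \<open>\<mu> > 0\<close> x D0 by (intro mult_left_mono) auto
  ultimately have "D z \<le> 2 * \<bar>a - b\<bar>" using mx[of z] z by linarith
  then have "D z * exp (\<mu> * z) \<le> 2 * \<bar>a - b\<bar> * exp (\<mu> * z)" by (intro mult_right_mono) auto
  moreover have "D z * exp (\<mu> * z) = \<bar>y1 z - y2 z\<bar>" by (simp add: D_def exp_minus)
  ultimately show ?thesis unfolding \<mu>_def[symmetric] by linarith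
qed

text \<open>Banach's fixed point theorem in the space of bounded continuous functions on the line.  Such a
  function \<open>v\<close> represents \<open>exp (\<mu> * t) * v t\<close>, which builds the weight into the norm, and the clamp
  \<open>c\<close> extends functions on \<open>{0..1/2}\<close> to the line by constants.\<close>

lemma solution_exists:
  assumes lip: "\<And>s t. \<bar>G s - G t\<bar> \<le> L * \<bar>s - t\<bar>"
  shows "\<exists>y. solves G (1/2) a y"
proof -
  define \<mu> where "\<mu> = 2 * (C + 1) * (L + 1)"
  have L0: "0 \<le> L" using lip[of 0 1] by simp
  have "\<mu> > 0" using C_nonneg L0 by (simp add: \<mu>_def)
  have lam: "C * L / \<mu> \<le> 1/2"
    using C_nonneg L0 \<open>\<mu> > 0\<close> by (simp add: \<mu>_def field_simps)
  define c :: "real \<Rightarrow> real" where "c z = max 0 (min (1/2) z)" for z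
  have c: "0 \<le> c z" "c z \<le> 1/2" for z by (auto simp: c_def)
  have c_id: "c z = z" if "0 \<le> z" "z \<le> 1/2" for z using that by (auto simp: c_def)
  have c_cont: "continuous_on UNIV c" unfolding c_def by (intro continuous_intros)
  define Y :: "(real \<Rightarrow>\<^sub>C real) \<Rightarrow> real \<Rightarrow> real" where "Y v t = exp (\<mu> * t) * apply_bcontfun v t" for v t
  have Y_cont: "continuous_on S (Y v)" for v S unfolding Y_def by (intro continuous_intros) auto
  have GY: "continuous_on S (\<lambda>t. G (Y v t))" for v S by (rule lipschitz_cont[OF lip Y_cont])
  define \<Psi> where "\<Psi> v z = exp (- \<mu> * z) * (a + integral {0..z} (avg (\<lambda>t. G (Y v t))))" for v z
  have \<Psi>_cont: "continuous_on {0..1/2} (\<Psi> v)" for v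
    unfolding \<Psi>_def
    by (intro continuous_intros indefinite_integral_continuous_1 integrable_continuous_interval avg_cont GY) auto
  have \<Psi>_bcont: "(\<lambda>z. \<Psi> v (c z)) \<in> bcontfun" for v
  proof -
    have "compact (\<Psi> v ` {0..1/2})" using \<Psi>_cont by (intro compact_continuous_image) auto
    then obtain B where B: "\<And>z. z \<in> {0..1/2} \<Longrightarrow> norm (\<Psi> v z) \<le> B"
      by (metis bounded_iff compact_imp_bounded imageI)
    show ?thesis
    proof (rule bcontfun_normI)
      show "continuous_on UNIV (\<lambda>z. \<Psi> v (c z))"
        by (rule continuous_on_compose2[OF \<Psi>_cont c_cont]) (use c in auto)
      show "norm (\<Psi> v (c z)) \<le> B" for z using B c by auto
    qed
  qed
  define T where "T v = Bcontfun (\<lambda>z. \<Psi> v (c z))" for v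
  have T: "apply_bcontfun (T v) z = \<Psi> v (c z)" for v z
    using \<Psi>_bcont by (simp add: T_def Bcontfun_inverse)
  have "dist (T v) (T w) \<le> 1/2 * dist v w" for v w
  proof (rule dist_bound)
    fix z
    have "\<bar>integral {0..c z} (avg (\<lambda>t. G (Y v t))) - integral {0..c z} (avg (\<lambda>t. G (Y w t)))\<bar>
        \<le> C * (L * dist v w) / \<mu> * exp (\<mu> * c z)"
    proof (rule volterra_estimate)
      fix t assume t: "0 \<le> t" "t \<le> c z"
      have "\<bar>Y v t - Y w t\<bar> = exp (\<mu> * t) * \<bar>apply_bcontfun v t - apply_bcontfun w t\<bar>"
        by (simp add: Y_def abs_mult flip: right_diff_distrib)
      also have "\<dots> \<le> exp (\<mu> * t) * dist v w"
        using dist_bounded[of v t w] by (intro mult_left_mono) (auto simp: dist_real_def)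
      finally have "L * \<bar>Y v t - Y w t\<bar> \<le> L * (exp (\<mu> * t) * dist v w)" by (rule mult_left_mono[OF _ L0])
      then show "\<bar>G (Y v t) - G (Y w t)\<bar> \<le> L * dist v w * exp (\<mu> * t)"
        using lip[of "Y v t" "Y w t"] by (simp add: mult_ac)
    qed (use GY c \<open>\<mu> > 0\<close> L0 in auto)
    then have "exp (- \<mu> * c z) * \<bar>integral {0..c z} (avg (\<lambda>t. G (Y v t))) - integral {0..c z} (avg (\<lambda>t. G (Y w t)))\<bar>
        \<le> exp (- \<mu> * c z) * (C * (L * dist v w) / \<mu> * exp (\<mu> * c z))"
      by (intro mult_left_mono) auto
    also have "\<dots> = C * L / \<mu> * dist v w" by (simp add: exp_minus)
    also have "\<dots> \<le> 1/2 * dist v w" using lam by (intro mult_right_mono) auto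
    finally show "dist (apply_bcontfun (T v) z) (apply_bcontfun (T w) z) \<le> 1/2 * dist v w"
      unfolding T \<Psi>_def dist_real_def by (simp add: abs_mult flip: right_diff_distrib)
  qed
  then obtain v where v: "T v = v" using banach_fix_type[of "1/2" T] by auto
  have "solves G (1/2) a (Y v)"
    unfolding solves_def
  proof (intro conjI ballI Y_cont)
    fix z :: real assume "z \<in> {0..1/2}"
    then have "apply_bcontfun v z = \<Psi> v z" using T[of v z] v c_id by simp
    then show "Y v z = a + integral {0..z} (avg (\<lambda>t. G (Y v t)))"
      by (simp add: Y_def[of v z] \<Psi>_def exp_minus)
  qed
  then show ?thesis by blast
qed

end

section \<open>Averages against a power\<close>

text \<open>This yields joint continuity of a solution's derivatives in the initial value (the parameter in
  \<open>S\<close>) and in \<open>z\<close>, once it is known for the solution itself.\<close>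

lemma scaled_integral_continuous:
  fixes w h :: "_ \<Rightarrow> real \<Rightarrow> real" and S :: "'p::topological_space set"
  assumes w: "continuous_on ({0..Z} \<times> {0..1}) (\<lambda>x. w (fst x) (snd x))"
    and e: "continuous_on {0..1} e" "\<And>s. \<lbrakk>0 \<le> s; s \<le> 1\<rbrakk> \<Longrightarrow> 0 \<le> e s \<and> e s \<le> (1::real)"
    and h: "continuous_on (S \<times> {0..Z}) (\<lambda>x. h (fst x) (snd x))"
  shows "continuous_on (S \<times> {0..Z}) (\<lambda>x. integral {0..1} (\<lambda>s. w (snd x) s * h (fst x) (snd x * e s)))"
proof -
  let ?U = "(S \<times> {0..Z}) \<times> {0..1::real}"
  have 1: "continuous_on ?U (\<lambda>u. e (snd u))"
    by (rule continuous_on_compose2[OF e(1)]) (auto intro!: continuous_intros)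
  have 2: "continuous_on ?U (\<lambda>u. w (snd (fst u)) (snd u))"
    using continuous_on_compose2[OF w, of ?U "\<lambda>u. (snd (fst u), snd u)"]
    by (force intro!: continuous_intros)
  have r: "0 \<le> z * e s \<and> z * e s \<le> Z" if "0 \<le> z" "z \<le> Z" "0 \<le> s" "s \<le> 1" for z s
    using e(2)[of s] mult_mono[of z Z "e s" 1] that by auto
  have "continuous_on ?U (\<lambda>u. (fst (fst u), snd (fst u) * e (snd u)))"
    using 1 by (intro continuous_intros)
  moreover have "(\<lambda>u. (fst (fst u), snd (fst u) * e (snd u))) ` ?U \<subseteq> S \<times> {0..Z}"
    using r by force
  ultimately have 3: "continuous_on ?U (\<lambda>u. h (fst (fst u)) (snd (fst u) * e (snd u)))"
    using continuous_on_compose2[OF h, of ?U "\<lambda>u. (fst (fst u), snd (fst u) * e (snd u))"]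
    by (simp only: fst_conv snd_conv)
  have "continuous_on ((S \<times> {0..Z}) \<times> cbox 0 1)
      (\<lambda>(x, s). w (snd x) s * h (fst x) (snd x * e s))"
    using 2 3 unfolding case_prod_beta by (simp add: continuous_on_mult)
  from integral_continuous_on_param[OF this] show ?thesis by simp
qed

text \<open>The average \<open>J\<close> of \<open>h (z * s powr (1/\<alpha>))\<close> over \<open>s\<close> is \<open>\<alpha> z\<^sup>-\<^sup>\<alpha> \<integral>\<^sub>0\<^sup>z t\<^sup>\<alpha>\<^sup>-\<^sup>1 h(t) dt\<close>, the solution of
  \<open>z * J' / \<alpha> + J = h\<close> that is regular at \<open>0\<close>.  In this form it can be differentiated under the
  integral sign up to \<open>z = 0\<close>.\<close>

locale power_average =
  fixes \<alpha> :: real and h h' :: "real \<Rightarrow> real" and Z :: real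
  assumes \<alpha>: "0 < \<alpha>"
    and h: "\<And>t. t \<in> {0..Z} \<Longrightarrow> (h has_real_derivative h' t) (at t within {0..Z})"
    and h'_cont: "continuous_on {0..Z} h'"
begin

lemma root_range: "\<lbrakk>0 \<le> s; s \<le> 1\<rbrakk> \<Longrightarrow> 0 \<le> s powr (1/\<alpha>) \<and> s powr (1/\<alpha>) \<le> 1"
  using \<alpha> by (simp add: powr_le1)

lemma root_cont: "continuous_on {0..1} (\<lambda>s. s powr (1/\<alpha>))"
  by (rule continuous_on_powr'[OF continuous_on_id continuous_on_const]) (use \<alpha> in auto)

lemma scaled_root: "\<lbrakk>0 \<le> z; z \<le> Z; 0 \<le> s; s \<le> 1\<rbrakk> \<Longrightarrow> 0 \<le> z * s powr (1/\<alpha>) \<and> z * s powr (1/\<alpha>) \<le> Z"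
  using root_range[of s] mult_mono[of z Z "s powr (1/\<alpha>)" 1] by auto

lemma h_cont: "continuous_on {0..Z} h"
  using h by (meson DERIV_continuous continuous_on_eq_continuous_within)

lemma slice_cont:
  assumes "continuous_on {0..Z} f" "z \<in> {0..Z}"
  shows "continuous_on {0..1} (\<lambda>s. f (z * s powr (1/\<alpha>)))"
  by (rule continuous_on_compose2[OF assms(1)])
     (use assms scaled_root root_cont in \<open>auto intro!: continuous_on_mult continuous_on_const\<close>)

lemma average_DERIV:
  assumes z: "z \<in> {0..Z}"
  shows "((\<lambda>z. integral {0..1} (\<lambda>s. h (z * s powr (1/\<alpha>)))) has_real_derivative
      integral {0..1} (\<lambda>s. s powr (1/\<alpha>) * h' (z * s powr (1/\<alpha>)))) (at z within {0..Z})"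
proof -
  have "((\<lambda>z. integral (cbox 0 1) (\<lambda>s. h (z * s powr (1/\<alpha>)))) has_field_derivative
      integral (cbox 0 1) (\<lambda>s. s powr (1/\<alpha>) * h' (z * s powr (1/\<alpha>)))) (at z within {0..Z})"
  proof (rule leibniz_rule_field_derivative)
    fix x s :: real assume x: "x \<in> {0..Z}" and s: "s \<in> cbox 0 1"
    have "((h \<circ> (\<lambda>x. x * s powr (1/\<alpha>))) has_real_derivative
        h' (x * s powr (1/\<alpha>)) * (s powr (1/\<alpha>))) (at x within {0..Z})"
    proof (rule DERIV_image_chain)
      have img: "(\<lambda>x. x * s powr (1/\<alpha>)) ` {0..Z} \<subseteq> {0..Z}" using scaled_root s by fastforce
      then show "(h has_real_derivative h' (x * s powr (1/\<alpha>)))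
          (at (x * s powr (1/\<alpha>)) within (\<lambda>x. x * s powr (1/\<alpha>)) ` {0..Z})"
        using h[of "x * s powr (1/\<alpha>)"] x by (meson DERIV_subset imageI subsetD)
      show "((\<lambda>x. x * s powr (1/\<alpha>)) has_real_derivative s powr (1/\<alpha>)) (at x within {0..Z})"
        by (auto intro!: derivative_eq_intros)
    qed
    then show "((\<lambda>x. h (x * s powr (1/\<alpha>))) has_real_derivative
        s powr (1/\<alpha>) * h' (x * s powr (1/\<alpha>))) (at x within {0..Z})"
      by (simp add: o_def mult.commute)
  next
    fix x assume "x \<in> {0..Z}"
    then show "(\<lambda>s. h (x * s powr (1/\<alpha>))) integrable_on cbox 0 1"
      using integrable_continuous_interval[OF slice_cont[OF h_cont]] by simp
  next
    have A: "continuous_on ({0..Z} \<times> {0..1}) (\<lambda>p. snd p powr (1/\<alpha>))"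
      by (rule continuous_on_compose2[OF root_cont]) (auto intro!: continuous_intros)
    have "continuous_on ({0..Z} \<times> {0..1}) (\<lambda>p. h' (fst p * snd p powr (1/\<alpha>)))"
      by (rule continuous_on_compose2[OF h'_cont])
         (use A scaled_root in \<open>auto intro!: continuous_on_mult continuous_on_fst continuous_on_id\<close>)
    then show "continuous_on ({0..Z} \<times> cbox 0 1) (\<lambda>(x, s). s powr (1/\<alpha>) * h' (x * s powr (1/\<alpha>)))"
      using A unfolding case_prod_beta by (simp add: continuous_on_mult)
  qed (use z in auto)
  then show ?thesis by simp
qed

text \<open>The integrand of the left-hand side is the derivative of \<open>s * h (z * s powr (1/\<alpha>))\<close> in \<open>s\<close>.\<close>

lemma average_identity:
  assumes z: "z \<in> {0..Z}"
  shows "z / \<alpha> * integral {0..1} (\<lambda>s. s powr (1/\<alpha>) * h' (z * s powr (1/\<alpha>)))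
    + integral {0..1} (\<lambda>s. h (z * s powr (1/\<alpha>))) = h z"
proof (cases "z = 0")
  case True
  then show ?thesis by simp
next
  case False
  then have z0: "0 < z" "z \<le> Z" using z by auto
  let ?e = "\<lambda>s. s powr (1/\<alpha>)"
  have i1: "(\<lambda>s. ?e s * h' (z * ?e s)) integrable_on {0..1}"
    by (intro integrable_continuous_interval continuous_on_mult root_cont slice_cont h'_cont z)
  have i2: "(\<lambda>s. h (z * ?e s)) integrable_on {0..1}"
    by (intro integrable_continuous_interval slice_cont h_cont z)
  have "((\<lambda>s. h (z * ?e s) + z / \<alpha> * (?e s * h' (z * ?e s))) has_integral
      (1 * h (z * ?e 1) - 0 * h (z * ?e 0))) {0..1}"
  proof (rule fundamental_theorem_of_calculus_interior)
    show "continuous_on {0..1} (\<lambda>s. s * h (z * ?e s))"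
      by (intro continuous_on_mult continuous_on_id slice_cont h_cont z)
    fix s :: real assume s: "s \<in> {0<..<1}"
    have lt: "?e s < 1" using s \<alpha> powr_less_mono2[of "1/\<alpha>" s 1] by simp
    have in01: "z * ?e s \<in> {0<..<Z}"
    proof -
      have "z * ?e s < z * 1" using z0 lt by (intro mult_strict_left_mono) auto
      then have "z * ?e s < Z" using z0 by linarith
      then show ?thesis using z0 s by auto
    qed
    have "(h has_real_derivative h' (z * ?e s)) (at (z * ?e s))"
      using h[of "z * ?e s"] in01 at_within_Icc_at[of 0 "z * ?e s" Z] by auto
    moreover have "((\<lambda>s. z * ?e s) has_real_derivative z * (1/\<alpha> * s powr (1/\<alpha> - 1))) (at s)"
      using s by (auto intro!: derivative_eq_intros)
    ultimately have "((\<lambda>s. h (z * ?e s)) has_real_derivative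
        h' (z * ?e s) * (z * (1/\<alpha> * s powr (1/\<alpha> - 1)))) (at s)"
      by (rule DERIV_chain2)
    then have D: "((\<lambda>s. s * h (z * ?e s)) has_real_derivative
        1 * h (z * ?e s) + h' (z * ?e s) * (z * (1/\<alpha> * s powr (1/\<alpha> - 1))) * s) (at s)"
      by (rule DERIV_mult[OF DERIV_ident])
    have "s powr (1/\<alpha> - 1) * s = ?e s" using s by (simp add: powr_diff)
    then have "1 * h (z * ?e s) + h' (z * ?e s) * (z * (1/\<alpha> * s powr (1/\<alpha> - 1))) * s
        = h (z * ?e s) + z / \<alpha> * (?e s * h' (z * ?e s))"
      by (simp add: mult_ac)
    with D show "((\<lambda>s. s * h (z * ?e s)) has_vector_derivative
        h (z * ?e s) + z / \<alpha> * (?e s * h' (z * ?e s))) (at s)"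
      by (simp only: has_real_derivative_iff_has_vector_derivative)
  qed simp
  then have "integral {0..1} (\<lambda>s. h (z * ?e s) + z / \<alpha> * (?e s * h' (z * ?e s))) = h z"
    using \<alpha> by (simp add: integral_unique)
  moreover have "integral {0..1} (\<lambda>s. h (z * ?e s) + z / \<alpha> * (?e s * h' (z * ?e s)))
      = integral {0..1} (\<lambda>s. h (z * ?e s)) + z / \<alpha> * integral {0..1} (\<lambda>s. ?e s * h' (z * ?e s))"
    using integral_add[OF i2 integrable_on_mult_right[OF i1, of "z / \<alpha>"]]
    by (simp only: integral_mult_right)
  ultimately show ?thesis by simp
qed

end

section \<open>The singular equation in integral form\<close>

text \<open>The equation \<open>z (1 - z) y'' + (\<alpha> - (\<alpha> + \<beta>) z) y' + \<kappa> (\<bar>y\<bar> powr r * y - y) = 0\<close>, studied on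
  \<open>{0..1/2}\<close> for solutions regular at \<open>0\<close>.  With \<open>z = t\<^sup>2 / 4\<close> the leading part near \<open>0\<close> is
  \<open>y\<^sub>t\<^sub>t + (2 \<alpha> - 1) y\<^sub>t / t\<close>, a radial Laplacian in dimension \<open>2 \<alpha>\<close>, and \<open>\<alpha> * r < r + 2\<close> says that the
  power \<open>r + 1\<close> lies below the critical Sobolev exponent of this dimension.\<close>

locale jacobi_shooting =
  fixes \<alpha> \<beta> \<kappa> r :: real
  assumes \<alpha>: "1/2 \<le> \<alpha>" and \<beta>: "1/2 \<le> \<beta>" and \<kappa>: "0 < \<kappa>" and r: "0 < r"
    and subcritical: "\<alpha> * r < r + 2"
begin

definition g :: "real \<Rightarrow> real" where "g s = \<bar>s\<bar> powr r * s - s"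
definition G :: "real \<Rightarrow> real" where "G s = \<bar>s\<bar> powr r * s\<^sup>2 / (r + 2) - s\<^sup>2 / 2"
definition g' :: "real \<Rightarrow> real" where "g' s = (r + 1) * \<bar>s\<bar> powr r - 1"
definition c0 :: real where "c0 = ((r + 2) powr (1/r))\<^sup>2"

lemma DERIV_g: "(g has_real_derivative g' s) (at s)"
  unfolding g_def[abs_def] g'_def by (rule DERIV_diff[OF DERIV_abs_powr_times[OF r] DERIV_ident])

lemma DERIV_G: "(G has_real_derivative g s) (at s)"
proof -
  have "((\<lambda>s. \<bar>s\<bar> powr r * s\<^sup>2 / (r + 2)) has_real_derivative
      (r + 2) * (\<bar>s\<bar> powr r * s) / (r + 2)) (at s)"
    by (rule DERIV_cdivide[OF DERIV_abs_powr_times_square[OF r]])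
  moreover have "((\<lambda>s. s\<^sup>2 / 2) has_real_derivative s) (at s)"
    by (auto intro!: derivative_eq_intros)
  ultimately have "((\<lambda>s. \<bar>s\<bar> powr r * s\<^sup>2 / (r + 2) - s\<^sup>2 / 2) has_real_derivative
      (r + 2) * (\<bar>s\<bar> powr r * s) / (r + 2) - s) (at s)"
    by (rule DERIV_diff)
  then show ?thesis using r by (simp add: g_def G_def[abs_def])
qed

lemma g_cont: "continuous_on S f \<Longrightarrow> continuous_on S (\<lambda>x. g (f x))"
  using DERIV_g DERIV_isCont continuous_at_imp_continuous_on continuous_on_compose2[of UNIV g S f]
  by blast

lemma g'_cont: "continuous_on S f \<Longrightarrow> continuous_on S (\<lambda>x. g' (f x))"
  unfolding g'_def
  by (rule continuous_on_diff[OF continuous_on_mult[OF continuous_on_const continuous_abs_powr[OF _ r]]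
        continuous_on_const])

lemma G_cont: "continuous_on S f \<Longrightarrow> continuous_on S (\<lambda>x. G (f x))"
  using DERIV_G DERIV_isCont continuous_at_imp_continuous_on continuous_on_compose2[of UNIV G S f]
  by blast

lemma G_lower: "s\<^sup>2 / 2 \<le> G s + c0"
proof -
  have "s\<^sup>2 \<le> \<bar>s\<bar> powr r * s\<^sup>2 / (r + 2) + c0"
    using square_le_abs_powr[of r "1/(r+2)" 1 s] r by (simp add: c0_def)
  then show ?thesis unfolding G_def by linarith
qed

lemma c0_nonneg: "0 \<le> c0" by (simp add: c0_def)

lemma G_upper:
  assumes "\<bar>s\<bar> \<le> A"
  shows "G s \<le> A powr r * A\<^sup>2 / (r + 2)"
proof -
  have "\<bar>s\<bar> powr r * s\<^sup>2 \<le> A powr r * A\<^sup>2"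
    using assms r abs_le_square_iff[of s A] by (intro mult_mono powr_mono2) auto
  then have "\<bar>s\<bar> powr r * s\<^sup>2 / (r + 2) \<le> A powr r * A\<^sup>2 / (r + 2)"
    using r by (intro divide_right_mono) auto
  then show ?thesis unfolding G_def using zero_le_power2[of s] by linarith
qed

text \<open>The equation is \<open>(z\<^sup>\<alpha> (1 - z)\<^sup>\<beta> y')' = - \<kappa> z\<^sup>\<alpha>\<^sup>-\<^sup>1 (1 - z)\<^sup>\<beta>\<^sup>-\<^sup>1 g(y)\<close>.  Integration from \<open>0\<close> and the
  substitution \<open>t = z * alpha_root s\<close> express \<open>y' z\<close> as the integral of
  \<open>kern z s * g (y (z * alpha_root s))\<close> over \<open>s \<in> {0..1}\<close>.\<close>

definition alpha_root :: "real \<Rightarrow> real" where "alpha_root s = s powr (1/\<alpha>)"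

definition kern :: "real \<Rightarrow> real \<Rightarrow> real" where
  "kern z s = - (\<kappa> / \<alpha>) * (1 - z) powr (-\<beta>) * (1 - z * alpha_root s) powr (\<beta> - 1)"

definition kern_bound :: real where "kern_bound = \<kappa> / \<alpha> * 2 powr \<beta> * 2"

lemma \<alpha>_pos: "0 < \<alpha>" using \<alpha> by linarith

lemma root_cont: "continuous_on {0..1} alpha_root"
  unfolding alpha_root_def[abs_def]
  by (rule continuous_on_powr'[OF continuous_on_id continuous_on_const]) (use \<alpha>_pos in auto)

lemma root_range: "\<lbrakk>0 \<le> s; s \<le> 1\<rbrakk> \<Longrightarrow> 0 \<le> alpha_root s \<and> alpha_root s \<le> 1"
  using \<alpha>_pos by (simp add: alpha_root_def powr_le1)

lemma scaled_root: "\<lbrakk>0 \<le> z; z \<le> Z; 0 \<le> s; s \<le> 1\<rbrakk> \<Longrightarrow> 0 \<le> z * alpha_root s \<and> z * alpha_root s \<le> Z"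
  using root_range[of s] mult_mono[of z Z "alpha_root s" 1] by auto

lemma kern_cont: "continuous_on ({0..1/2} \<times> {0..1}) (\<lambda>(z, s). kern z s)"
proof -
  have A: "continuous_on ({0..1/2} \<times> {0..1}) (\<lambda>p. alpha_root (snd p))"
    by (rule continuous_on_compose2[OF root_cont]) (auto intro!: continuous_intros)
  have le: "z * alpha_root s \<le> 1/2" if "0 \<le> z" "z \<le> 1/2" "0 \<le> s" "s \<le> 1" for z s :: real
    using scaled_root[of z "1/2" s] that by auto
  have "continuous_on ({0..1/2} \<times> {0..1}) (\<lambda>p. (1 - fst p * alpha_root (snd p)) powr (\<beta> - 1))"
    by (rule continuous_on_powr) (use A le in \<open>fastforce intro!: continuous_on_diff continuous_on_mult
      continuous_on_fst continuous_on_id continuous_on_const\<close>)+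
  moreover have "continuous_on ({0..1/2} \<times> {0..1}) (\<lambda>p. (1 - fst p) powr (-\<beta>))"
    by (rule continuous_on_powr) (auto intro!: continuous_intros)
  ultimately show ?thesis unfolding kern_def case_prod_beta
    by (intro continuous_on_mult continuous_on_const)
qed

lemma kern_bound:
  assumes "0 \<le> z" "z \<le> 1/2" "0 \<le> s" "s \<le> 1"
  shows "\<bar>kern z s\<bar> \<le> kern_bound"
proof -
  have x: "0 \<le> z * alpha_root s" "z * alpha_root s \<le> 1/2" using scaled_root[of z "1/2" s] assms by auto
  have "(1 - z) powr (-\<beta>) \<le> (1/2) powr (-\<beta>)"
    using assms \<beta> by (intro powr_mono2') auto
  also have "\<dots> = 2 powr \<beta>" by (simp add: powr_minus powr_divide)
  finally have 1: "(1 - z) powr (-\<beta>) \<le> 2 powr \<beta>" .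
  have "x powr (\<beta> - 1) \<le> 2" if "1/2 \<le> x" "x \<le> 1" for x :: real
  proof -
    have "x powr (\<beta> - 1) \<le> x powr (-1)" using that \<beta> by (intro powr_mono') auto
    also have "\<dots> = 1 / x" using that by (intro powr_neg_one) auto
    also have "\<dots> \<le> 2" using that by (simp add: field_simps)
    finally show ?thesis .
  qed
  then have 2: "(1 - z * alpha_root s) powr (\<beta> - 1) \<le> 2" using x by simp
  have "\<bar>kern z s\<bar> = \<kappa> / \<alpha> * (1 - z) powr (-\<beta>) * (1 - z * alpha_root s) powr (\<beta> - 1)"
    using \<kappa> \<alpha>_pos by (simp add: kern_def abs_mult)
  also have "\<dots> \<le> kern_bound" unfolding kern_bound_def
    using 1 2 \<kappa> \<alpha>_pos by (intro mult_mono mult_left_mono) auto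
  finally show ?thesis .
qed

sublocale volterra_average kern alpha_root kern_bound
  by standard (use kern_cont kern_bound root_cont root_range in auto)

definition D1 :: "(real \<Rightarrow> real) \<Rightarrow> real \<Rightarrow> real" where
  "D1 y = avg (\<lambda>t. g (y t))"

text \<open>The derivative of the formula \<open>D1_alt\<close> for \<open>D1 y\<close>, taken under the integral sign; a
  formula in terms of \<open>y\<close> and \<open>D1 y\<close> shows continuity up to \<open>z = 0\<close>, where the equation cannot be
  solved for \<open>y''\<close>.  The factor \<open>1\<close> gives the first integral the shape of
  \<open>scaled_integral_continuous\<close>.\<close>

definition D2 :: "(real \<Rightarrow> real) \<Rightarrow> real \<Rightarrow> real" where
  "D2 y z = - (\<kappa> / \<alpha>) *
     (\<beta> * (1 - z) powr (-\<beta> - 1) * integral {0..1} (\<lambda>s. 1 * ((1 - z * alpha_root s) powr (\<beta> - 1) * g (y (z * alpha_root s))))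
     + (1 - z) powr (-\<beta>) * integral {0..1} (\<lambda>s. alpha_root s *
         (- (\<beta> - 1) * (1 - z * alpha_root s) powr (\<beta> - 2) * g (y (z * alpha_root s))
          + (1 - z * alpha_root s) powr (\<beta> - 1) * (g' (y (z * alpha_root s)) * D1 y (z * alpha_root s)))))"

lemma DERIV_one_minus_powr:
  assumes "z < 1"
  shows "((\<lambda>z. (1 - z) powr c) has_real_derivative - c * (1 - z) powr (c - 1)) (at z within S)"
  using assms by (auto intro!: derivative_eq_intros)

lemma one_minus_powr_cont:
  fixes f :: "'b::topological_space \<Rightarrow> real"
  assumes "Z \<le> 1/2" "continuous_on S f" "f ` S \<subseteq> {0..Z}"
  shows "continuous_on S (\<lambda>z. (1 - f z) powr c)"
proof (rule continuous_on_powr)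
  show "continuous_on S (\<lambda>z. 1 - f z)" by (rule continuous_on_diff[OF continuous_on_const assms(2)])
  show "\<forall>z\<in>S. 1 - f z \<noteq> 0" using assms by fastforce
qed (rule continuous_on_const)

context
  fixes Z a y
  assumes Z: "0 \<le> Z" "Z \<le> 1/2" and sol: "solves g Z a y"
begin

lemma sol_cont: "continuous_on {0..Z} y" using sol by (simp add: solves_def)

lemma sol_0: "y 0 = a" using sol Z by (simp add: solves_def)

lemma D1_cont: "continuous_on {0..Z} (D1 y)"
  unfolding D1_def by (intro avg_cont g_cont sol_cont Z)

lemma sol_DERIV:
  assumes "z \<in> {0..Z}"
  shows "(y has_real_derivative D1 y z) (at z within {0..Z})"
proof -
  have "((\<lambda>u. integral {0..u} (D1 y)) has_real_derivative D1 y z) (at z within {0..Z})"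
    using integral_has_real_derivative[OF D1_cont assms] .
  then have "((\<lambda>u. a + integral {0..u} (D1 y)) has_real_derivative 0 + D1 y z) (at z within {0..Z})"
    by (rule DERIV_add[OF DERIV_const])
  from has_field_derivative_transform_within[OF this zero_less_one assms, of y]
  show ?thesis using sol by (simp add: solves_def D1_def)
qed

lemma D1_alt:
  "D1 y z = - (\<kappa> / \<alpha>) * (1 - z) powr (-\<beta>) *
     integral {0..1} (\<lambda>s. (1 - z * alpha_root s) powr (\<beta> - 1) * g (y (z * alpha_root s)))"
  unfolding D1_def avg_def kern_def
  by (simp only: integral_mult_right[symmetric] mult.assoc)

lemma power_average: "power_average \<alpha> (\<lambda>t. (1 - t) powr (\<beta> - 1) * g (y t))
    (\<lambda>t. - (\<beta> - 1) * (1 - t) powr (\<beta> - 2) * g (y t)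
          + (1 - t) powr (\<beta> - 1) * (g' (y t) * D1 y t)) Z"
proof
  fix t assume t: "t \<in> {0..Z}"
  have "((\<lambda>t. g (y t)) has_real_derivative g' (y t) * D1 y t) (at t within {0..Z})"
    by (rule DERIV_chain2[OF DERIV_g sol_DERIV[OF t]])
  then have "((\<lambda>t. (1 - t) powr (\<beta> - 1) * g (y t)) has_real_derivative
      - (\<beta> - 1) * (1 - t) powr (\<beta> - 1 - 1) * g (y t)
          + g' (y t) * D1 y t * (1 - t) powr (\<beta> - 1)) (at t within {0..Z})"
    using t Z by (intro DERIV_mult DERIV_one_minus_powr) auto
  then show "((\<lambda>t. (1 - t) powr (\<beta> - 1) * g (y t)) has_real_derivative
      - (\<beta> - 1) * (1 - t) powr (\<beta> - 2) * g (y t)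
          + (1 - t) powr (\<beta> - 1) * (g' (y t) * D1 y t)) (at t within {0..Z})"
    by (simp add: mult.commute)
next
  show "continuous_on {0..Z} (\<lambda>t. - (\<beta> - 1) * (1 - t) powr (\<beta> - 2) * g (y t)
          + (1 - t) powr (\<beta> - 1) * (g' (y t) * D1 y t))"
    by (intro continuous_on_add continuous_on_mult continuous_on_const g_cont g'_cont sol_cont D1_cont
        one_minus_powr_cont[OF Z(2)] continuous_on_id) auto
qed (rule \<alpha>_pos)

lemma D1_DERIV:
  assumes z: "z \<in> {0..Z}"
  shows "(D1 y has_real_derivative D2 y z) (at z within {0..Z})"
proof -
  let ?J = "\<lambda>z. integral {0..1} (\<lambda>s. (1 - z * alpha_root s) powr (\<beta> - 1) * g (y (z * alpha_root s)))"
  let ?J' = "integral {0..1} (\<lambda>s. alpha_root s *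
         (- (\<beta> - 1) * (1 - z * alpha_root s) powr (\<beta> - 2) * g (y (z * alpha_root s))
          + (1 - z * alpha_root s) powr (\<beta> - 1) * (g' (y (z * alpha_root s)) * D1 y (z * alpha_root s))))"
  interpret P: power_average \<alpha> "\<lambda>t. (1 - t) powr (\<beta> - 1) * g (y t)"
    "\<lambda>t. - (\<beta> - 1) * (1 - t) powr (\<beta> - 2) * g (y t)
          + (1 - t) powr (\<beta> - 1) * (g' (y t) * D1 y t)" Z
    by (rule power_average)
  have J: "(?J has_real_derivative ?J') (at z within {0..Z})"
    using P.average_DERIV[OF z] unfolding alpha_root_def .
  have "((\<lambda>z. (1 - z) powr (-\<beta>) * ?J z) has_real_derivative
      - (-\<beta>) * (1 - z) powr (-\<beta> - 1) * ?J z + ?J' * (1 - z) powr (-\<beta>)) (at z within {0..Z})"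
    using z Z by (intro DERIV_mult DERIV_one_minus_powr J) auto
  then have "((\<lambda>z. - (\<kappa> / \<alpha>) * ((1 - z) powr (-\<beta>) * ?J z)) has_real_derivative
      - (\<kappa> / \<alpha>) * (- (-\<beta>) * (1 - z) powr (-\<beta> - 1) * ?J z + ?J' * (1 - z) powr (-\<beta>))) (at z within {0..Z})"
    by (rule DERIV_cmult)
  moreover have "D1 y = (\<lambda>z. - (\<kappa> / \<alpha>) * ((1 - z) powr (-\<beta>) * ?J z))"
    by (rule ext) (simp only: D1_alt mult.assoc)
  moreover have "D2 y z = - (\<kappa> / \<alpha>) * (- (-\<beta>) * (1 - z) powr (-\<beta> - 1) * ?J z + ?J' * (1 - z) powr (-\<beta>))"
    by (simp only: D2_def minus_minus mult_1 mult.commute[of ?J'])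
  ultimately show ?thesis by simp
qed

text \<open>The average \<open>J\<close> in \<open>D1 y\<close> satisfies \<open>z / \<alpha> * J' + J = (1 - z) powr (\<beta> - 1) * g (y z)\<close>; this removes
  \<open>J'\<close> from \<open>z * (1 - z) * D2 y z\<close>.\<close>

lemma sol_ode:
  assumes z: "z \<in> {0..Z}"
  shows "z * (1 - z) * D2 y z + (\<alpha> - (\<alpha> + \<beta>) * z) * D1 y z + \<kappa> * g (y z) = 0"
proof -
  define J where "J = integral {0..1} (\<lambda>s. (1 - z * alpha_root s) powr (\<beta> - 1) * g (y (z * alpha_root s)))"
  define J' where "J' = integral {0..1} (\<lambda>s. alpha_root s *
         (- (\<beta> - 1) * (1 - z * alpha_root s) powr (\<beta> - 2) * g (y (z * alpha_root s))
          + (1 - z * alpha_root s) powr (\<beta> - 1) * (g' (y (z * alpha_root s)) * D1 y (z * alpha_root s))))"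
  interpret P: power_average \<alpha> "\<lambda>t. (1 - t) powr (\<beta> - 1) * g (y t)"
    "\<lambda>t. - (\<beta> - 1) * (1 - t) powr (\<beta> - 2) * g (y t)
          + (1 - t) powr (\<beta> - 1) * (g' (y t) * D1 y t)" Z
    by (rule power_average)
  have id: "z / \<alpha> * J' + J = (1 - z) powr (\<beta> - 1) * g (y z)"
    using P.average_identity[OF z] unfolding alpha_root_def J_def J'_def .
  define q where "q = (1 - z) powr (-\<beta>)"
  have z1: "0 < 1 - z" using z Z by auto
  have q0: "q > 0" using z1 by (simp add: q_def)
  have q1: "(1 - z) * (1 - z) powr (-\<beta> - 1) = q" using z1 by (simp add: q_def powr_diff)
  have q2: "(1 - z) * q * (1 - z) powr (\<beta> - 1) = 1"
    using z1 by (simp add: q_def powr_diff powr_minus field_simps)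
  have d1: "D1 y z = - (\<kappa> / \<alpha>) * q * J" by (simp only: D1_alt q_def J_def)
  have d2: "D2 y z = - (\<kappa> / \<alpha>) * (\<beta> * (1 - z) powr (-\<beta> - 1) * J + q * J')"
    by (simp only: D2_def q_def J_def J'_def mult_1)
  have "z * (1 - z) * D2 y z = - (\<kappa> / \<alpha>) * (z * \<beta> * ((1 - z) * (1 - z) powr (-\<beta> - 1)) * J + z * (1 - z) * q * J')"
    unfolding d2 by algebra
  also have "\<dots> = \<beta> * z * D1 y z - (\<kappa> / \<alpha>) * z * (1 - z) * q * J'"
    unfolding q1 d1 by algebra
  also have "(\<kappa> / \<alpha>) * z * (1 - z) * q * J' = \<kappa> * ((1 - z) * q) * (z / \<alpha> * J')" by simp
  also have "z / \<alpha> * J' = (1 - z) powr (\<beta> - 1) * g (y z) - J" using id by linarith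
  also have "\<kappa> * ((1 - z) * q) * ((1 - z) powr (\<beta> - 1) * g (y z) - J)
      = \<kappa> * ((1 - z) * q * (1 - z) powr (\<beta> - 1)) * g (y z) - \<kappa> * ((1 - z) * q) * J"
    by (simp add: algebra_simps)
  also have "\<dots> = \<kappa> * g (y z) + \<alpha> * (1 - z) * D1 y z"
    unfolding q2 d1 using \<alpha>_pos by (simp add: field_simps)
  finally show ?thesis by (simp add: algebra_simps)
qed

end

end

section \<open>Energy and global solutions\<close>

text \<open>Gronwall: \<open>f t * exp (- c * (t - a))\<close> is decreasing.\<close>

lemma exponential_upper_bound:
  fixes f :: "real \<Rightarrow> real"
  assumes cont: "continuous_on {a..b} f"
    and der: "\<And>z. \<lbrakk>a < z; z < b\<rbrakk> \<Longrightarrow> \<exists>d. (f has_real_derivative d) (at z) \<and> d \<le> c * f z"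
    and z: "a \<le> z" "z \<le> b"
  shows "f z \<le> f a * exp (c * (z - a))"
proof -
  let ?h = "\<lambda>t. f t * exp (- c * (t - a))"
  have "?h z \<le> ?h a"
  proof (rule DERIV_nonpos_imp_decreasing_open[OF z(1)])
    fix t assume t: "a < t" "t < z"
    then obtain d where d: "(f has_real_derivative d) (at t)" "d \<le> c * f t"
      using der[of t] z by auto
    have "(?h has_real_derivative d * exp (- c * (t - a)) + exp (- c * (t - a)) * (- c) * f t) (at t)"
      by (rule DERIV_mult[OF d(1)]) (auto intro!: derivative_eq_intros)
    moreover have "d * exp (- c * (t - a)) + exp (- c * (t - a)) * (- c) * f t
        = (d - c * f t) * exp (- c * (t - a))"
      by (simp add: algebra_simps)
    moreover have "(d - c * f t) * exp (- c * (t - a)) \<le> 0"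
      using d(2) by (intro mult_nonpos_nonneg) auto
    ultimately show "\<exists>e. (?h has_real_derivative e) (at t) \<and> e \<le> 0" by metis
  next
    show "continuous_on {a..z} ?h"
      by (intro continuous_intros continuous_on_subset[OF cont]) (use z in auto)
  qed
  then have "?h z * exp (c * (z - a)) \<le> ?h a * exp (c * (z - a))" by (intro mult_right_mono) auto
  moreover have "?h z * exp (c * (z - a)) = f z" by (simp add: exp_minus)
  moreover have "?h a = f a" by simp
  ultimately show ?thesis by (simp only:)
qed

lemma exponential_lower_bound:
  fixes f :: "real \<Rightarrow> real"
  assumes cont: "continuous_on {a..b} f"
    and der: "\<And>z. \<lbrakk>a < z; z < b\<rbrakk> \<Longrightarrow> \<exists>d. (f has_real_derivative d) (at z) \<and> c * f z \<le> d"
    and z: "a \<le> z" "z \<le> b"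
  shows "f a * exp (c * (z - a)) \<le> f z"
proof -
  have "- f z \<le> - f a * exp (c * (z - a))"
  proof (rule exponential_upper_bound[where b = b])
    show "continuous_on {a..b} (\<lambda>x. - f x)" by (intro continuous_intros cont)
    fix t assume "a < t" "t < b"
    then obtain d where d: "(f has_real_derivative d) (at t)" "c * f t \<le> d" using der by blast
    then have "((\<lambda>x. - f x) has_real_derivative - d) (at t)" by (intro DERIV_minus)
    then show "\<exists>d. ((\<lambda>x. - f x) has_real_derivative d) (at t) \<and> d \<le> c * - f t" using d(2) by auto
  qed (use z in auto)
  then show ?thesis by simp
qed

lemma continuous_on_Times_lipschitz:
  fixes f :: "real \<Rightarrow> real \<Rightarrow> real"
  assumes cont: "\<And>a. continuous_on T (f a)"
    and lip: "\<And>A. \<exists>K. \<forall>a b. \<forall>z\<in>T. \<bar>a\<bar> \<le> A \<longrightarrow> \<bar>b\<bar> \<le> A \<longrightarrow> \<bar>f a z - f b z\<bar> \<le> K * \<bar>a - b\<bar>"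
  shows "continuous_on (UNIV \<times> T) (\<lambda>x. f (fst x) (snd x))"
  unfolding continuous_on_iff
proof (intro ballI allI impI)
  fix x :: "real \<times> real" and \<epsilon> :: real assume x: "x \<in> UNIV \<times> T" and "0 < \<epsilon>"
  obtain a z where [simp]: "x = (a, z)" by (cases x)
  obtain K where K: "\<And>b c w. w \<in> T \<Longrightarrow> \<bar>b\<bar> \<le> \<bar>a\<bar> + 1 \<Longrightarrow> \<bar>c\<bar> \<le> \<bar>a\<bar> + 1 \<Longrightarrow> \<bar>f b w - f c w\<bar> \<le> K * \<bar>b - c\<bar>"
    using lip[of "\<bar>a\<bar> + 1"] by blast
  obtain \<delta> where \<delta>: "\<delta> > 0" "\<And>w. w \<in> T \<Longrightarrow> dist w z < \<delta> \<Longrightarrow> dist (f a w) (f a z) < \<epsilon> / 2"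
    using cont[of a] x \<open>0 < \<epsilon>\<close> unfolding continuous_on_iff by (metis \<open>x = (a, z)\<close> half_gt_zero mem_Times_iff snd_conv)
  define d where "d = min \<delta> (min 1 (\<epsilon> / (2 * (\<bar>K\<bar> + 1))))"
  have "d > 0" using \<delta> \<open>0 < \<epsilon>\<close> by (simp add: d_def)
  have "dist (f b w) (f a z) < \<epsilon>" if w: "w \<in> T" and d: "dist (b, w) (a, z) < d" for b w
  proof -
    have db: "\<bar>b - a\<bar> < d" "dist w z < d"
      using d dist_fst_le[of "(b, w)" "(a, z)"] dist_snd_le[of "(b, w)" "(a, z)"]
      by (auto simp: dist_real_def)
    then have "\<bar>b\<bar> \<le> \<bar>a\<bar> + 1" by (auto simp: d_def)
    then have "\<bar>f b w - f a w\<bar> \<le> K * \<bar>b - a\<bar>" using K[of w b a] w by simp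
    also have "\<dots> \<le> (\<bar>K\<bar> + 1) * \<bar>b - a\<bar>" by (intro mult_right_mono) auto
    also have "\<dots> \<le> (\<bar>K\<bar> + 1) * (\<epsilon> / (2 * (\<bar>K\<bar> + 1)))"
      using db by (intro mult_left_mono) (auto simp: d_def)
    also have "\<dots> = \<epsilon> / 2" by (simp add: field_simps)
    finally have "\<bar>f b w - f a w\<bar> \<le> \<epsilon> / 2" .
    moreover have "dist (f a w) (f a z) < \<epsilon> / 2" using \<delta>(2)[OF w] db by (simp add: d_def)
    ultimately show ?thesis unfolding dist_real_def by linarith
  qed
  then show "\<exists>d>0. \<forall>x'\<in>UNIV \<times> T. dist x' x < d \<longrightarrow> dist (f (fst x') (snd x')) (f (fst x) (snd x)) < \<epsilon>"
    using \<open>d > 0\<close> by (intro exI[of _ d]) auto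
qed

context jacobi_shooting
begin

text \<open>Kinetic plus potential energy, the coefficient \<open>z * (1 - z)\<close> of \<open>y''\<close> playing the role of the
  mass.  The constant \<open>c0\<close> makes the potential part dominate \<open>\<kappa> * y\<^sup>2 / 2\<close>.\<close>

definition energy :: "(real \<Rightarrow> real) \<Rightarrow> real \<Rightarrow> real" where
  "energy y z = z * (1 - z) * (D1 y z)\<^sup>2 / 2 + \<kappa> * (G (y z) + c0)"

context
  fixes Z a y
  assumes Z: "0 \<le> Z" "Z \<le> 1/2" and sol: "solves g Z a y"
begin

lemma sol_DERIV_interior:
  assumes "0 < z" "z < Z"
  shows "(y has_real_derivative D1 y z) (at z)" "(D1 y has_real_derivative D2 y z) (at z)"
  using sol_DERIV[OF Z sol, of z] D1_DERIV[OF Z sol, of z] at_within_Icc_at[of 0 z Z] assms by auto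

lemma energy_cont: "continuous_on {0..Z} (energy y)"
  unfolding energy_def
  by (intro continuous_intros G_cont D1_cont[OF Z sol] sol_cont[OF Z sol]) auto

lemma energy_DERIV:
  assumes z: "0 < z" "z < Z"
  shows "(energy y has_real_derivative - ((\<alpha> - 1/2) - (\<alpha> + \<beta> - 1) * z) * (D1 y z)\<^sup>2) (at z)"
proof -
  note d = sol_DERIV_interior[OF z]
  have e: "z * (1 - z) * D2 y z = - (\<alpha> - (\<alpha> + \<beta>) * z) * D1 y z - \<kappa> * g (y z)"
    using sol_ode[OF Z sol, of z] z by (simp add: algebra_simps)
  have G: "((\<lambda>z. G (y z)) has_real_derivative g (y z) * D1 y z) (at z)"
    by (rule DERIV_chain2[OF DERIV_G d(1)])
  have "(energy y has_real_derivative
      ((1 - 2 * z) * (D1 y z)\<^sup>2 + z * (1 - z) * (2 * D1 y z * D2 y z)) / 2 + \<kappa> * (g (y z) * D1 y z)) (at z)"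
    unfolding energy_def[abs_def]
    by (auto intro!: derivative_eq_intros d G simp: field_simps)
  moreover have "((1 - 2 * z) * (D1 y z)\<^sup>2 + z * (1 - z) * (2 * D1 y z * D2 y z)) / 2 + \<kappa> * (g (y z) * D1 y z)
      = (1/2 - z) * (D1 y z)\<^sup>2 + D1 y z * (z * (1 - z) * D2 y z) + \<kappa> * (g (y z) * D1 y z)"
    by (simp add: field_simps)
  moreover have "\<dots> = - ((\<alpha> - 1/2) - (\<alpha> + \<beta> - 1) * z) * (D1 y z)\<^sup>2"
    unfolding e by (simp add: algebra_simps power2_eq_square)
  ultimately show ?thesis by simp
qed

lemma energy_bounds:
  assumes z: "z \<in> {0..Z}"
  shows "0 \<le> energy y z" "\<kappa> * (y z)\<^sup>2 / 2 \<le> energy y z" "z * (1 - z) * (D1 y z)\<^sup>2 / 2 \<le> energy y z"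
proof -
  have "0 \<le> z * (1 - z) * (D1 y z)\<^sup>2 / 2" using z Z by (intro divide_nonneg_pos mult_nonneg_nonneg) auto
  moreover have "\<kappa> * ((y z)\<^sup>2 / 2) \<le> \<kappa> * (G (y z) + c0)"
    using G_lower[of "y z"] \<kappa> by (intro mult_left_mono) auto
  moreover have "0 \<le> \<kappa> * ((y z)\<^sup>2 / 2)" using \<kappa> by simp
  ultimately show "0 \<le> energy y z" "\<kappa> * (y z)\<^sup>2 / 2 \<le> energy y z"
    "z * (1 - z) * (D1 y z)\<^sup>2 / 2 \<le> energy y z"
    unfolding energy_def by simp_all
qed

text \<open>Near \<open>z = 0\<close> the first order term of the equation is friction because \<open>\<alpha> \<ge> 1/2\<close>.  What may act
  against it is of size \<open>z * y'\<^sup>2\<close>, hence bounded by the energy itself.\<close>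

lemma energy_upper:
  assumes z: "z \<in> {0..Z}"
  shows "energy y z \<le> \<kappa> * (G a + c0) * exp (4 * (\<alpha> + \<beta>))"
proof -
  have ab: "0 \<le> \<alpha> + \<beta> - 1" using \<alpha> \<beta> by simp
  have "energy y z \<le> energy y 0 * exp (4 * (\<alpha> + \<beta>) * (z - 0))"
  proof (rule exponential_upper_bound[OF energy_cont])
    fix t assume t: "0 < t" "t < Z"
    let ?D = "(D1 y t)\<^sup>2"
    have "- ((\<alpha> - 1/2) - (\<alpha> + \<beta> - 1) * t) * ?D \<le> ((\<alpha> + \<beta> - 1) * t) * ?D"
      using \<alpha> by (intro mult_right_mono) auto
    also have "\<dots> \<le> ((\<alpha> + \<beta>) * t) * ?D" using t by (intro mult_right_mono) auto
    also have "\<dots> \<le> ((\<alpha> + \<beta>) * t) * (2 * (1 - t)) * ?D"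
    proof (intro mult_right_mono)
      have "((\<alpha> + \<beta>) * t) * 1 \<le> ((\<alpha> + \<beta>) * t) * (2 * (1 - t))"
        using t Z ab by (intro mult_left_mono) auto
      then show "(\<alpha> + \<beta>) * t \<le> (\<alpha> + \<beta>) * t * (2 * (1 - t))" by simp
    qed simp
    also have "\<dots> = 4 * (\<alpha> + \<beta>) * (t * (1 - t) * ?D / 2)" by algebra
    also have "\<dots> \<le> 4 * (\<alpha> + \<beta>) * energy y t"
      using energy_bounds(3)[of t] t ab by (intro mult_left_mono) auto
    finally show "\<exists>d. (energy y has_real_derivative d) (at t) \<and> d \<le> 4 * (\<alpha> + \<beta>) * energy y t"
      using energy_DERIV[OF t] by blast
  qed (use z in auto)
  also have "energy y 0 = \<kappa> * (G a + c0)" by (simp add: energy_def sol_0[OF Z sol])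
  also have "\<kappa> * (G a + c0) * exp (4 * (\<alpha> + \<beta>) * (z - 0)) \<le> \<kappa> * (G a + c0) * exp (4 * (\<alpha> + \<beta>) * 1)"
    using z Z ab \<kappa> order_trans[OF _ G_lower[of a]]
    by (intro mult_left_mono) (auto intro!: mult_left_le)
  finally show ?thesis by simp
qed

end

text \<open>The square root comes from \<open>energy_upper\<close>; the summand \<open>A\<close> keeps the initial values with
  \<open>\<bar>a\<bar> \<le> A\<close> themselves below the bound.\<close>

definition bnd :: "real \<Rightarrow> real" where
  "bnd A = sqrt (2 * (A powr r * A\<^sup>2 / (r + 2) + c0) * exp (4 * (\<alpha> + \<beta>))) + A"

lemma a_priori_bound:
  assumes Z: "0 \<le> Z" "Z \<le> 1/2" and sol: "solves g Z a y" and a: "\<bar>a\<bar> \<le> A" and z: "z \<in> {0..Z}"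
  shows "\<bar>y z\<bar> \<le> bnd A"
proof -
  have "\<kappa> * ((y z)\<^sup>2 / 2) \<le> \<kappa> * ((G a + c0) * exp (4 * (\<alpha> + \<beta>)))"
    using energy_bounds(2)[OF Z sol z] energy_upper[OF Z sol z] by simp
  then have "(y z)\<^sup>2 / 2 \<le> (G a + c0) * exp (4 * (\<alpha> + \<beta>))" using \<kappa> by simp
  also have "\<dots> \<le> (A powr r * A\<^sup>2 / (r + 2) + c0) * exp (4 * (\<alpha> + \<beta>))"
    using G_upper[OF a] by (intro mult_right_mono) auto
  finally have "sqrt ((y z)\<^sup>2) \<le> sqrt (2 * (A powr r * A\<^sup>2 / (r + 2) + c0) * exp (4 * (\<alpha> + \<beta>)))"
    by (intro real_sqrt_le_mono) linarith
  then show ?thesis using a by (simp add: bnd_def)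
qed

definition cutoff :: "real \<Rightarrow> real \<Rightarrow> real" where "cutoff R s = g (max (-R) (min R s))"

lemma cutoff_id: "\<bar>s\<bar> \<le> R \<Longrightarrow> cutoff R s = g s"
  by (auto simp: cutoff_def intro!: arg_cong[of _ _ g])

lemma cutoff_lipschitz:
  assumes "0 \<le> R"
  shows "\<bar>cutoff R s - cutoff R t\<bar> \<le> ((r + 1) * R powr r + 1) * \<bar>s - t\<bar>"
proof -
  let ?c = "\<lambda>s. max (-R) (min R s)"
  have "norm (g (?c s) - g (?c t)) \<le> ((r + 1) * R powr r + 1) * norm (?c s - ?c t)"
  proof (rule field_differentiable_bound[of "{-R..R}" g g'])
    fix u assume u: "u \<in> {-R..R}"
    show "(g has_real_derivative g' u) (at u within {-R..R})" by (rule has_field_derivative_at_within[OF DERIV_g])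
    have "\<bar>u\<bar> powr r \<le> R powr r" using u r by (intro powr_mono2) auto
    then have "(r + 1) * \<bar>u\<bar> powr r \<le> (r + 1) * R powr r" using r by (intro mult_left_mono) auto
    moreover have "0 \<le> (r + 1) * \<bar>u\<bar> powr r" using r by simp
    ultimately show "norm (g' u) \<le> (r + 1) * R powr r + 1" unfolding g'_def by (simp add: abs_le_iff)
  qed (use assms in auto)
  also have "\<dots> \<le> ((r + 1) * R powr r + 1) * \<bar>s - t\<bar>"
    using r by (intro mult_left_mono) auto
  finally show ?thesis by (simp add: cutoff_def)
qed

lemma solves_cong:
  assumes "Z \<le> 1/2" "\<And>t. t \<in> {0..Z} \<Longrightarrow> G1 (y t) = G2 (y t)" "solves G1 Z a y"
  shows "solves G2 Z a y"
proof -
  have "avg (\<lambda>t. G1 (y t)) u = avg (\<lambda>t. G2 (y t)) u" if "u \<in> {0..Z}" for u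
    unfolding avg_def using that assms(2) scaled_root[of u Z]
    by (intro integral_cong) auto
  then have "integral {0..z} (avg (\<lambda>t. G1 (y t))) = integral {0..z} (avg (\<lambda>t. G2 (y t)))" if "z \<in> {0..Z}" for z
    using that by (intro integral_cong) auto
  then show ?thesis using assms(3) by (simp add: solves_def)
qed

lemma solves_restrict:
  "solves G1 Z a y \<Longrightarrow> z \<le> Z \<Longrightarrow> solves G1 z a y"
  by (auto simp: solves_def elim: continuous_on_subset)

text \<open>Truncated at height \<open>R\<close>, the nonlinearity is Lipschitz and the equation is solvable on
  \<open>{0..1/2}\<close>.  As long as \<open>\<bar>y\<bar> \<le> R\<close>, the solution solves the original equation, so the a priori
  bound gives \<open>\<bar>y\<bar> \<le> bnd \<bar>a\<bar> < R\<close>; by the barrier principle the truncation is never reached.\<close>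

lemma global_solution_exists: "\<exists>y. solves g (1/2) a y"
proof -
  define R where "R = bnd \<bar>a\<bar> + 1"
  have R: "\<bar>a\<bar> < R" using c0_nonneg r by (simp add: R_def bnd_def add_pos_nonneg add_nonneg_pos)
  then have "0 \<le> R" by linarith
  obtain y where y: "solves (cutoff R) (1/2) a y"
    using solution_exists[of "cutoff R", OF cutoff_lipschitz[OF \<open>0 \<le> R\<close>]] by blast
  have y0: "y 0 = a" using y by (simp add: solves_def)
  have "0 < R - \<bar>y z\<bar>" if z: "0 \<le> z" "z \<le> 1/2" for z
  proof (rule barrier_principle[of "1/2" "\<lambda>z. R - \<bar>y z\<bar>"])
    show "continuous_on {0..1/2} (\<lambda>z. R - \<bar>y z\<bar>)"
      using y by (auto simp: solves_def intro!: continuous_intros)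
    fix x :: real assume x: "0 \<le> x" "x \<le> 1/2" and le: "\<And>t. 0 \<le> t \<Longrightarrow> t \<le> x \<Longrightarrow> 0 \<le> R - \<bar>y t\<bar>"
    have "solves g x a y"
      by (rule solves_cong[where ?G1.0 = "cutoff R"])
         (use x le y in \<open>auto intro!: cutoff_id intro: solves_restrict\<close>)
    then have "\<bar>y x\<bar> \<le> bnd \<bar>a\<bar>" using a_priori_bound[of x a y "\<bar>a\<bar>" x] x by simp
    then show "0 < R - \<bar>y x\<bar>" by (simp add: R_def)
  qed (use R y0 z in auto)
  then have "solves g (1/2) a y"
    by (intro solves_cong[OF _ _ y] cutoff_id) force+
  then show ?thesis by blast
qed

definition Y :: "real \<Rightarrow> real \<Rightarrow> real" where "Y a = (SOME y. solves g (1/2) a y)"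

lemma Y_solves: "solves g (1/2) a (Y a)"
  unfolding Y_def by (rule someI_ex[OF global_solution_exists])

lemma half: "0 \<le> (1/2::real)" "1/2 \<le> (1/2::real)" by auto

text \<open>By the a priori bound all solutions with \<open>\<bar>a\<bar> \<le> A\<close> solve the equation with one and the same
  truncation, and stability for Lipschitz nonlinearities applies.\<close>

lemma Y_joint_cont: "continuous_on (UNIV \<times> {0..1/2}) (\<lambda>x. Y (fst x) (snd x))"
proof (rule continuous_on_Times_lipschitz)
  show "continuous_on {0..1/2} (Y a)" for a by (rule sol_cont[OF half Y_solves])
  fix A :: real
  define R where "R = max 0 (bnd A)"
  let ?L = "(r + 1) * R powr r + 1"
  let ?K = "2 * exp (2 * (kern_bound + 1) * (?L + 1) * (1/2))"
  have kb: "0 \<le> kern_bound" by (rule C_nonneg)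
  have "\<bar>Y a z - Y b z\<bar> \<le> ?K * \<bar>a - b\<bar>" if z: "z \<in> {0..1/2}" and ab: "\<bar>a\<bar> \<le> A" "\<bar>b\<bar> \<le> A" for a b z
  proof -
    have cut: "solves (cutoff R) (1/2) c (Y c)" if "\<bar>c\<bar> \<le> A" for c
    proof (rule solves_cong[OF _ _ Y_solves])
      fix t :: real assume "t \<in> {0..1/2}"
      then have "\<bar>Y c t\<bar> \<le> R" using a_priori_bound[OF half Y_solves that, of t] by (simp add: R_def)
      then show "g (Y c t) = cutoff R (Y c t)" by (simp add: cutoff_id)
    qed simp
    have "\<bar>Y a z - Y b z\<bar> \<le> 2 * \<bar>a - b\<bar> * exp (2 * (kern_bound + 1) * (?L + 1) * z)"
      by (rule solutions_stable[OF cutoff_lipschitz _ _ cut[OF ab(1)] cut[OF ab(2)]])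
         (use z in \<open>auto simp: R_def\<close>)
    also have "\<dots> \<le> 2 * \<bar>a - b\<bar> * exp (2 * (kern_bound + 1) * (?L + 1) * (1/2))"
      using z kb r by (intro mult_left_mono iffD2[OF exp_le_cancel_iff]) auto
    finally show ?thesis by (simp only: mult_ac)
  qed
  then show "\<exists>K. \<forall>a b. \<forall>z\<in>{0..1/2}. \<bar>a\<bar> \<le> A \<longrightarrow> \<bar>b\<bar> \<le> A \<longrightarrow> \<bar>Y a z - Y b z\<bar> \<le> K * \<bar>a - b\<bar>"
    by blast
qed

lemma D1_joint_cont: "continuous_on (UNIV \<times> {0..1/2}) (\<lambda>x. D1 (Y (fst x)) (snd x))"
  unfolding D1_def avg_def
  by (rule scaled_integral_continuous[OF kern_cont[unfolded case_prod_beta] root_cont root_range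
        g_cont[OF Y_joint_cont]])

lemma D2_joint_cont: "continuous_on (UNIV \<times> {0..1/2}) (\<lambda>x. D2 (Y (fst x)) (snd x))"
proof -
  let ?U = "UNIV \<times> {0..1/2::real}"
  have s: "continuous_on ?U (\<lambda>x. snd x)" by (intro continuous_intros)
  have p: "continuous_on ?U (\<lambda>x. (1 - snd x) powr c)" for c
    by (rule one_minus_powr_cont[where Z = "1/2", OF _ s]) auto
  have A: "continuous_on ?U (\<lambda>x. integral {0..1} (\<lambda>s. 1 * ((1 - snd x * alpha_root s) powr (\<beta> - 1) * g (Y (fst x) (snd x * alpha_root s)))))"
    by (rule scaled_integral_continuous[where w = "\<lambda>_ _. 1" and h = "\<lambda>a t. (1 - t) powr (\<beta> - 1) * g (Y a t)",
          OF continuous_on_const root_cont root_range], assumption, assumption)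
       (intro continuous_on_mult p g_cont Y_joint_cont)
  have B: "continuous_on ?U (\<lambda>x. integral {0..1} (\<lambda>s. alpha_root s *
         (- (\<beta> - 1) * (1 - snd x * alpha_root s) powr (\<beta> - 2) * g (Y (fst x) (snd x * alpha_root s))
          + (1 - snd x * alpha_root s) powr (\<beta> - 1) * (g' (Y (fst x) (snd x * alpha_root s)) * D1 (Y (fst x)) (snd x * alpha_root s)))))"
  proof (rule scaled_integral_continuous[where w = "\<lambda>_ s. alpha_root s" and h = "\<lambda>a t. - (\<beta> - 1) * (1 - t) powr (\<beta> - 2) * g (Y a t)
          + (1 - t) powr (\<beta> - 1) * (g' (Y a t) * D1 (Y a) t)", OF _ root_cont root_range])
    show "continuous_on ({0..1/2} \<times> {0..1}) (\<lambda>x. alpha_root (snd x))"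
      by (rule continuous_on_compose2[OF root_cont]) (auto intro!: continuous_intros)
  qed (assumption, assumption, intro continuous_on_add continuous_on_mult continuous_on_const p g_cont g'_cont Y_joint_cont D1_joint_cont)
  show ?thesis unfolding D2_def
    by (intro continuous_on_add continuous_on_mult continuous_on_const p A B)
qed

end

section \<open>A Pohozaev functional\<close>

context jacobi_shooting
begin

lemma kern_bound_pos: "0 < kern_bound"
  using \<kappa> \<alpha>_pos by (simp add: kern_bound_def)

lemma g_nonneg: "1 \<le> s \<Longrightarrow> 0 \<le> g s"
  using r by (simp add: g_def ge_one_powr_ge_zero)

lemma D1_nonpos:
  assumes sol: "solves g Z a y" "0 \<le> Z" "Z \<le> 1/2" and ge: "\<And>t. t \<in> {0..Z} \<Longrightarrow> 1 \<le> y t" and z: "z \<in> {0..Z}"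
  shows "D1 y z \<le> 0"
proof -
  have "integral {0..1} (\<lambda>s. kern z s * g (y (z * alpha_root s))) \<le> integral {0..1::real} (\<lambda>s. 0)"
  proof (rule integral_le)
    show "(\<lambda>s. kern z s * g (y (z * alpha_root s))) integrable_on {0..1}"
      by (rule avg_integrable[OF g_cont[OF sol_cont[OF sol(2,3,1)]] sol(3)]) (use z in auto)
    fix s :: real assume s: "s \<in> {0..1}"
    have "0 \<le> g (y (z * alpha_root s))" using ge scaled_root[of z Z s] s z by (intro g_nonneg) auto
    moreover have "kern z s \<le> 0" unfolding kern_def using \<kappa> \<alpha>_pos
      by (intro mult_nonpos_nonneg) auto
    ultimately show "kern z s * g (y (z * alpha_root s)) \<le> 0" by (rule mult_nonpos_nonneg[rotated])
  qed (simp add: integrable_0)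
  then show ?thesis by (simp add: D1_def avg_def)
qed

lemma D1_abs_bound:
  assumes sol: "solves g Z a y" "0 \<le> Z" "Z \<le> 1/2"
    and le: "\<And>t. t \<in> {0..Z} \<Longrightarrow> \<bar>g (y t)\<bar> \<le> m" and z: "z \<in> {0..Z}"
  shows "\<bar>D1 y z\<bar> \<le> kern_bound * m"
  using avg_diff_bound[OF g_cont[OF sol_cont[OF sol(2,3,1)]] continuous_on_const[of _ 0] sol(3), of z m] le z
  by (simp add: D1_def avg_def)

text \<open>The length of an interval on which the solution stays comparable with its initial value
  \<open>a\<close>, by \<open>plateau_lower_bound\<close>; its order \<open>a powr (- r)\<close> is the natural scale of the equation.\<close>

definition plateau :: "real \<Rightarrow> real" where "plateau a = a powr (-r) / (4 * kern_bound)"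

text \<open>While \<open>y \<ge> a / 2 \<ge> 1\<close>, the solution decreases, so it stays below \<open>a\<close> and its slope is at most
  \<open>kern_bound * a powr (r + 1)\<close>.  On the plateau it thus loses at most \<open>a / 4\<close>, and the barrier
  principle applies.\<close>

lemma plateau_lower_bound:
  assumes a: "2 \<le> a" and z: "0 \<le> z" "z \<le> 1/2" "z \<le> plateau a"
  shows "a / 2 < Y a z"
proof (rule barrier_principle[of z "Y a" "a / 2"])
  note Ysol = solves_restrict[OF Y_solves]
  show "continuous_on {0..z} (Y a)" 
    by (rule continuous_on_subset[OF sol_cont[OF half Y_solves]]) (use z in auto)
  show "a / 2 < Y a 0" using sol_0[OF half Y_solves] a by simp
  fix x assume x: "0 \<le> x" "x \<le> z" and low: "\<And>t. \<lbrakk>0 \<le> t; t \<le> x\<rbrakk> \<Longrightarrow> a / 2 \<le> Y a t"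
  have x2: "x \<le> 1/2" using x z by simp
  have sx: "solves g x a (Y a)" using Ysol x2 by simp
  have one: "1 \<le> Y a t" if "t \<in> {0..x}" for t using low[of t] a that by simp
  have up: "Y a t \<le> a" if t: "t \<in> {0..x}" for t
  proof -
    have "Y a t \<le> Y a 0"
    proof (rule DERIV_nonpos_imp_decreasing_open[where f = "Y a"])
      show "continuous_on {0..t} (Y a)" using sol_cont[OF x(1) x2 sx] t by (auto intro: continuous_on_subset)
      fix u assume u: "0 < u" "u < t"
      show "\<exists>d. (Y a has_real_derivative d) (at u) \<and> d \<le> 0"
        using sol_DERIV_interior(1)[OF x(1) x2 sx, of u] D1_nonpos[OF sx x(1) x2 one, of u] u t by auto
    qed (use t in auto)
    then show ?thesis using sol_0[OF half Y_solves] by simp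
  qed
  have gb: "\<bar>g (Y a t)\<bar> \<le> a powr r * a" if t: "t \<in> {0..x}" for t
  proof -
    have "\<bar>Y a t\<bar> powr r * Y a t \<le> a powr r * a"
      using one[OF t] up[OF t] r by (intro mult_mono powr_mono2) auto
    then show ?thesis using g_nonneg[OF one[OF t]] one[OF t] by (simp add: g_def)
  qed
  let ?K = "kern_bound * (a powr r * a)"
  have "Y a 0 + ?K * 0 \<le> Y a x + ?K * x"
  proof (rule DERIV_nonneg_imp_increasing_open[where f = "\<lambda>x. Y a x + ?K * x"])
    show "continuous_on {0..x} (\<lambda>x. Y a x + ?K * x)"
      by (intro continuous_intros sol_cont[OF x(1) x2 sx])
    fix u assume u: "0 < u" "u < x"
    have "((\<lambda>x. Y a x + ?K * x) has_real_derivative D1 (Y a) u + ?K * 1) (at u)"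
      by (intro DERIV_add DERIV_cmult DERIV_ident sol_DERIV_interior(1)[OF x(1) x2 sx u])
    moreover have "0 \<le> D1 (Y a) u + ?K * 1"
      using D1_abs_bound[OF sx x(1) x2 gb, of u] u by auto
    ultimately show "\<exists>d. ((\<lambda>x. Y a x + ?K * x) has_real_derivative d) (at u) \<and> 0 \<le> d" by blast
  qed (use x in auto)
  moreover have "?K * x \<le> ?K * plateau a"
    using x z kern_bound_pos a by (intro mult_left_mono) auto
  moreover have "?K * plateau a = a / 4"
    using kern_bound_pos a by (simp add: plateau_def powr_minus field_simps)
  ultimately have "a \<le> Y a x + a / 4" using sol_0[OF half Y_solves, of a] by linarith
  then show "a / 2 < Y a x" using a by simp
qed (use z in auto)

text \<open>The coefficients of the Pohozaev functional.  They are determined by the requirement that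
  \<open>\<alpha> P + z P'\<close> contain neither \<open>y'\<^sup>2\<close> nor \<open>y y'\<close>: the terms \<open>y'\<^sup>2\<close> fix the multiplier
  \<open>b0 - \<eta> * z\<close> of \<open>y y'\<close> in \<open>P\<close>, and the terms \<open>y y'\<close> fix the coefficient \<open>h0 + h1 * z\<close> of \<open>y\<^sup>2\<close>.\<close>

definition b0 :: real where "b0 = (\<alpha> - 1) / 2"
definition \<eta> :: real where "\<eta> = \<alpha> / 2 + \<beta> - 3 / 2"
definition h0 :: real where "h0 = b0 * (\<beta> - 1) - \<eta>"
definition h1 :: real where "h1 = \<eta> * (2 - \<beta>)"

definition pohozaev :: "(real \<Rightarrow> real) \<Rightarrow> real \<Rightarrow> real" where
  "pohozaev y z = (1 - z) * (z * (1 - z) * (D1 y z)\<^sup>2 / 2 + \<kappa> * G (y z))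
     + (1 - z) * (b0 - \<eta> * z) * y z * D1 y z - (h0 + h1 * z) * (y z)\<^sup>2 / 2"

lemma pohozaev_cont: "continuous_on {0..1/2} (pohozaev (Y a))"
  unfolding pohozaev_def
  by (intro continuous_intros G_cont D1_cont[OF half Y_solves] sol_cont[OF half Y_solves]) auto

text \<open>The two sides differ by the equation for \<open>y\<close> multiplied by
  \<open>(1 - z) * z * y' + (b0 - \<eta> * z) * y\<close>.\<close>

lemma pohozaev_DERIV:
  assumes z: "0 < z" "z < 1/2"
  shows "\<exists>d. (pohozaev (Y a) has_real_derivative d) (at z) \<and>
     \<alpha> * pohozaev (Y a) z + z * d = \<kappa> * ((\<alpha> - (\<alpha> + 1) * z) * G (Y a z) - (b0 - \<eta> * z) * (Y a z * g (Y a z)))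
       - (\<alpha> * h0 + (\<alpha> + 1) * h1 * z) * (Y a z)\<^sup>2 / 2"
proof -
  note d = sol_DERIV_interior[OF half Y_solves[of a] z]
  have e: "z * (1 - z) * D2 (Y a) z + (\<alpha> - (\<alpha> + \<beta>) * z) * D1 (Y a) z + \<kappa> * g (Y a z) = 0"
    using sol_ode[OF half Y_solves, of z a] z by simp
  have DG: "((\<lambda>z. G (Y a z)) has_real_derivative g (Y a z) * D1 (Y a) z) (at z)"
    by (rule DERIV_chain2[OF DERIV_G d(1)])
  define y p q where "y = Y a z" and "p = D1 (Y a) z" and "q = D2 (Y a) z"
  let ?d = "- (z * (1 - z) * p\<^sup>2 / 2 + \<kappa> * G y)
      + (1 - z) * (((1 - 2 * z) * p\<^sup>2 + z * (1 - z) * (2 * p * q)) / 2 + \<kappa> * (g y * p))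
      + (- (b0 - \<eta> * z) - (1 - z) * \<eta>) * y * p + (1 - z) * (b0 - \<eta> * z) * (p * p + y * q)
      - h1 * y\<^sup>2 / 2 - (h0 + h1 * z) * (y * p)"
  have "(pohozaev (Y a) has_real_derivative ?d) (at z)"
    unfolding pohozaev_def[abs_def] y_def p_def q_def
    by (auto intro!: derivative_eq_intros d DG simp: field_simps power2_eq_square)
  moreover have "\<alpha> * pohozaev (Y a) z + z * ?d
    = \<kappa> * ((\<alpha> - (\<alpha> + 1) * z) * G y - (b0 - \<eta> * z) * (y * g y)) - (\<alpha> * h0 + (\<alpha> + 1) * h1 * z) * y\<^sup>2 / 2
      + (z * (1 - z) * q + (\<alpha> - (\<alpha> + \<beta>) * z) * p + \<kappa> * g y) * ((1 - z) * z * p + (b0 - \<eta> * z) * y)"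
    unfolding pohozaev_def h0_def h1_def b0_def \<eta>_def y_def[symmetric] p_def[symmetric]
    by (simp add: field_simps power2_eq_square)
  ultimately show ?thesis using e unfolding y_def p_def q_def by auto
qed

text \<open>At \<open>z = 0\<close> the right-hand side of \<open>pohozaev_DERIV\<close> contains \<open>\<bar>y\<bar> powr (r + 2)\<close> with the coefficient
  \<open>2 * \<kappa> * \<delta>0\<close>, and \<open>\<delta>0 > 0\<close> is the subcriticality of \<open>r\<close>.  Up to \<open>z0\<close> the coefficient is
  still at least \<open>\<kappa> * \<delta>0\<close>.  One half of this is kept in \<open>pohozaev_source_lower\<close>; the other half
  absorbs the quadratic terms, at most \<open>C1 * y\<^sup>2\<close>, up to the constant \<open>C2\<close>.\<close>

definition \<delta>0 :: real where "\<delta>0 = (\<alpha> / (r + 2) - b0) / 2"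
definition z0 :: real where "z0 = min (1/4) (\<delta>0 / (\<bar>\<eta> - (\<alpha> + 1) / (r + 2)\<bar> + 1))"
definition C1 :: real where
  "C1 = \<kappa> * (\<bar>b0\<bar> + \<alpha> + 1 + \<bar>\<eta>\<bar>) + \<alpha> * \<bar>h0\<bar> + (\<alpha> + 1) * \<bar>h1\<bar>"
definition C2 :: real where "C2 = C1 * ((C1 / (\<kappa> * \<delta>0 / 2)) powr (1/r))\<^sup>2"

lemma \<delta>0_pos: "0 < \<delta>0"
proof -
  have "(\<alpha> - 1) * (r + 2) < 2 * \<alpha>" using subcritical by (simp add: algebra_simps)
  then have "b0 < \<alpha> / (r + 2)" using r by (simp add: b0_def field_simps)
  then show ?thesis by (simp add: \<delta>0_def)
qed

lemma z0: "0 < z0" "z0 \<le> 1/4"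
proof -
  show "0 < z0" using \<delta>0_pos by (simp add: z0_def)
  show "z0 \<le> 1/4" unfolding z0_def by (rule min.cobounded1)
qed

lemma C1_nonneg: "0 \<le> C1" using \<kappa> \<alpha>_pos by (simp add: C1_def)

lemma pohozaev_source_lower:
  assumes z: "0 \<le> z" "z \<le> z0"
  shows "\<kappa> * \<delta>0 / 2 * (\<bar>s\<bar> powr r * s\<^sup>2) - C2 \<le>
    \<kappa> * ((\<alpha> - (\<alpha> + 1) * z) * G s - (b0 - \<eta> * z) * (s * g s)) - (\<alpha> * h0 + (\<alpha> + 1) * h1 * z) * s\<^sup>2 / 2"
proof -
  define \<phi> where "\<phi> = \<bar>s\<bar> powr r * s\<^sup>2"
  have \<phi>0: "0 \<le> \<phi>" by (simp add: \<phi>_def)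
  define B where "B = \<kappa> * ((b0 - \<eta> * z) - (\<alpha> - (\<alpha> + 1) * z) / 2) - (\<alpha> * h0 + (\<alpha> + 1) * h1 * z) / 2"
  define \<delta> where "\<delta> = (\<alpha> - (\<alpha> + 1) * z) / (r + 2) - (b0 - \<eta> * z)"
  have z1: "z \<le> 1" using z z0 by simp
  have eq: "\<kappa> * ((\<alpha> - (\<alpha> + 1) * z) * G s - (b0 - \<eta> * z) * (s * g s)) - (\<alpha> * h0 + (\<alpha> + 1) * h1 * z) * s\<^sup>2 / 2
      = \<kappa> * \<delta> * \<phi> + B * s\<^sup>2"
    unfolding \<delta>_def B_def G_def g_def \<phi>_def using r by (simp add: field_simps power2_eq_square)
  have "\<bar>(\<eta> - (\<alpha> + 1) / (r + 2)) * z\<bar> \<le> (\<bar>\<eta> - (\<alpha> + 1) / (r + 2)\<bar> + 1) * (\<delta>0 / (\<bar>\<eta> - (\<alpha> + 1) / (r + 2)\<bar> + 1))"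
    unfolding abs_mult using z by (intro mult_mono) (auto simp: z0_def)
  also have "\<dots> = \<delta>0" by simp
  finally have "\<bar>(\<eta> - (\<alpha> + 1) / (r + 2)) * z\<bar> \<le> \<delta>0" .
  moreover have "\<delta> = 2 * \<delta>0 + (\<eta> - (\<alpha> + 1) / (r + 2)) * z"
  proof -
    have "2 * \<delta>0 = \<alpha> / (r + 2) - b0" by (simp only: \<delta>0_def) simp
    then show ?thesis unfolding \<delta>_def by (simp add: diff_divide_distrib left_diff_distrib)
  qed
  ultimately have "\<delta>0 \<le> \<delta>" by linarith
  then have 1: "\<kappa> * \<delta>0 * \<phi> \<le> \<kappa> * \<delta> * \<phi>" using \<kappa> \<phi>0 by (intro mult_mono) (use \<delta>0_pos in auto)
  have zz: "\<bar>c * z\<bar> \<le> \<bar>c\<bar>" for c using z z1 by (simp add: abs_mult mult_left_le)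
  have *: "\<bar>b - v - (u - w) / 2\<bar> \<le> \<bar>b\<bar> + u + 1 + \<bar>e\<bar>"
    if "0 < u" "\<bar>v\<bar> \<le> \<bar>e\<bar>" "\<bar>w\<bar> \<le> u + 1" for b v u w e :: real
  proof -
    have "v \<le> \<bar>e\<bar>" "- v \<le> \<bar>e\<bar>" "w \<le> u + 1" "- w \<le> u + 1" "b \<le> \<bar>b\<bar>" "- b \<le> \<bar>b\<bar>"
      using that by auto
    moreover have "(u - w) / 2 = u / 2 - w / 2" by (simp add: diff_divide_distrib)
    ultimately show ?thesis using that(1) unfolding abs_le_iff by (intro conjI) linarith+
  qed
  have "\<bar>\<kappa> * ((b0 - \<eta> * z) - (\<alpha> - (\<alpha> + 1) * z) / 2)\<bar> = \<kappa> * \<bar>(b0 - \<eta> * z) - (\<alpha> - (\<alpha> + 1) * z) / 2\<bar>"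
    using \<kappa> by (simp add: abs_mult)
  also have "\<dots> \<le> \<kappa> * (\<bar>b0\<bar> + \<alpha> + 1 + \<bar>\<eta>\<bar>)"
  proof (rule mult_left_mono)
    have "\<bar>(\<alpha> + 1) * z\<bar> \<le> \<alpha> + 1" using zz[of "\<alpha> + 1"] \<alpha>_pos by simp
    then show "\<bar>(b0 - \<eta> * z) - (\<alpha> - (\<alpha> + 1) * z) / 2\<bar> \<le> \<bar>b0\<bar> + \<alpha> + 1 + \<bar>\<eta>\<bar>"
      by (rule *[OF \<alpha>_pos zz])
  qed (use \<kappa> in simp)
  finally have 2: "\<bar>\<kappa> * ((b0 - \<eta> * z) - (\<alpha> - (\<alpha> + 1) * z) / 2)\<bar> \<le> \<kappa> * (\<bar>b0\<bar> + \<alpha> + 1 + \<bar>\<eta>\<bar>)" .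
  have "\<bar>\<alpha> * h0\<bar> = \<alpha> * \<bar>h0\<bar>" "\<bar>(\<alpha> + 1) * h1\<bar> = (\<alpha> + 1) * \<bar>h1\<bar>" using \<alpha>_pos by (auto simp: abs_mult)
  moreover have "- (K + u' + w') \<le> x - (u + w) / 2"
    if "\<bar>x\<bar> \<le> K" "\<bar>u\<bar> = u'" "\<bar>w\<bar> \<le> w'" for x u w K u' w' :: real
  proof -
    have "- x \<le> K" "u \<le> u'" "0 \<le> u'" "w \<le> w'" "0 \<le> w'" using that by auto
    moreover have "(u + w) / 2 = u / 2 + w / 2" by (simp add: add_divide_distrib)
    ultimately show ?thesis by linarith
  qed
  ultimately have "- C1 \<le> B" using 2 zz[of "(\<alpha> + 1) * h1"] unfolding B_def C1_def by metis
  then have 3: "- C1 * s\<^sup>2 \<le> B * s\<^sup>2" by (intro mult_right_mono) auto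
  have "C1 * s\<^sup>2 \<le> \<kappa> * \<delta>0 / 2 * \<bar>s\<bar> powr r * s\<^sup>2 + C2"
    unfolding C2_def by (rule square_le_abs_powr) (use r \<kappa> \<delta>0_pos C1_nonneg in auto)
  then have "C1 * s\<^sup>2 \<le> \<kappa> * \<delta>0 / 2 * \<phi> + C2" by (simp add: \<phi>_def mult_ac)
  moreover have "\<kappa> * \<delta>0 / 2 * \<phi> = \<kappa> * \<delta>0 * \<phi> / 2" by simp
  ultimately show ?thesis unfolding eq \<phi>_def[symmetric] using 1 3 by linarith
qed

text \<open>The integral of \<open>z\<^sup>\<alpha>\<^sup>-\<^sup>1 * \<kappa> * \<delta>0 / 2 * (a/2) powr (r + 2)\<close> over the plateau.\<close>

definition gain :: "real \<Rightarrow> real" where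
  "gain a = \<kappa> * \<delta>0 / 2 * ((a/2) powr r * (a/2)\<^sup>2) * plateau a powr \<alpha> / \<alpha>"

text \<open>The product rule: \<open>(z\<^sup>\<alpha> (P + C2 / \<alpha>))' = z\<^sup>\<alpha>\<^sup>-\<^sup>1 (\<alpha> P + z P' + C2)\<close>.\<close>

lemma weighted_pohozaev_DERIV:
  assumes z: "0 < z" "z < z0"
  shows "\<exists>d. ((\<lambda>z. z powr \<alpha> * (pohozaev (Y a) z + C2 / \<alpha>)) has_real_derivative d) (at z) \<and>
     z powr (\<alpha> - 1) * (\<kappa> * \<delta>0 / 2 * (\<bar>Y a z\<bar> powr r * (Y a z)\<^sup>2)) \<le> d"
proof -
  have zh: "z < 1/2" using z z0 by simp
  obtain d where d: "(pohozaev (Y a) has_real_derivative d) (at z)"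
    and id: "\<alpha> * pohozaev (Y a) z + z * d = \<kappa> * ((\<alpha> - (\<alpha> + 1) * z) * G (Y a z) - (b0 - \<eta> * z) * (Y a z * g (Y a z)))
       - (\<alpha> * h0 + (\<alpha> + 1) * h1 * z) * (Y a z)\<^sup>2 / 2"
    using pohozaev_DERIV[OF z(1) zh] by blast
  have "((\<lambda>z. z powr \<alpha> * (pohozaev (Y a) z + C2 / \<alpha>)) has_real_derivative
      (\<alpha> * z powr (\<alpha> - 1)) * (pohozaev (Y a) z + C2 / \<alpha>) + d * z powr \<alpha>) (at z)"
  proof (rule DERIV_mult)
    show "((\<lambda>z. z powr \<alpha>) has_real_derivative \<alpha> * z powr (\<alpha> - 1)) (at z)"
      using z by (auto intro!: derivative_eq_intros)
    show "((\<lambda>z. pohozaev (Y a) z + C2 / \<alpha>) has_real_derivative d) (at z)"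
      using DERIV_add[OF d DERIV_const] by simp
  qed
  moreover have "(\<alpha> * z powr (\<alpha> - 1)) * (pohozaev (Y a) z + C2 / \<alpha>) + d * z powr \<alpha>
      = z powr (\<alpha> - 1) * (\<alpha> * pohozaev (Y a) z + z * d + C2)"
  proof -
    have "z powr \<alpha> = z powr (\<alpha> - 1) * z" using z by (simp add: powr_diff)
    then show ?thesis using \<alpha>_pos by (simp add: field_simps)
  qed
  moreover have "\<kappa> * \<delta>0 / 2 * (\<bar>Y a z\<bar> powr r * (Y a z)\<^sup>2) \<le> \<alpha> * pohozaev (Y a) z + z * d + C2"
    using pohozaev_source_lower[of z "Y a z"] z unfolding id by simp
  then have "z powr (\<alpha> - 1) * (\<kappa> * \<delta>0 / 2 * (\<bar>Y a z\<bar> powr r * (Y a z)\<^sup>2))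
      \<le> z powr (\<alpha> - 1) * (\<alpha> * pohozaev (Y a) z + z * d + C2)"
    by (intro mult_left_mono) auto
  ultimately show ?thesis by (intro exI conjI) auto
qed

lemma weighted_pohozaev_cont:
  "continuous_on {0..1/2} (\<lambda>z. z powr \<alpha> * (pohozaev (Y a) z + C2 / \<alpha>))"
  by (intro continuous_on_mult continuous_on_add continuous_on_const pohozaev_cont
      continuous_on_powr'[OF continuous_on_id continuous_on_const]) (use \<alpha>_pos in auto)

text \<open>On the plateau, where \<open>y \<ge> a / 2\<close>, the weighted functional gains at least \<open>gain a\<close>, and up to \<open>z0\<close> it
  does not decrease.  The weight \<open>z\<^sup>\<alpha>\<close> is at most \<open>1\<close> and can be dropped.\<close>

lemma pohozaev_lower:
  assumes a: "2 \<le> a" and p: "plateau a \<le> z0" and z: "plateau a \<le> z" "z \<le> z0"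
  shows "gain a - C2 / \<alpha> \<le> pohozaev (Y a) z"
proof -
  let ?P = "\<lambda>z. z powr \<alpha> * (pohozaev (Y a) z + C2 / \<alpha>)"
  let ?m = "\<kappa> * \<delta>0 / 2 * ((a/2) powr r * (a/2)\<^sup>2)"
  have pl: "0 < plateau a" using a kern_bound_pos by (simp add: plateau_def)
  have m0: "0 \<le> ?m" using \<kappa> \<delta>0_pos by simp
  have "?P 0 - ?m * (0 powr \<alpha> / \<alpha>) \<le> ?P (plateau a) - ?m * (plateau a powr \<alpha> / \<alpha>)"
  proof (rule DERIV_nonneg_imp_increasing_open[where f = "\<lambda>z. ?P z - ?m * (z powr \<alpha> / \<alpha>)"])
    have "{0..plateau a} \<subseteq> {0..1/2}" using p z0 by auto
    then show "continuous_on {0..plateau a} (\<lambda>z. ?P z - ?m * (z powr \<alpha> / \<alpha>))"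
      by (intro continuous_on_diff continuous_on_subset[OF weighted_pohozaev_cont] continuous_on_mult
          continuous_on_divide continuous_on_const continuous_on_powr'[OF continuous_on_id continuous_on_const])
        (use \<alpha>_pos in auto)
    fix u assume u: "0 < u" "u < plateau a"
    then obtain d where d: "(?P has_real_derivative d) (at u)"
      "u powr (\<alpha> - 1) * (\<kappa> * \<delta>0 / 2 * (\<bar>Y a u\<bar> powr r * (Y a u)\<^sup>2)) \<le> d"
      using weighted_pohozaev_DERIV[of u a] p by auto
    have "a / 2 \<le> Y a u" using plateau_lower_bound[OF a, of u] u p z0 by simp
    then have "(a/2) powr r * (a/2)\<^sup>2 \<le> \<bar>Y a u\<bar> powr r * (Y a u)\<^sup>2"
      using a r by (intro mult_mono powr_mono2 power_mono) auto
    then have "?m \<le> \<kappa> * \<delta>0 / 2 * (\<bar>Y a u\<bar> powr r * (Y a u)\<^sup>2)"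
      using \<kappa> \<delta>0_pos by (intro mult_left_mono) auto
    then have "u powr (\<alpha> - 1) * ?m \<le> u powr (\<alpha> - 1) * (\<kappa> * \<delta>0 / 2 * (\<bar>Y a u\<bar> powr r * (Y a u)\<^sup>2))"
      by (rule mult_left_mono) simp
    then have "0 \<le> d - ?m * u powr (\<alpha> - 1)" using d(2) by (simp add: mult.commute)
    moreover have "((\<lambda>z. z powr \<alpha> / \<alpha>) has_real_derivative u powr (\<alpha> - 1)) (at u)"
      using u \<alpha>_pos by (auto intro!: derivative_eq_intros)
    then have "((\<lambda>z. ?P z - ?m * (z powr \<alpha> / \<alpha>)) has_real_derivative d - ?m * u powr (\<alpha> - 1)) (at u)"
      by (intro DERIV_diff d(1) DERIV_cmult)
    ultimately show "\<exists>e. ((\<lambda>z. ?P z - ?m * (z powr \<alpha> / \<alpha>)) has_real_derivative e) (at u) \<and> 0 \<le> e" by blast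
  qed (use pl in auto)
  then have 1: "gain a \<le> ?P (plateau a)" using \<alpha>_pos by (simp add: gain_def)
  have "?P (plateau a) \<le> ?P z"
  proof (rule DERIV_nonneg_imp_increasing_open[OF z(1)])
    have "{plateau a..z} \<subseteq> {0..1/2}" using pl z z0 by auto
    then show "continuous_on {plateau a..z} ?P" by (rule continuous_on_subset[OF weighted_pohozaev_cont])
    fix u assume u: "plateau a < u" "u < z"
    then obtain d where d: "(?P has_real_derivative d) (at u)"
      "u powr (\<alpha> - 1) * (\<kappa> * \<delta>0 / 2 * (\<bar>Y a u\<bar> powr r * (Y a u)\<^sup>2)) \<le> d"
      using weighted_pohozaev_DERIV[of u a] pl z by auto
    moreover have "0 \<le> u powr (\<alpha> - 1) * (\<kappa> * \<delta>0 / 2 * (\<bar>Y a u\<bar> powr r * (Y a u)\<^sup>2))"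
      using \<kappa> \<delta>0_pos by simp
    ultimately show "\<exists>e. (?P has_real_derivative e) (at u) \<and> 0 \<le> e" by (meson order_trans)
  qed
  then have 2: "gain a \<le> ?P z" using 1 by linarith
  have g0: "0 \<le> gain a" unfolding gain_def using m0 \<alpha>_pos by simp
  have zp: "0 < z powr \<alpha>" "z powr \<alpha> \<le> 1" using pl z z0 \<alpha>_pos by (auto intro!: powr_le1)
  have X: "0 \<le> pohozaev (Y a) z + C2 / \<alpha>"
    using 2 g0 zp(1) by (meson order_trans zero_le_mult_iff not_less)
  then have "?P z \<le> 1 * (pohozaev (Y a) z + C2 / \<alpha>)" using zp by (intro mult_right_mono) auto
  then have "?P z \<le> pohozaev (Y a) z + C2 / \<alpha>" by (simp only: mult_1)
  then have "gain a \<le> pohozaev (Y a) z + C2 / \<alpha>" by (rule order_trans[OF 2])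
  then show ?thesis by (simp only: diff_le_eq)
qed

text \<open>The gain is a multiple of \<open>a powr (r + 2 - \<alpha> * r)\<close>, with a positive exponent by subcriticality.\<close>

lemma gain_at_top: "filterlim gain at_top at_top"
proof -
  define c where "c = \<kappa> * \<delta>0 / 2 * ((1/2) powr r * (1/2)\<^sup>2) * (1 / (4 * kern_bound)) powr \<alpha> / \<alpha>"
  have c: "0 < c" unfolding c_def using \<kappa> \<delta>0_pos \<alpha>_pos kern_bound_pos by simp
  have eq: "gain a = c * a powr (r + 2 - \<alpha> * r)" if a: "0 < a" for a
  proof -
    have 1: "(a / 2) powr r = a powr r * (1/2) powr r" using powr_mult[of a "1/2" r] a by simp
    have 2: "(a / 2)\<^sup>2 = a powr 2 * (1/2)\<^sup>2" using a by (simp add: power_divide powr_numeral)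
    have "plateau a = a powr (-r) * (1 / (4 * kern_bound))" by (simp add: plateau_def)
    then have "plateau a powr \<alpha> = (a powr (-r)) powr \<alpha> * (1 / (4 * kern_bound)) powr \<alpha>"
      by (simp only: powr_mult)
    then have 3: "plateau a powr \<alpha> = a powr (- \<alpha> * r) * (1 / (4 * kern_bound)) powr \<alpha>"
      by (simp add: powr_powr mult.commute)
    have 4: "a powr (r + 2 - \<alpha> * r) = a powr r * a powr 2 * a powr (- \<alpha> * r)"
      by (simp flip: powr_add)
    show ?thesis unfolding gain_def 1 2 3 4 c_def by (simp only: mult_ac times_divide_eq_right times_divide_eq_left)
  qed
  have "filterlim (\<lambda>a. a powr (r + 2 - \<alpha> * r)) at_top at_top"
    unfolding filterlim_at_top
  proof
    fix K :: real
    let ?p = "r + 2 - \<alpha> * r"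
    have p: "0 < ?p" using subcritical by simp
    show "\<forall>\<^sub>F a in at_top. K \<le> a powr ?p"
      using eventually_ge_at_top[of "max 1 K powr (1 / ?p)"]
    proof eventually_elim
      case (elim a)
      have "max 1 K = (max 1 K powr (1 / ?p)) powr ?p" using p by (simp add: powr_powr)
      also have "\<dots> \<le> a powr ?p" using elim p by (intro powr_mono2) auto
      finally show ?case by simp
    qed
  qed
  then have "filterlim (\<lambda>a. c * a powr (r + 2 - \<alpha> * r)) at_top at_top"
    by (intro filterlim_tendsto_pos_mult_at_top[OF tendsto_const c])
  then show ?thesis
    by (rule filterlim_cong[OF refl refl, THEN iffD1, rotated])
       (rule eventually_mono[OF eventually_gt_at_top[of 0]], simp only: eq)
qed

lemma plateau_small: "\<forall>\<^sub>F a in at_top. plateau a \<le> z0"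
proof -
  have "((\<lambda>a. a powr (-r)) \<longlongrightarrow> 0) at_top" using r by (intro tendsto_neg_powr filterlim_ident) auto
  then have "(plateau \<longlongrightarrow> 0) at_top" unfolding plateau_def[abs_def] by (rule tendsto_divide_zero)
  then show ?thesis using order_tendstoD(2)[of plateau 0 at_top z0] z0 by (auto elim: eventually_mono)
qed

definition C3 :: real where
  "C3 = 1 + (\<bar>b0\<bar> + \<bar>\<eta>\<bar>) * (1 / \<kappa> + 2 / z0) + (\<bar>h0\<bar> + \<bar>h1\<bar>) / \<kappa>"

lemma pohozaev_le_energy: "pohozaev (Y a) z0 \<le> C3 * energy (Y a) z0"
proof -
  define y p E where "y = Y a z0" and "p = D1 (Y a) z0" and "E = energy (Y a) z0"
  have zh: "z0 \<in> {0..1/2}" using z0 by auto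
  have E0: "0 \<le> E" and yE: "\<kappa> * y\<^sup>2 / 2 \<le> E" and pE: "z0 * (1 - z0) * p\<^sup>2 / 2 \<le> E"
    using energy_bounds[OF half Y_solves zh, of a] by (auto simp: y_def p_def E_def)
  have y2: "y\<^sup>2 \<le> 2 / \<kappa> * E" using yE \<kappa> by (simp add: field_simps)
  have "z0 * (1/2) * p\<^sup>2 \<le> z0 * (1 - z0) * p\<^sup>2" using z0 by (intro mult_right_mono mult_left_mono) auto
  then have "z0 * p\<^sup>2 \<le> 4 * E" using pE by simp
  then have p2: "p\<^sup>2 \<le> 4 / z0 * E" using z0 by (simp add: field_simps)
  have "z0 * (1 - z0) * p\<^sup>2 / 2 + \<kappa> * G y \<le> E"
    unfolding E_def energy_def y_def p_def using \<kappa> c0_nonneg by (simp add: algebra_simps)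
  then have "(1 - z0) * (z0 * (1 - z0) * p\<^sup>2 / 2 + \<kappa> * G y) \<le> (1 - z0) * E"
    using z0 by (intro mult_left_mono) auto
  also have "\<dots> \<le> 1 * E" using z0 E0 by (intro mult_right_mono) auto
  finally have 1: "(1 - z0) * (z0 * (1 - z0) * p\<^sup>2 / 2 + \<kappa> * G y) \<le> E" by simp
  have zz: "\<bar>c * z0\<bar> \<le> \<bar>c\<bar>" for c using z0 by (simp add: abs_mult mult_left_le)
  have bb: "\<bar>(1 - z0) * (b0 - \<eta> * z0)\<bar> \<le> \<bar>b0\<bar> + \<bar>\<eta>\<bar>"
  proof -
    have "\<bar>b0 - \<eta> * z0\<bar> \<le> \<bar>b0\<bar> + \<bar>\<eta>\<bar>" using zz[of \<eta>] by linarith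
    then have "\<bar>1 - z0\<bar> * \<bar>b0 - \<eta> * z0\<bar> \<le> 1 * (\<bar>b0\<bar> + \<bar>\<eta>\<bar>)" using z0 by (intro mult_mono) auto
    then show ?thesis by (simp add: abs_mult)
  qed
  have "\<bar>y * p\<bar> \<le> (y\<^sup>2 + p\<^sup>2) / 2"
    using sum_squares_bound[of "\<bar>y\<bar>" "\<bar>p\<bar>"] by (simp add: abs_mult)
  also have "\<dots> \<le> (1 / \<kappa> + 2 / z0) * E" using y2 p2 by (simp add: algebra_simps)
  finally have "\<bar>(1 - z0) * (b0 - \<eta> * z0)\<bar> * \<bar>y * p\<bar> \<le> (\<bar>b0\<bar> + \<bar>\<eta>\<bar>) * ((1 / \<kappa> + 2 / z0) * E)"
    by (intro mult_mono bb) auto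
  moreover have "(1 - z0) * (b0 - \<eta> * z0) * y * p \<le> \<bar>(1 - z0) * (b0 - \<eta> * z0)\<bar> * \<bar>y * p\<bar>"
    using abs_ge_self[of "(1 - z0) * (b0 - \<eta> * z0) * (y * p)"] by (simp only: abs_mult mult.assoc)
  ultimately have 2: "(1 - z0) * (b0 - \<eta> * z0) * y * p \<le> (\<bar>b0\<bar> + \<bar>\<eta>\<bar>) * (1 / \<kappa> + 2 / z0) * E"
    by (simp only: mult.assoc)
  have "- (h0 + h1 * z0) \<le> \<bar>h0\<bar> + \<bar>h1\<bar>" using zz[of h1] by linarith
  then have "- (h0 + h1 * z0) * y\<^sup>2 \<le> (\<bar>h0\<bar> + \<bar>h1\<bar>) * y\<^sup>2" by (rule mult_right_mono) simp
  also have "\<dots> \<le> (\<bar>h0\<bar> + \<bar>h1\<bar>) * (2 / \<kappa> * E)" by (rule mult_left_mono[OF y2]) simp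
  also have "\<dots> = 2 * ((\<bar>h0\<bar> + \<bar>h1\<bar>) / \<kappa> * E)" by simp
  finally have "- ((h0 + h1 * z0) * y\<^sup>2) \<le> 2 * ((\<bar>h0\<bar> + \<bar>h1\<bar>) / \<kappa> * E)"
    by (simp only: mult_minus_left)
  then have 3: "- ((h0 + h1 * z0) * y\<^sup>2 / 2) \<le> (\<bar>h0\<bar> + \<bar>h1\<bar>) / \<kappa> * E" by linarith
  have "C3 * E = E + (\<bar>b0\<bar> + \<bar>\<eta>\<bar>) * (1 / \<kappa> + 2 / z0) * E + (\<bar>h0\<bar> + \<bar>h1\<bar>) / \<kappa> * E"
    unfolding C3_def by (simp only: distrib_right mult_1)
  then show ?thesis using 1 2 3 unfolding pohozaev_def y_def[symmetric] p_def[symmetric] E_def[symmetric] by linarith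
qed

lemma C3_pos: "0 < C3"
proof -
  have "0 \<le> (\<bar>b0\<bar> + \<bar>\<eta>\<bar>) * (1 / \<kappa> + 2 / z0)" "0 \<le> (\<bar>h0\<bar> + \<bar>h1\<bar>) / \<kappa>"
    using \<kappa> z0 by auto
  then show ?thesis unfolding C3_def by linarith
qed

text \<open>The energy loses at most \<open>\<alpha> * y'\<^sup>2\<close> per unit of \<open>z\<close>, which is at most \<open>4 * \<alpha> / z0\<close> times the
  energy since \<open>z\<close> is bounded away from \<open>0\<close>.\<close>

lemma energy_later:
  assumes z: "z \<in> {z0..1/2}"
  shows "energy (Y a) z0 * exp (- (4 * \<alpha> / z0)) \<le> energy (Y a) z"
proof -
  have "energy (Y a) z0 * exp (- (4 * \<alpha> / z0) * (z - z0)) \<le> energy (Y a) z"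
  proof (rule exponential_lower_bound[where b = "1/2"])
    show "continuous_on {z0..1/2} (energy (Y a))"
      by (rule continuous_on_subset[OF energy_cont[OF half Y_solves]]) (use z0 in auto)
    fix t :: real assume t: "z0 < t" "t < 1/2"
    let ?D = "(D1 (Y a) t)\<^sup>2"
    have ab: "0 \<le> (\<alpha> + \<beta> - 1) * t" using \<alpha> \<beta> t z0 by (intro mult_nonneg_nonneg) auto
    have "\<alpha> * (z0 * (1/2) * ?D) \<le> \<alpha> * (t * (1 - t) * ?D)"
      using t z0 \<alpha>_pos by (intro mult_left_mono mult_right_mono mult_mono) auto
    also have "\<dots> \<le> \<alpha> * (2 * energy (Y a) t)"
      using energy_bounds(3)[OF half Y_solves, of t a] t z0 \<alpha>_pos by (intro mult_left_mono) auto
    finally have "\<alpha> * ?D \<le> 4 * \<alpha> / z0 * energy (Y a) t" using z0 by (simp add: field_simps)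
    moreover have "- \<alpha> * ?D \<le> - ((\<alpha> - 1/2) - (\<alpha> + \<beta> - 1) * t) * ?D"
      using ab by (intro mult_right_mono) auto
    ultimately have "- (4 * \<alpha> / z0) * energy (Y a) t \<le> - ((\<alpha> - 1/2) - (\<alpha> + \<beta> - 1) * t) * ?D"
      by linarith
    then show "\<exists>d. (energy (Y a) has_real_derivative d) (at t) \<and> - (4 * \<alpha> / z0) * energy (Y a) t \<le> d"
      using energy_DERIV[OF half Y_solves, of t a] t z0 by auto
  qed (use z in auto)
  moreover have "energy (Y a) z0 * exp (- (4 * \<alpha> / z0)) \<le> energy (Y a) z0 * exp (- (4 * \<alpha> / z0) * (z - z0))"
  proof (rule mult_left_mono)
    have "4 * \<alpha> / z0 * (z - z0) \<le> 4 * \<alpha> / z0 * 1"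
      by (rule mult_left_mono) (use z z0 \<alpha>_pos in auto)
    then show "exp (- (4 * \<alpha> / z0)) \<le> exp (- (4 * \<alpha> / z0) * (z - z0))" by simp
    show "0 \<le> energy (Y a) z0" using energy_bounds(1)[OF half Y_solves, of z0 a] z0 by auto
  qed
  ultimately show ?thesis by linarith
qed

text \<open>The energy at the point \<open>z0\<close>, which does not depend on \<open>a\<close>, dominates the Pohozaev functional there,
  and beyond \<open>z0\<close> it decreases by a bounded factor only.\<close>

lemma energy_at_top: "\<forall>\<^sub>F a in at_top. \<forall>z\<in>{z0..1/2}. M \<le> energy (Y a) z"
proof -
  let ?N = "C3 * (max 0 M * exp (4 * \<alpha> / z0)) + C2 / \<alpha>"
  have "\<forall>\<^sub>F a in at_top. ?N \<le> gain a" using gain_at_top by (simp add: filterlim_at_top)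
  then show ?thesis using plateau_small eventually_ge_at_top[of 2]
  proof eventually_elim
    case (elim a)
    have "gain a - C2 / \<alpha> \<le> pohozaev (Y a) z0" using pohozaev_lower[of a z0] elim by auto
    then have "C3 * (max 0 M * exp (4 * \<alpha> / z0)) \<le> C3 * energy (Y a) z0"
      using pohozaev_le_energy[of a] elim by linarith
    then have "max 0 M * exp (4 * \<alpha> / z0) \<le> energy (Y a) z0" using C3_pos by simp
    then have "max 0 M * exp (4 * \<alpha> / z0) * exp (- (4 * \<alpha> / z0)) \<le> energy (Y a) z0 * exp (- (4 * \<alpha> / z0))"
      by (rule mult_right_mono) simp
    then have "max 0 M \<le> energy (Y a) z0 * exp (- (4 * \<alpha> / z0))"
      by (simp only: mult.assoc exp_add[symmetric] add.right_inverse exp_zero mult_1_right)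
    then show ?case using energy_later[of _ a] by (meson max.bounded_iff order_trans)
  qed
qed

text \<open>On the plateau \<open>y\<close> is positive, then up to \<open>z0\<close> the Pohozaev functional is, and beyond \<open>z0\<close> the
  energy exceeds its value \<open>\<kappa> * c0\<close> at the origin of the phase plane.\<close>

lemma nonvanishing: "\<forall>\<^sub>F a in at_top. \<forall>z\<in>{0..1/2}. Y a z \<noteq> 0 \<or> D1 (Y a) z \<noteq> 0"
proof -
  have "\<forall>\<^sub>F a in at_top. C2 / \<alpha> + 1 \<le> gain a" using gain_at_top by (simp add: filterlim_at_top)
  then show ?thesis using plateau_small eventually_ge_at_top[of 2] energy_at_top[of "\<kappa> * c0 + 1"]
  proof eventually_elim
    case (elim a)
    show ?case
    proof
      fix z :: real assume z: "z \<in> {0..1/2}"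
      consider "z \<le> plateau a" | "plateau a \<le> z" "z \<le> z0" | "z0 \<le> z" by linarith
      then show "Y a z \<noteq> 0 \<or> D1 (Y a) z \<noteq> 0"
      proof cases
        case 1
        then show ?thesis using plateau_lower_bound[of a z] elim z by auto
      next
        case 2
        then have "1 \<le> pohozaev (Y a) z" using pohozaev_lower[of a z] elim by auto
        then show ?thesis by (auto simp: pohozaev_def G_def)
      next
        case 3
        then have "\<kappa> * c0 + 1 \<le> energy (Y a) z" using elim z by auto
        then show ?thesis by (auto simp: energy_def G_def)
      qed
    qed
  qed
qed

end

section \<open>Rotation in the phase plane\<close>

text \<open>A continuous logarithm along a curve by an explicit formula, from which its dependence on
  parameters can be read off.  If \<open>L\<close> is the exponent, then \<open>exp (- L) * f\<close> is constant.\<close>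

lemma exp_lift_of_logarithmic_integral:
  fixes f f' :: "real \<Rightarrow> complex"
  assumes f: "\<And>t. t \<in> {0..Z} \<Longrightarrow> (f has_vector_derivative f' t) (at t within {0..Z})"
    and nz: "\<And>t. t \<in> {0..Z} \<Longrightarrow> f t \<noteq> 0" and cont: "continuous_on {0..Z} (\<lambda>t. f' t / f t)"
    and z: "z \<in> {0..Z}"
  shows "exp (Ln (f 0) + integral {0..z} (\<lambda>t. f' t / f t)) = f z"
proof -
  define L where "L z = Ln (f 0) + integral {0..z} (\<lambda>t. f' t / f t)" for z
  have L: "(L has_vector_derivative f' t / f t) (at t within {0..Z})" if "t \<in> {0..Z}" for t
  proof -
    have "((\<lambda>z. Ln (f 0) + integral {0..z} (\<lambda>t. f' t / f t)) has_vector_derivative 0 + f' t / f t) (at t within {0..Z})"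
      by (intro has_vector_derivative_add has_vector_derivative_const integral_has_vector_derivative cont that)
    then show ?thesis by (simp add: L_def[abs_def])
  qed
  have "\<exists>c. \<forall>t\<in>{0..Z}. exp (- L t) * f t = c"
  proof (rule has_derivative_zero_constant)
    fix t assume t: "t \<in> {0..Z}"
    have "((exp \<circ> (\<lambda>t. - L t)) has_vector_derivative - (f' t / f t) * exp (- L t)) (at t within {0..Z})"
      by (rule field_vector_diff_chain_within[OF has_vector_derivative_minus[OF L[OF t]]
            has_field_derivative_at_within[OF DERIV_exp]])
    then have "((\<lambda>t. exp (- L t) * f t) has_vector_derivative
        exp (- L t) * f' t + - (f' t / f t) * exp (- L t) * f t) (at t within {0..Z})"
      unfolding o_def by (rule has_vector_derivative_mult[OF _ f[OF t]])
    moreover have "exp (- L t) * f' t + - (f' t / f t) * exp (- L t) * f t = 0"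
      using nz[OF t] by simp
    ultimately show "((\<lambda>t. exp (- L t) * f t) has_derivative (\<lambda>h. 0)) (at t within {0..Z})"
      by (simp add: has_vector_derivative_def)
  qed simp
  then obtain c where c: "\<And>t. t \<in> {0..Z} \<Longrightarrow> exp (- L t) * f t = c" by blast
  have "0 \<in> {0..Z}" using z by auto
  then have "c = exp (- L 0) * f 0" using c by simp
  also have "\<dots> = 1" using nz[OF \<open>0 \<in> {0..Z}\<close>] by (simp add: L_def exp_minus)
  finally have "exp (- L z) * f z = 1" using c[OF z] by simp
  then show ?thesis by (simp add: L_def[symmetric] exp_minus field_simps)
qed

text \<open>The angle of \<open>(cos t, sin t / \<omega>)\<close> for the branch near \<open>t\<close>, that is \<open>t\<close> minus the \<open>arctan\<close> of the
  tangent of the difference of the two angles; in this form it is smooth on the whole line.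
  A curve whose angle satisfies \<open>\<theta>' = (\<omega>\<^sup>2 cos\<^sup>2 \<theta> + sin\<^sup>2 \<theta>) / 4\<close> slows down near \<open>cos \<theta> = 0\<close> however
  large \<open>\<omega>\<close> is, but its sheared angle grows with the constant speed \<open>\<omega> / 4\<close>.\<close>

definition sheared_angle :: "real \<Rightarrow> real \<Rightarrow> real" where
  "sheared_angle \<omega> t = t - arctan ((\<omega> - 1) * sin t * cos t / (\<omega> * (cos t)\<^sup>2 + (sin t)\<^sup>2))"

lemma sheared_angle_near: "\<bar>sheared_angle \<omega> t - t\<bar> < pi / 2"
proof -
  let ?x = "(\<omega> - 1) * sin t * cos t / (\<omega> * (cos t)\<^sup>2 + (sin t)\<^sup>2)"
  have "sheared_angle \<omega> t - t = - arctan ?x" by (simp add: sheared_angle_def)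
  then show ?thesis using arctan_lbound[of ?x] arctan_ubound[of ?x] by (simp only: abs_less_iff) linarith
qed

lemma sheared_angle_DERIV:
  assumes "0 < \<omega>"
  shows "(sheared_angle \<omega> has_real_derivative \<omega> / (\<omega>\<^sup>2 * (cos t)\<^sup>2 + (sin t)\<^sup>2)) (at t)"
proof -
  define s c where "s = sin t" and "c = cos t"
  have sc: "s\<^sup>2 + c\<^sup>2 = 1" by (simp add: s_def c_def)
  have pos: "0 < x * c\<^sup>2 + s\<^sup>2" if "0 < x" for x
  proof (cases "c = 0")
    case True then show ?thesis using sc by simp
  next
    case False then show ?thesis using that by (simp add: add_pos_nonneg)
  qed
  let ?u = "(\<omega> - 1) * s * c" and ?v = "\<omega> * c\<^sup>2 + s\<^sup>2" and ?w = "\<omega>\<^sup>2 * c\<^sup>2 + s\<^sup>2"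
  have v: "0 < ?v" and w: "0 < ?w" using pos assms by auto
  have s2: "s\<^sup>2 = 1 - c\<^sup>2" using sc by simp
  have uv: "?u\<^sup>2 + ?v\<^sup>2 = ?w"
  proof -
    have "?u\<^sup>2 + ?v\<^sup>2 = (\<omega> - 1)\<^sup>2 * s\<^sup>2 * c\<^sup>2 + (\<omega> * c\<^sup>2 + s\<^sup>2)\<^sup>2" by (simp add: power_mult_distrib)
    also have "\<dots> = ?w" unfolding s2 by algebra
    finally show ?thesis .
  qed
  let ?q = "(((\<omega> - 1) * (c * c - s * s)) * ?v - ?u * (- 2 * (\<omega> - 1) * s * c)) / ?v\<^sup>2"
  have "((\<lambda>t. (\<omega> - 1) * sin t * cos t / (\<omega> * (cos t)\<^sup>2 + (sin t)\<^sup>2)) has_real_derivative ?q) (at t)"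
    using v unfolding s_def c_def
    by (auto intro!: derivative_eq_intros simp: power2_eq_square algebra_simps)
  then have "((\<lambda>t. arctan ((\<omega> - 1) * sin t * cos t / (\<omega> * (cos t)\<^sup>2 + (sin t)\<^sup>2))) has_real_derivative
      inverse (1 + (?u / ?v)\<^sup>2) * ?q) (at t)"
    unfolding s_def c_def by (rule DERIV_chain2[OF DERIV_arctan])
  then have "(sheared_angle \<omega> has_real_derivative 1 - inverse (1 + (?u / ?v)\<^sup>2) * ?q) (at t)"
    unfolding sheared_angle_def[abs_def] by (rule DERIV_diff[OF DERIV_ident])
  moreover have "inverse (1 + (?u / ?v)\<^sup>2) = ?v\<^sup>2 / ?w"
  proof -
    have "1 + (?u / ?v)\<^sup>2 = ?w / ?v\<^sup>2" using v uv by (simp add: field_simps)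
    then show ?thesis by simp
  qed
  moreover have "?v\<^sup>2 / ?w * ?q = (((\<omega> - 1) * (c * c - s * s)) * ?v - ?u * (- 2 * (\<omega> - 1) * s * c)) / ?w"
    using v w by simp
  moreover have "1 - (((\<omega> - 1) * (c * c - s * s)) * ?v - ?u * (- 2 * (\<omega> - 1) * s * c)) / ?w = \<omega> / ?w"
  proof -
    have "(((\<omega> - 1) * (c * c - s * s)) * ?v - ?u * (- 2 * (\<omega> - 1) * s * c))
        = (\<omega> - 1) * ((c\<^sup>2 - s\<^sup>2) * ?v + 2 * (\<omega> - 1) * s\<^sup>2 * c\<^sup>2)" by algebra
    also have "\<dots> = ?w - \<omega>" unfolding s2 by algebra
    finally show ?thesis using w by (simp add: field_simps)
  qed
  ultimately show ?thesis unfolding s_def c_def by simp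
qed

context jacobi_shooting
begin

definition phase :: "real \<Rightarrow> real \<Rightarrow> complex" where "phase a z = Complex (Y a z) (D1 (Y a) z)"
definition phase' :: "real \<Rightarrow> real \<Rightarrow> complex" where "phase' a z = Complex (D1 (Y a) z) (D2 (Y a) z)"

text \<open>A logarithm of the phase curve \<open>y + \<i> y'\<close>.  In terms of it, \<open>y = exp \<rho> * cos \<theta>\<close> and
  \<open>y' = - exp \<rho> * sin \<theta>\<close> with \<open>\<rho>\<close> the real part and \<open>\<theta>\<close> minus the imaginary part; the sign is
  chosen so that solutions rotate towards larger \<open>\<theta>\<close>.\<close>

definition phase_log :: "real \<Rightarrow> real \<Rightarrow> complex" where
  "phase_log a z = Ln (phase a 0) + integral {0..z} (\<lambda>t. phase' a t / phase a t)"

lemma phase_cont: "continuous_on (UNIV \<times> {0..1/2}) (\<lambda>x. phase (fst x) (snd x))"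
  unfolding phase_def Complex_eq
  by (intro continuous_on_add continuous_on_mult continuous_on_const continuous_on_of_real Y_joint_cont D1_joint_cont)

lemma phase'_cont: "continuous_on (UNIV \<times> {0..1/2}) (\<lambda>x. phase' (fst x) (snd x))"
  unfolding phase'_def Complex_eq
  by (intro continuous_on_add continuous_on_mult continuous_on_const continuous_on_of_real D1_joint_cont D2_joint_cont)

lemma phase_slice_cont:
  assumes "continuous_on (UNIV \<times> {0..1/2}) (\<lambda>x. F (fst x) (snd x))"
  shows "continuous_on {0..1/2} (F (a::real) :: real \<Rightarrow> complex)"
proof -
  have "continuous_on {0..1/2} (\<lambda>z. (a, z))" by (intro continuous_intros)
  moreover have "(\<lambda>z. (a, z)) ` {0..1/2} \<subseteq> UNIV \<times> {0..1/2}" by auto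
  ultimately show ?thesis using continuous_on_compose2[OF assms, of "{0..1/2}" "\<lambda>z. (a, z)"] by simp
qed

lemma phase_DERIV:
  assumes "t \<in> {0..1/2}"
  shows "(phase a has_vector_derivative phase' a t) (at t within {0..1/2})"
  using sol_DERIV[OF half Y_solves assms, of a] D1_DERIV[OF half Y_solves assms, of a]
  unfolding phase_def[abs_def] phase'_def
  by (simp add: has_vector_derivative_complex_iff has_real_derivative_iff_has_vector_derivative)

lemma phase_0: "phase a 0 = Complex a (D1 (Y a) 0)"
  by (simp add: phase_def sol_0[OF half Y_solves])

context
  fixes A0 :: real
  assumes A0: "0 < A0" and nonzero: "\<And>a z. \<lbrakk>A0 \<le> a; z \<in> {0..1/2}\<rbrakk> \<Longrightarrow> Y a z \<noteq> 0 \<or> D1 (Y a) z \<noteq> 0"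
begin

lemma phase_nonzero: "\<lbrakk>A0 \<le> a; z \<in> {0..1/2}\<rbrakk> \<Longrightarrow> phase a z \<noteq> 0"
  using nonzero[of a z] by (auto simp: phase_def complex_eq_iff)

lemma log_deriv_cont: "continuous_on ({A0..} \<times> {0..1/2}) (\<lambda>x. phase' (fst x) (snd x) / phase (fst x) (snd x))"
  by (intro continuous_on_divide continuous_on_subset[OF phase_cont] continuous_on_subset[OF phase'_cont])
     (use phase_nonzero in auto)

lemma log_deriv_slice_cont:
  assumes "A0 \<le> a" shows "continuous_on {0..1/2} (\<lambda>t. phase' a t / phase a t)"
  by (intro continuous_on_divide phase_slice_cont phase_cont phase'_cont) (use assms phase_nonzero in auto)

lemma exp_phase_log:
  assumes "A0 \<le> a" "z \<in> {0..1/2}"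
  shows "exp (phase_log a z) = phase a z"
  unfolding phase_log_def
  by (rule exp_lift_of_logarithmic_integral[where Z = "1/2" and f = "phase a" and f' = "phase' a"])
     (use assms phase_DERIV phase_nonzero log_deriv_slice_cont in auto)

lemma phase_polar:
  assumes "A0 \<le> a" "z \<in> {0..1/2}"
  shows "Y a z = exp (Re (phase_log a z)) * cos (- Im (phase_log a z))"
    and "D1 (Y a) z = - exp (Re (phase_log a z)) * sin (- Im (phase_log a z))"
proof -
  have "phase a z = exp (phase_log a z)" using exp_phase_log[OF assms] by simp
  then have "Re (phase a z) = Re (exp (phase_log a z))" "Im (phase a z) = Im (exp (phase_log a z))" by auto
  then show "Y a z = exp (Re (phase_log a z)) * cos (- Im (phase_log a z))"
    "D1 (Y a) z = - exp (Re (phase_log a z)) * sin (- Im (phase_log a z))"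
    by (auto simp: phase_def Re_exp Im_exp)
qed

lemma phase_log_endpoint_cont: "continuous_on {A0..} (\<lambda>a. phase_log a (1/2))"
proof -
  have 1: "continuous_on {A0..} (\<lambda>a. phase a 0)"
    using continuous_on_compose2[OF phase_cont, of "{A0..}" "\<lambda>a. (a, 0)"]
    by (force intro!: continuous_intros)
  have 2: "continuous_on {A0..} (\<lambda>a. Ln (phase a 0))"
    by (rule continuous_on_Ln'[OF 1]) (use A0 in \<open>auto simp: phase_0 complex_nonpos_Reals_iff\<close>)
  have 3: "continuous_on {A0..} (\<lambda>a. integral (cbox 0 (1/2)) (\<lambda>t. phase' a t / phase a t))"
    by (rule integral_continuous_on_param) (use log_deriv_cont in \<open>simp add: case_prod_beta\<close>)
  show ?thesis unfolding phase_log_def using 2 3 by (intro continuous_on_add) auto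
qed

lemma phase_log_slice_cont:
  assumes "A0 \<le> a" shows "continuous_on {0..1/2} (phase_log a)"
  unfolding phase_log_def
  by (intro continuous_on_add continuous_on_const indefinite_integral_continuous_1
      integrable_continuous_interval log_deriv_slice_cont assms)

lemma phase_log_DERIV:
  assumes "A0 \<le> a" "t \<in> {0..1/2}"
  shows "(phase_log a has_vector_derivative phase' a t / phase a t) (at t within {0..1/2})"
proof -
  have "((\<lambda>z. Ln (phase a 0) + integral {0..z} (\<lambda>t. phase' a t / phase a t)) has_vector_derivative
      0 + phase' a t / phase a t) (at t within {0..1/2})"
    by (intro has_vector_derivative_add has_vector_derivative_const integral_has_vector_derivative
        log_deriv_slice_cont assms)
  then show ?thesis by (simp add: phase_log_def[abs_def])
qed

lemma angle_DERIV:
  assumes a: "A0 \<le> a" and t: "0 < t" "t < 1/2"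
  shows "((\<lambda>z. - Im (phase_log a z)) has_real_derivative
      ((D1 (Y a) t)\<^sup>2 - Y a t * D2 (Y a) t) / ((Y a t)\<^sup>2 + (D1 (Y a) t)\<^sup>2)) (at t)"
proof -
  have "(phase_log a has_vector_derivative phase' a t / phase a t) (at t)"
    using phase_log_DERIV[OF a, of t] at_within_Icc_at[of 0 t "1/2"] t by auto
  then have "((\<lambda>z. Im (phase_log a z)) has_real_derivative Im (phase' a t / phase a t)) (at t)"
    by (simp add: has_vector_derivative_complex_iff has_real_derivative_iff_has_vector_derivative)
  then have "((\<lambda>z. - Im (phase_log a z)) has_real_derivative - Im (phase' a t / phase a t)) (at t)"
    by (rule DERIV_minus)
  moreover have "- Im (phase' a t / phase a t) =
      ((D1 (Y a) t)\<^sup>2 - Y a t * D2 (Y a) t) / ((Y a t)\<^sup>2 + (D1 (Y a) t)\<^sup>2)"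
  proof -
    have "Im (phase' a t / phase a t) =
        (Y a t * D2 (Y a) t - (D1 (Y a) t)\<^sup>2) / ((Y a t)\<^sup>2 + (D1 (Y a) t)\<^sup>2)"
      unfolding phase_def phase'_def by (simp add: Im_divide power2_eq_square mult.commute)
    then show ?thesis by (simp only: minus_divide_left minus_diff_eq)
  qed
  ultimately show ?thesis by simp
qed

text \<open>At the angle \<open>- pi / 2\<close> one has \<open>y = 0 < y'\<close>, hence \<open>y < 0\<close> just before.  But an angle
  in \<open>{- pi / 2..pi / 2}\<close> means \<open>y \<ge> 0\<close>, so this angle is never reached from above.\<close>

lemma angle_lower:
  assumes a: "A0 \<le> a" and z: "0 \<le> z" "z \<le> 1/2"
  shows "- (pi / 2) < - Im (phase_log a z)"
proof (rule barrier_principle[of "1/2" "\<lambda>z. - Im (phase_log a z)"])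
  show cont: "continuous_on {0..1/2} (\<lambda>z. - Im (phase_log a z))"
    by (intro continuous_intros phase_log_slice_cont a)
  have "Re (phase a 0) > 0" using a A0 by (simp add: phase_0)
  then have "\<bar>Im (Ln (phase a 0))\<bar> < pi / 2"
    using Re_Ln_pos_lt_imp Re_Ln_pos_lt[of "phase a 0"] phase_nonzero[OF a, of 0] by auto
  then show "- (pi / 2) < - Im (phase_log a 0)" by (simp add: phase_log_def)
  fix x :: real assume x: "0 \<le> x" "x \<le> 1/2" and low: "\<And>t. \<lbrakk>0 \<le> t; t \<le> x\<rbrakk> \<Longrightarrow> - (pi / 2) \<le> - Im (phase_log a t)"
  show "- (pi / 2) < - Im (phase_log a x)"
  proof (rule ccontr)
    let ?\<theta> = "\<lambda>z. - Im (phase_log a z)"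
    assume "\<not> - (pi / 2) < ?\<theta> x"
    then have eq: "?\<theta> x = - (pi / 2)" using low[of x] x by simp
    have "x \<noteq> 0" using eq \<open>- (pi / 2) < - Im (phase_log a 0)\<close> by auto
    then have "0 < x" using x by simp
    have xin: "x \<in> {0..1/2}" using x by simp
    have y0: "Y a x = 0" using phase_polar(1)[OF a xin] unfolding eq by simp
    have "D1 (Y a) x = exp (Re (phase_log a x))" using phase_polar(2)[OF a xin] unfolding eq by simp
    then have d0: "0 < D1 (Y a) x" by simp
    have "(Y a has_real_derivative D1 (Y a) x) (at x within {0..1/2})"
      by (rule sol_DERIV[OF half Y_solves xin])
    then obtain d where d: "d > 0" "\<And>h. h > 0 \<Longrightarrow> x - h \<in> {0..1/2} \<Longrightarrow> h < d \<Longrightarrow> Y a (x - h) < Y a x"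
      using has_real_derivative_pos_inc_left[OF _ d0, of "Y a" x "{0..1/2}"] by blast
    have "continuous (at x within {0..1/2}) ?\<theta>"
      using cont xin by (simp add: continuous_on_eq_continuous_within)
    then obtain e where e: "e > 0" "\<And>t. t \<in> {0..1/2} \<Longrightarrow> dist t x < e \<Longrightarrow> dist (?\<theta> t) (?\<theta> x) < pi / 2"
      unfolding continuous_within_eps_delta by (metis pi_half_gt_zero)
    define h where "h = min x (min d e) / 2"
    have h: "0 < h" "h < x" "h < d" "h < e" using \<open>0 < x\<close> d(1) e(1) by (auto simp: h_def min_def)
    have tin: "x - h \<in> {0..1/2}" using h x by auto
    have "Y a (x - h) < 0" using d(2)[of h] h tin y0 by auto
    moreover have "\<bar>?\<theta> (x - h)\<bar> \<le> pi / 2"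
      using e(2)[OF tin] h low[of "x - h"] eq by (auto simp: dist_real_def)
    then have "0 \<le> cos (?\<theta> (x - h))" by (intro cos_ge_zero) auto
    then have "0 \<le> Y a (x - h)" using phase_polar(1)[OF a tin] by simp
    ultimately show False by simp
  qed
qed (use z in auto)

end

text \<open>Divided by \<open>y\<^sup>2 + y'\<^sup>2\<close>, the claim says \<open>\<theta>' \<ge> (\<omega>\<^sup>2 cos\<^sup>2 \<theta> + sin\<^sup>2 \<theta>) / 4\<close> for the angle \<open>\<theta>\<close> in the
  phase plane.  After multiplication by \<open>p = z * (1 - z)\<close> and elimination of \<open>y''\<close> by the equation, it
  remains to absorb a multiple \<open>W\<close> of \<open>y\<^sup>2\<close> into \<open>p / 2 * y'\<^sup>2 + \<kappa> * \<bar>y\<bar> powr (r + 2)\<close>.  If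
  \<open>\<kappa> * \<bar>y\<bar> powr r \<ge> W\<close>, the power does it; otherwise \<open>y\<close> is bounded and a large energy makes \<open>y'\<close>
  large.\<close>

lemma rotation_speed:
  assumes "0 < \<omega>"
  shows "\<exists>M. \<forall>a z. z0 \<le> z \<longrightarrow> z < 1/2 \<longrightarrow> M \<le> energy (Y a) z \<longrightarrow>
     \<omega>\<^sup>2 * (Y a z)\<^sup>2 + (D1 (Y a) z)\<^sup>2 \<le> 4 * ((D1 (Y a) z)\<^sup>2 - Y a z * D2 (Y a) z)"
proof -
  define W where "W = \<kappa> + (\<alpha> + \<beta>)\<^sup>2 * (2 / z0) + \<omega>\<^sup>2"
  have W0: "0 \<le> W" unfolding W_def using \<kappa> z0 by (intro add_nonneg_nonneg) auto
  define S where "S = ((W / \<kappa>) powr (1/r))\<^sup>2"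
  have S0: "0 \<le> S" by (simp add: S_def)
  define M where "M = 2 * W * S + \<kappa> * c0"
  have "\<omega>\<^sup>2 * (Y a z)\<^sup>2 + (D1 (Y a) z)\<^sup>2 \<le> 4 * ((D1 (Y a) z)\<^sup>2 - Y a z * D2 (Y a) z)"
    if z: "z0 \<le> z" "z < 1/2" and E: "M \<le> energy (Y a) z" for a z
  proof -
    define y v w \<phi> p q where "y = Y a z" and "v = D1 (Y a) z" and "w = D2 (Y a) z"
      and "\<phi> = \<bar>y\<bar> powr r" and "p = z * (1 - z)" and "q = \<alpha> - (\<alpha> + \<beta>) * z"
    have \<phi>0: "0 \<le> \<phi>" by (simp add: \<phi>_def)
    have "z0 * (1/2) \<le> z * (1 - z)" using z z0 by (intro mult_mono) auto
    then have p: "z0 / 2 \<le> p" "0 < p" using z0 by (auto simp: p_def)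
    have p1: "p \<le> 1" unfolding p_def using z z0 mult_mono[of z 1 "1 - z" 1] by simp
    have ode: "p * w + q * v + \<kappa> * (\<phi> * y - y) = 0"
      using sol_ode[OF half Y_solves, of z a] z z0
      by (simp add: y_def v_def w_def \<phi>_def p_def q_def g_def)
    have q: "q\<^sup>2 \<le> (\<alpha> + \<beta>)\<^sup>2"
    proof -
      define m where "m = (\<alpha> + \<beta>) * z"
      have "m \<le> \<alpha> + \<beta>" "0 \<le> m"
        unfolding m_def using z z0 \<alpha> \<beta> by (auto intro!: mult_left_le)
      then have "\<bar>q\<bar> \<le> \<bar>\<alpha> + \<beta>\<bar>" unfolding q_def m_def[symmetric] abs_le_iff using \<alpha> \<beta> by auto
      then show ?thesis by (simp only: abs_le_square_iff)
    qed
    have "W * y\<^sup>2 \<le> p / 2 * v\<^sup>2 + \<kappa> * \<phi> * y\<^sup>2"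
    proof (cases "W \<le> \<kappa> * \<phi>")
      case True
      then have "W * y\<^sup>2 \<le> \<kappa> * \<phi> * y\<^sup>2" by (rule mult_right_mono) simp
      moreover have "0 \<le> p / 2 * v\<^sup>2" using p by simp
      ultimately show ?thesis by linarith
    next
      case False
      have "\<phi> \<le> W / \<kappa>" using False \<kappa> by (simp add: field_simps)
      then have "\<bar>y\<bar> \<le> (W / \<kappa>) powr (1/r)"
      proof -
        have "\<bar>y\<bar> = \<phi> powr (1/r)" using r by (simp add: \<phi>_def powr_powr)
        also have "\<dots> \<le> (W / \<kappa>) powr (1/r)" using \<open>\<phi> \<le> W / \<kappa>\<close> \<phi>0 r by (intro powr_mono2) auto
        finally show ?thesis .
      qed
      then have yS: "y\<^sup>2 \<le> S" unfolding S_def using power_mono[of "\<bar>y\<bar>" "(W / \<kappa>) powr (1/r)" 2] by simp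
      have "\<kappa> * \<phi> * y\<^sup>2 \<le> W * S" using False \<kappa> \<phi>0 yS W0 by (intro mult_mono) auto
      moreover have "\<kappa> * \<phi> * y\<^sup>2 / (r + 2) \<le> \<kappa> * \<phi> * y\<^sup>2"
      proof -
        have "\<kappa> * \<phi> * y\<^sup>2 / (r + 2) \<le> \<kappa> * \<phi> * y\<^sup>2 / 1"
          using \<kappa> \<phi>0 r by (intro divide_left_mono) auto
        then show ?thesis by simp
      qed
      moreover have "M \<le> p * v\<^sup>2 / 2 + \<kappa> * \<phi> * y\<^sup>2 / (r + 2) - \<kappa> * y\<^sup>2 / 2 + \<kappa> * c0"
      proof -
        have "M \<le> p * v\<^sup>2 / 2 + \<kappa> * (\<phi> * y\<^sup>2 / (r + 2) - y\<^sup>2 / 2 + c0)"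
          using E unfolding energy_def G_def y_def[symmetric] v_def[symmetric] \<phi>_def[symmetric] p_def[symmetric] .
        also have "\<kappa> * (\<phi> * y\<^sup>2 / (r + 2) - y\<^sup>2 / 2 + c0)
            = \<kappa> * \<phi> * y\<^sup>2 / (r + 2) - \<kappa> * y\<^sup>2 / 2 + \<kappa> * c0"
          by (simp only: distrib_left right_diff_distrib times_divide_eq_right mult.assoc)
        finally show ?thesis by linarith
      qed
      moreover have "0 \<le> \<kappa> * y\<^sup>2 / 2" "0 \<le> \<kappa> * \<phi> * y\<^sup>2" using \<kappa> \<phi>0 by auto
      ultimately have "W * S \<le> p * v\<^sup>2 / 2 + \<kappa> * \<phi> * y\<^sup>2" unfolding M_def by linarith
      moreover have "W * y\<^sup>2 \<le> W * S" by (rule mult_left_mono[OF yS W0])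
      ultimately show ?thesis by simp
    qed
    moreover have "- (q * v * y) \<le> p / 4 * v\<^sup>2 + (\<alpha> + \<beta>)\<^sup>2 * (2 / z0) * y\<^sup>2"
    proof -
      have "0 \<le> (p / 2 * v + q * y)\<^sup>2" by simp
      then have "- (p * (q * v * y)) \<le> p\<^sup>2 / 4 * v\<^sup>2 + q\<^sup>2 * y\<^sup>2"
        by (simp add: power2_eq_square field_simps)
      also have "\<dots> \<le> p\<^sup>2 / 4 * v\<^sup>2 + (\<alpha> + \<beta>)\<^sup>2 * y\<^sup>2" using q by (intro add_mono mult_right_mono) auto
      also have "(\<alpha> + \<beta>)\<^sup>2 * y\<^sup>2 \<le> (p * (2 / z0)) * ((\<alpha> + \<beta>)\<^sup>2 * y\<^sup>2)"
        using p z0 mult_right_mono[of 1 "p * (2 / z0)" "(\<alpha> + \<beta>)\<^sup>2 * y\<^sup>2"] by (simp add: field_simps)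
      finally have "p * - (q * v * y) \<le> p * (p / 4 * v\<^sup>2 + (\<alpha> + \<beta>)\<^sup>2 * (2 / z0) * y\<^sup>2)"
        by (simp add: algebra_simps power2_eq_square)
      then show ?thesis by (rule mult_left_le_imp_le[OF _ p(2)])
    qed
    moreover have "p * \<omega>\<^sup>2 / 4 * y\<^sup>2 \<le> \<omega>\<^sup>2 * y\<^sup>2"
    proof (rule mult_right_mono)
      have "p * \<omega>\<^sup>2 \<le> 1 * \<omega>\<^sup>2" using p1 by (rule mult_right_mono) simp
      then show "p * \<omega>\<^sup>2 / 4 \<le> \<omega>\<^sup>2" using zero_le_power2[of \<omega>] by linarith
    qed simp
    moreover have "W * y\<^sup>2 = \<kappa> * y\<^sup>2 + (\<alpha> + \<beta>)\<^sup>2 * (2 / z0) * y\<^sup>2 + \<omega>\<^sup>2 * y\<^sup>2"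
      by (simp add: W_def distrib_right)
    ultimately have "0 \<le> 3 / 4 * (p * v\<^sup>2) + q * v * y + \<kappa> * \<phi> * y\<^sup>2 - \<kappa> * y\<^sup>2 - p * \<omega>\<^sup>2 / 4 * y\<^sup>2"
      by (simp add: field_simps)
    also have "\<dots> = p * (v\<^sup>2 - y * w) - p * (\<omega>\<^sup>2 * y\<^sup>2 + v\<^sup>2) / 4"
    proof -
      have "p * w = - q * v - \<kappa> * (\<phi> * y - y)" using ode by linarith
      then have "p * (y * w) = y * (- q * v - \<kappa> * (\<phi> * y - y))" by (metis mult.left_commute)
      then show ?thesis by (simp add: field_simps power2_eq_square)
    qed
    finally have "p * (\<omega>\<^sup>2 * y\<^sup>2 + v\<^sup>2) \<le> 4 * (p * (v\<^sup>2 - y * w))" by linarith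
    then have "p * (\<omega>\<^sup>2 * y\<^sup>2 + v\<^sup>2) \<le> p * (4 * (v\<^sup>2 - y * w))" by (simp only: mult.left_commute)
    then have "\<omega>\<^sup>2 * y\<^sup>2 + v\<^sup>2 \<le> 4 * (v\<^sup>2 - y * w)" by (rule mult_left_le_imp_le[OF _ p(2)])
    then show ?thesis unfolding y_def v_def w_def .
  qed
  then show ?thesis by blast
qed

text \<open>Large energy at \<open>z = 1/2\<close> means that \<open>(y, y')\<close> is far from the origin.  The angle is above
  \<open>- pi / 2\<close> at \<open>z0\<close>, and from \<open>z0\<close> to \<open>1/2\<close>, a length of at least \<open>1/4\<close>, the sheared angle increases
  with speed at least \<open>\<omega> / 4\<close>; here \<open>\<omega>\<close> is arbitrary if \<open>a\<close> is large, and the sheared angle differs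
  from the angle by at most \<open>pi / 2\<close>.\<close>

lemma shooting_curve:
  "\<exists>A0>0. \<exists>\<rho> \<theta>. continuous_on {A0..} \<rho> \<and> continuous_on {A0..} \<theta> \<and>
     filterlim \<rho> at_top at_top \<and> filterlim \<theta> at_top at_top \<and>
     (\<forall>a\<ge>A0. Y a (1/2) = exp (\<rho> a) * cos (\<theta> a) \<and> D1 (Y a) (1/2) = - exp (\<rho> a) * sin (\<theta> a))"
proof -
  obtain A1 where A1: "\<And>a z. \<lbrakk>A1 \<le> a; z \<in> {0..1/2}\<rbrakk> \<Longrightarrow> Y a z \<noteq> 0 \<or> D1 (Y a) z \<noteq> 0"
    using nonvanishing unfolding eventually_at_top_linorder by meson
  define A0 where "A0 = max A1 1"
  have A0: "0 < A0" by (simp add: A0_def)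
  have nz: "\<And>a z. \<lbrakk>A0 \<le> a; z \<in> {0..1/2}\<rbrakk> \<Longrightarrow> Y a z \<noteq> 0 \<or> D1 (Y a) z \<noteq> 0"
    using A1 by (simp add: A0_def)
  define \<rho> where "\<rho> a = Re (phase_log a (1/2))" for a
  define \<theta> where "\<theta> a = - Im (phase_log a (1/2))" for a
  have polar: "Y a (1/2) = exp (\<rho> a) * cos (\<theta> a) \<and> D1 (Y a) (1/2) = - exp (\<rho> a) * sin (\<theta> a)"
    if "A0 \<le> a" for a
    using phase_polar[OF A0 nz that, of "1/2"] by (simp add: \<rho>_def \<theta>_def)
  have "filterlim \<rho> at_top at_top"
    unfolding filterlim_at_top
  proof
    fix K :: real
    define B where "B = exp (2 * K)"
    have B0: "0 \<le> B" by (simp add: B_def)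
    show "\<forall>\<^sub>F a in at_top. K \<le> \<rho> a"
      using energy_at_top[of "B + \<kappa> * (sqrt B powr r * (sqrt B)\<^sup>2 / (r + 2) + c0) + 1"] eventually_ge_at_top[of A0]
    proof eventually_elim
      case (elim a)
      show ?case
      proof (rule ccontr)
        assume "\<not> K \<le> \<rho> a"
        then have "2 * \<rho> a \<le> 2 * K" by simp
        have "(Y a (1/2))\<^sup>2 + (D1 (Y a) (1/2))\<^sup>2 = (exp (\<rho> a))\<^sup>2 * ((sin (\<theta> a))\<^sup>2 + (cos (\<theta> a))\<^sup>2)"
          unfolding polar[OF elim(2), THEN conjunct1] polar[OF elim(2), THEN conjunct2] by algebra
        also have "\<dots> = exp (2 * \<rho> a)" by (simp add: exp_double)
        also have "\<dots> \<le> B" using \<open>2 * \<rho> a \<le> 2 * K\<close> by (simp add: B_def)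
        finally have le: "(Y a (1/2))\<^sup>2 + (D1 (Y a) (1/2))\<^sup>2 \<le> B" .
        have y: "\<bar>Y a (1/2)\<bar> \<le> sqrt B" and v: "(D1 (Y a) (1/2))\<^sup>2 \<le> B"
        proof -
          have "(Y a (1/2))\<^sup>2 \<le> B" "(D1 (Y a) (1/2))\<^sup>2 \<le> B"
            using le zero_le_power2[of "Y a (1/2)"] zero_le_power2[of "D1 (Y a) (1/2)"] by linarith+
          then have "\<bar>Y a (1/2)\<bar>\<^sup>2 \<le> B" "(D1 (Y a) (1/2))\<^sup>2 \<le> B" by simp_all
          then show "\<bar>Y a (1/2)\<bar> \<le> sqrt B" "(D1 (Y a) (1/2))\<^sup>2 \<le> B" by (auto intro: real_le_rsqrt)
        qed
        have "\<kappa> * (G (Y a (1/2)) + c0) \<le> \<kappa> * (sqrt B powr r * (sqrt B)\<^sup>2 / (r + 2) + c0)"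
          using G_upper[OF y] \<kappa> by (intro mult_left_mono) auto
        moreover have "energy (Y a) (1/2) = (D1 (Y a) (1/2))\<^sup>2 / 8 + \<kappa> * (G (Y a (1/2)) + c0)"
          by (simp add: energy_def)
        moreover have "B + \<kappa> * (sqrt B powr r * (sqrt B)\<^sup>2 / (r + 2) + c0) + 1 \<le> energy (Y a) (1/2)"
          using elim z0 by (auto simp del: real_sqrt_pow2)
        ultimately show False using v B0 by linarith
      qed
    qed
  qed
  moreover have "filterlim \<theta> at_top at_top"
    unfolding filterlim_at_top
  proof
    fix N :: real
    define \<omega> where "\<omega> = 16 * (\<bar>N\<bar> + 2 * pi)"
    have \<omega>: "0 < \<omega>" using pi_gt_zero by (simp add: \<omega>_def add_nonneg_pos)
    obtain M where M: "\<And>a z. \<lbrakk>z0 \<le> z; z < 1/2; M \<le> energy (Y a) z\<rbrakk> \<Longrightarrow>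
     \<omega>\<^sup>2 * (Y a z)\<^sup>2 + (D1 (Y a) z)\<^sup>2 \<le> 4 * ((D1 (Y a) z)\<^sup>2 - Y a z * D2 (Y a) z)"
      using rotation_speed[OF \<omega>] by blast
    show "\<forall>\<^sub>F a in at_top. N \<le> \<theta> a"
      using energy_at_top[of M] eventually_ge_at_top[of A0]
    proof eventually_elim
      case (elim a)
      let ?t = "\<lambda>z. - Im (phase_log a z)"
      let ?H = "\<lambda>z. sheared_angle \<omega> (?t z) - \<omega> / 4 * z"
      have Dt: "(?t has_real_derivative ((D1 (Y a) t)\<^sup>2 - Y a t * D2 (Y a) t) / ((Y a t)\<^sup>2 + (D1 (Y a) t)\<^sup>2)) (at t)"
        if "0 < t" "t < 1/2" for t using angle_DERIV[OF A0 nz elim(2) that] .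
      have "?H z0 \<le> ?H (1/2)"
      proof (rule DERIV_nonneg_imp_increasing_open[where f = ?H])
        have "continuous_on UNIV (sheared_angle \<omega>)"
          using sheared_angle_DERIV[OF \<omega>] DERIV_isCont continuous_at_imp_continuous_on by blast
        moreover have "continuous_on {z0..1/2} ?t"
          by (intro continuous_intros continuous_on_subset[OF phase_log_slice_cont[OF A0 nz elim(2)]])
             (use z0 in auto)
        ultimately have "continuous_on {z0..1/2} (\<lambda>z. sheared_angle \<omega> (?t z))"
          using continuous_on_compose2 by blast
        then show "continuous_on {z0..1/2} ?H" by (intro continuous_intros)
        fix t :: real assume t: "z0 < t" "t < 1/2"
        have t0: "0 < t" and tin: "t \<in> {0..1/2}" using t z0 by auto
        define y v R where "y = Y a t" and "v = D1 (Y a) t" and "R = exp (Re (phase_log a t))"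
        have R: "0 < R" by (simp add: R_def)
        have yR: "y = R * cos (?t t)" and vR: "v = - R * sin (?t t)"
          using phase_polar[OF A0 nz elim(2) tin] by (auto simp: y_def v_def R_def)
        have y2: "y\<^sup>2 = R\<^sup>2 * (cos (?t t))\<^sup>2" and v2: "v\<^sup>2 = R\<^sup>2 * (sin (?t t))\<^sup>2"
          unfolding yR vR by (simp_all add: power_mult_distrib)
        have r2: "y\<^sup>2 + v\<^sup>2 = R\<^sup>2"
          unfolding y2 v2 by (simp flip: distrib_left)
        let ?D = "v\<^sup>2 - y * D2 (Y a) t"
        let ?w = "\<omega>\<^sup>2 * (cos (?t t))\<^sup>2 + (sin (?t t))\<^sup>2"
        have "((\<lambda>z. sheared_angle \<omega> (?t z)) has_real_derivative (\<omega> / ?w) * (?D / R\<^sup>2)) (at t)"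
          using DERIV_chain2[OF sheared_angle_DERIV[OF \<omega>] Dt[OF t0 t(2)]]
          unfolding y_def[symmetric] v_def[symmetric] r2 .
        then have "(?H has_real_derivative (\<omega> / ?w) * (?D / R\<^sup>2) - \<omega> / 4 * 1) (at t)"
          by (intro DERIV_diff DERIV_cmult DERIV_ident)
        moreover have "0 \<le> (\<omega> / ?w) * (?D / R\<^sup>2) - \<omega> / 4 * 1"
        proof -
          have le: "\<omega>\<^sup>2 * y\<^sup>2 + v\<^sup>2 \<le> 4 * ?D" using M[of t a] t elim(1) by (auto simp: y_def v_def)
          have "\<omega>\<^sup>2 * y\<^sup>2 + v\<^sup>2 = R\<^sup>2 * ?w" unfolding y2 v2 by (simp add: algebra_simps)
          moreover have "y \<noteq> 0 \<or> v \<noteq> 0" using nz[OF elim(2) tin] by (simp add: y_def v_def)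
          then have "0 < \<omega>\<^sup>2 * y\<^sup>2 + v\<^sup>2"
            using \<omega> by (auto intro: add_pos_nonneg add_nonneg_pos)
          ultimately have pos: "0 < R\<^sup>2 * ?w" and le': "R\<^sup>2 * ?w \<le> 4 * ?D" using le by auto
          have "1 / 4 \<le> ?D / (R\<^sup>2 * ?w)" using pos le' by (simp add: pos_le_divide_eq)
          then have "\<omega> * (1 / 4) \<le> \<omega> * (?D / (R\<^sup>2 * ?w))" using \<omega> by (intro mult_left_mono) auto
          then show ?thesis by (simp add: mult.commute)
        qed
        ultimately show "\<exists>e. (?H has_real_derivative e) (at t) \<and> 0 \<le> e" by blast
      qed (use z0 in auto)
      moreover have "\<omega> / 4 * z0 \<le> \<omega> / 4 * (1/4)" using z0 \<omega> by (intro mult_left_mono) auto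
      ultimately have "sheared_angle \<omega> (?t z0) + \<omega> / 16 \<le> sheared_angle \<omega> (\<theta> a)"
        by (simp add: \<theta>_def)
      moreover have "- (pi / 2) < ?t z0" using angle_lower[OF A0 nz elim(2), of z0] z0 by auto
      moreover have "\<bar>sheared_angle \<omega> (?t z0) - ?t z0\<bar> < pi / 2" "\<bar>sheared_angle \<omega> (\<theta> a) - \<theta> a\<bar> < pi / 2"
        by (rule sheared_angle_near)+
      moreover have "\<omega> / 16 = \<bar>N\<bar> + 2 * pi" by (simp add: \<omega>_def)
      ultimately show ?case by linarith
    qed
  qed
  moreover have "continuous_on {A0..} \<rho>" "continuous_on {A0..} \<theta>"
    unfolding \<rho>_def \<theta>_def by (intro continuous_intros phase_log_endpoint_cont[OF A0 nz]; assumption)+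
  ultimately show ?thesis using A0 polar by blast
qed

end

section \<open>Intersection of two spirals\<close>

definition pt :: "real \<Rightarrow> real \<Rightarrow> real^2" where "pt x y = (\<chi> i. if i = 1 then x else y)"

lemma pt_nth [simp]: "pt x y $ 1 = x" "pt x y $ 2 = y" by (simp_all add: pt_def)

lemma pt_eq: "pt x y = pt x' y' \<longleftrightarrow> x = x' \<and> y = y'" by (auto simp: vec_eq_iff forall_2)

lemma pt_cont:
  assumes "continuous_on S f" "continuous_on S g"
  shows "continuous_on S (\<lambda>t. pt (f t) (g t))"
  unfolding pt_def
proof (rule continuous_on_vec_lambda)
  fix i :: 2 show "continuous_on S (\<lambda>t. if i = 1 then f t else g t)" using assms by (cases "i = 1") auto
qed

lemma curve_path:
  fixes f g :: "real \<Rightarrow> real"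
  assumes ab: "a \<le> b" and f: "continuous_on {a..b} f" and g: "continuous_on {a..b} g"
  defines "c \<equiv> \<lambda>t. pt (f (a + t * (b - a))) (g (a + t * (b - a)))"
  shows "path c" "pathstart c = pt (f a) (g a)" "pathfinish c = pt (f b) (g b)"
    "path_image c \<subseteq> (\<lambda>s. pt (f s) (g s)) ` {a..b}"
proof -
  have r: "a + t * (b - a) \<in> {a..b}" if "t \<in> {0..1}" for t
    using that ab mult_left_le_one_le[of "b - a" t] by auto
  have p: "continuous_on {0..1} (\<lambda>t. a + t * (b - a))" by (intro continuous_intros)
  show "path c" unfolding path_def c_def
    by (intro pt_cont continuous_on_compose2[OF f p] continuous_on_compose2[OF g p]) (use r in auto)
  show "pathstart c = pt (f a) (g a)" "pathfinish c = pt (f b) (g b)"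
    by (simp_all add: c_def pathstart_def pathfinish_def)
  show "path_image c \<subseteq> (\<lambda>s. pt (f s) (g s)) ` {a..b}"
    unfolding path_image_def c_def using r by blast
qed

lemma compact_max:
  fixes f :: "real \<Rightarrow> real"
  assumes "a \<le> b" "continuous_on {a..b} f"
  obtains c where "c \<in> {a..b}" "\<And>x. x \<in> {a..b} \<Longrightarrow> f x \<le> f c"
  using continuous_attains_sup[of "{a..b}" f] assms by auto

lemma continuous_bounded_below:
  fixes f :: "real \<Rightarrow> real"
  assumes f: "continuous_on {a..} f" and lim: "filterlim f at_top at_top"
  obtains m where "\<And>x. a \<le> x \<Longrightarrow> m \<le> f x"
proof -
  obtain A where A: "\<And>x. A \<le> x \<Longrightarrow> 0 \<le> f x"
    using lim unfolding filterlim_at_top eventually_at_top_linorder by meson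
  have "continuous_on {a..max a A} (\<lambda>x. - f x)"
    by (intro continuous_intros continuous_on_subset[OF f]) auto
  then obtain c where c: "\<And>x. x \<in> {a..max a A} \<Longrightarrow> - f x \<le> - f c"
    using compact_max[of a "max a A" "\<lambda>x. - f x"] by auto
  show thesis
  proof (rule that[of "min 0 (f c)"])
    fix x assume "a \<le> x"
    then show "min 0 (f c) \<le> f x" using A[of x] c[of x] by (cases "A \<le> x") auto
  qed
qed

lemma closed_segment_component_bounds:
  fixes u v x :: "real^'n"
  assumes "x \<in> closed_segment u v"
  shows "min (u $ i) (v $ i) \<le> x $ i \<and> x $ i \<le> max (u $ i) (v $ i)"
proof -
  have "\<exists>t. 0 \<le> t \<and> t \<le> 1 \<and> x = (1 - t) *\<^sub>R u + t *\<^sub>R v"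
    using assms by (simp only: in_segment(1))
  then obtain t where t: "0 \<le> t" "t \<le> 1" "x = (1 - t) *\<^sub>R u + t *\<^sub>R v" by (elim exE conjE)
  let ?r = "u $ i" and ?s = "v $ i"
  have "(1 - t) * ?r \<le> (1 - t) * max ?r ?s" "t * ?s \<le> t * max ?r ?s"
    "(1 - t) * min ?r ?s \<le> (1 - t) * ?r" "t * min ?r ?s \<le> t * ?s"
    using t by (auto intro!: mult_left_mono)
  moreover have "(1 - t) * w + t * w = w" for w by (simp add: algebra_simps)
  ultimately have "min ?r ?s \<le> (1 - t) * ?r + t * ?s \<and> (1 - t) * ?r + t * ?s \<le> max ?r ?s"
    by (metis add_mono)
  then show ?thesis unfolding t(3) by (simp only: vector_add_component vector_scaleR_component real_scaleR_def)
qed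

lemma pt_segment:
  assumes "x \<in> closed_segment (pt u v) (pt u' v')" "u \<le> u'" "v \<le> v'"
  shows "u \<le> x $ 1" "x $ 1 \<le> u'" "v \<le> x $ 2" "x $ 2 \<le> v'"
  using closed_segment_component_bounds[OF assms(1), of 1] closed_segment_component_bounds[OF assms(1), of 2] assms(2,3)
  by auto

text \<open>In the plane of the coordinates \<open>(\<rho>, \<theta>)\<close> the two curves are \<open>(\<rho>1, - \<theta>1)\<close> and
  \<open>(\<rho>2, \<theta>2 - N)\<close>.  The first one, prolonged to the left by a horizontal segment, runs from the left
  to the right side of a rectangle; the second one, prolonged downwards by a vertical segment, runs from
  the bottom to the top.  By the Fashoda theorem they meet.  The second curve starts so far out
  (at \<open>b1\<close>) that neither it nor its segment can meet the horizontal segment, and for large \<open>N\<close> the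
  vertical segment lies below the part of the first curve over the same \<open>\<rho>\<close>.\<close>

lemma spirals_meet:
  fixes \<rho>1 \<theta>1 \<rho>2 \<theta>2 :: "real \<Rightarrow> real"
  assumes c1: "continuous_on {a0..} \<rho>1" "continuous_on {a0..} \<theta>1"
    and c2: "continuous_on {b0..} \<rho>2" "continuous_on {b0..} \<theta>2"
    and l1: "filterlim \<rho>1 at_top at_top" "filterlim \<theta>1 at_top at_top"
    and l2: "filterlim \<rho>2 at_top at_top" "filterlim \<theta>2 at_top at_top"
  shows "\<exists>N0. \<forall>N\<ge>N0. \<exists>a\<ge>a0. \<exists>b\<ge>b0. \<rho>1 a = \<rho>2 b \<and> \<theta>1 a + \<theta>2 b = N"
proof -
  have big: "\<exists>A. \<forall>x\<ge>A. K \<le> f x" if "filterlim f at_top at_top" for f :: "real \<Rightarrow> real" and K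
    using that unfolding filterlim_at_top eventually_at_top_linorder by meson
  obtain b1 where b1: "b0 \<le> b1" "\<And>b. b1 \<le> b \<Longrightarrow> \<rho>1 a0 + 1 \<le> \<rho>2 b"
    using big[OF l2(1), of "\<rho>1 a0 + 1"] by (metis max.bounded_iff max.cobounded1)
  obtain a1 where a1: "a0 \<le> a1" "\<And>a. a1 \<le> a \<Longrightarrow> \<rho>2 b1 + 1 \<le> \<rho>1 a"
    using big[OF l1(1), of "\<rho>2 b1 + 1"] by (metis max.bounded_iff max.cobounded1)
  have c1': "continuous_on {a0..x} \<rho>1" "continuous_on {a0..x} \<theta>1" for x
    using c1 by (auto elim: continuous_on_subset)
  have c2': "continuous_on {b1..x} \<rho>2" "continuous_on {b1..x} \<theta>2" for x
    using c2 b1(1) by (auto elim!: continuous_on_subset)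
  obtain aC where C: "\<And>a. a \<in> {a0..a1} \<Longrightarrow> \<theta>1 a \<le> \<theta>1 aC"
    using compact_max[OF a1(1) c1'(2)] by blast
  obtain m where m: "\<And>a. a0 \<le> a \<Longrightarrow> m \<le> \<theta>1 a" using continuous_bounded_below[OF c1(2) l1(2)] by blast
  have "\<exists>a\<ge>a0. \<exists>b\<ge>b0. \<rho>1 a = \<rho>2 b \<and> \<theta>1 a + \<theta>2 b = N" if N: "\<theta>1 aC + \<theta>2 b1 + 1 \<le> N" for N
  proof -
    obtain B' where B': "b1 \<le> B'" "N - m \<le> \<theta>2 B'"
      using big[OF l2(2), of "N - m"] by (metis max.cobounded1 max.cobounded2)
    obtain B where B: "B \<in> {b1..B'}" "\<And>b. b \<in> {b1..B'} \<Longrightarrow> \<theta>2 b \<le> \<theta>2 B"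
      using compact_max[OF B'(1) c2'(2)] by blast
    have "b1 \<le> B" using B by simp
    have "N - m \<le> \<theta>2 B" using B(2)[of B'] B' by simp
    obtain bR where bR: "\<And>b. b \<in> {b1..B} \<Longrightarrow> \<rho>2 b \<le> \<rho>2 bR"
      using compact_max[OF \<open>b1 \<le> B\<close> c2'(1)] by blast
    obtain A' where A': "a0 \<le> A'" "\<rho>2 bR \<le> \<rho>1 A'"
      using big[OF l1(1), of "\<rho>2 bR"] by (metis max.cobounded1 max.cobounded2)
    obtain A where A: "A \<in> {a0..A'}" "\<And>a. a \<in> {a0..A'} \<Longrightarrow> \<rho>1 a \<le> \<rho>1 A"
      using compact_max[OF A'(1) c1'(1)] by blast
    have "a0 \<le> A" using A by simp
    have "\<rho>2 bR \<le> \<rho>1 A" using A(2)[of A'] A' by simp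
    obtain p where p: "\<And>a. a \<in> {a0..A} \<Longrightarrow> - \<rho>1 a \<le> - \<rho>1 p"
      using compact_max[OF \<open>a0 \<le> A\<close> continuous_on_minus[OF c1'(1)]] by blast
    obtain aT where aT: "\<And>a. a \<in> {a0..A} \<Longrightarrow> \<theta>1 a \<le> \<theta>1 aT"
      using compact_max[OF \<open>a0 \<le> A\<close> c1'(2)] by blast
    obtain q where q: "\<And>b. b \<in> {b1..B} \<Longrightarrow> - \<theta>2 b \<le> - \<theta>2 q"
      using compact_max[OF \<open>b1 \<le> B\<close> continuous_on_minus[OF c2'(2)]] by blast
    \<comment> \<open>The rectangle has the sides \<open>lf\<close>, \<open>\<rho>1 A\<close>,
      \<open>bt\<close> and \<open>\<theta>2 B - N\<close>: the end points \<open>A\<close> and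
      \<open>B\<close> are maxima, so that both curves stay inside.\<close>
    define lf where "lf = \<rho>1 p"
    define bt where "bt = min (- \<theta>1 aT) (\<theta>2 q - N)"
    define F where "F = linepath (pt lf (- \<theta>1 a0)) (pt (\<rho>1 a0) (- \<theta>1 a0)) +++
      (\<lambda>t. pt (\<rho>1 (a0 + t * (A - a0))) (- \<theta>1 (a0 + t * (A - a0))))"
    define H where "H = linepath (pt (\<rho>2 b1) bt) (pt (\<rho>2 b1) (\<theta>2 b1 - N)) +++
      (\<lambda>t. pt (\<rho>2 (b1 + t * (B - b1))) (\<theta>2 (b1 + t * (B - b1)) - N))"
    note F1 = curve_path[OF \<open>a0 \<le> A\<close> c1'(1) continuous_on_minus[OF c1'(2)]]
    note H1 = curve_path[OF \<open>b1 \<le> B\<close> c2'(1) continuous_on_diff[OF c2'(2) continuous_on_const]]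
    have Fim: "path_image F \<subseteq> {x. x $ 1 \<in> {lf..\<rho>1 a0} \<and> x $ 2 = - \<theta>1 a0} \<union> (\<lambda>a. pt (\<rho>1 a) (- \<theta>1 a)) ` {a0..A}"
    proof -
      have le: "lf \<le> \<rho>1 a0" using p[of a0] \<open>a0 \<le> A\<close> by (simp add: lf_def)
      have "path_image F \<subseteq> closed_segment (pt lf (- \<theta>1 a0)) (pt (\<rho>1 a0) (- \<theta>1 a0)) \<union> (\<lambda>a. pt (\<rho>1 a) (- \<theta>1 a)) ` {a0..A}"
        unfolding F_def path_image_linepath[symmetric]
        by (rule order_trans[OF path_image_join_subset Un_mono[OF order_refl F1(4)]])
      moreover have "closed_segment (pt lf (- \<theta>1 a0)) (pt (\<rho>1 a0) (- \<theta>1 a0)) \<subseteq> {x. x $ 1 \<in> {lf..\<rho>1 a0} \<and> x $ 2 = - \<theta>1 a0}"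
        using pt_segment[OF _ le order_refl] by (intro subsetI CollectI conjI antisym) simp_all
      ultimately show ?thesis by (meson Un_mono order_refl order_trans)
    qed
    have btle: "bt \<le> \<theta>2 b1 - N" using q[of b1] \<open>b1 \<le> B\<close> by (auto simp: bt_def)
    have Him: "path_image H \<subseteq> {x. x $ 1 = \<rho>2 b1 \<and> x $ 2 \<in> {bt..\<theta>2 b1 - N}} \<union> (\<lambda>b. pt (\<rho>2 b) (\<theta>2 b - N)) ` {b1..B}"
    proof -
      have "path_image H \<subseteq> closed_segment (pt (\<rho>2 b1) bt) (pt (\<rho>2 b1) (\<theta>2 b1 - N)) \<union> (\<lambda>b. pt (\<rho>2 b) (\<theta>2 b - N)) ` {b1..B}"
        unfolding H_def path_image_linepath[symmetric]
        by (rule order_trans[OF path_image_join_subset Un_mono[OF order_refl H1(4)]])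
      moreover have "closed_segment (pt (\<rho>2 b1) bt) (pt (\<rho>2 b1) (\<theta>2 b1 - N)) \<subseteq> {x. x $ 1 = \<rho>2 b1 \<and> x $ 2 \<in> {bt..\<theta>2 b1 - N}}"
        using pt_segment[OF _ order_refl btle] by (intro subsetI CollectI conjI antisym) simp_all
      ultimately show ?thesis by (meson Un_mono order_refl order_trans)
    qed
    have rb: "\<rho>1 a0 + 1 \<le> \<rho>2 b" if "b \<in> {b1..B}" for b using b1(2) that by auto
    obtain z where z: "z \<in> path_image F" "z \<in> path_image H"
    proof (rule fashoda[of F H "pt lf bt" "pt (\<rho>1 A) (\<theta>2 B - N)"])
      show "path F" unfolding F_def using F1 by (intro path_join_imp) auto
      show "path H" unfolding H_def using H1 by (intro path_join_imp) auto
      have 1: "lf \<le> \<rho>1 a \<and> \<rho>1 a \<le> \<rho>1 A \<and> bt \<le> - \<theta>1 a \<and> - \<theta>1 a \<le> \<theta>2 B - N" if a: "a \<in> {a0..A}" for a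
        using p[OF a] aT[OF a] m[of a] \<open>N - m \<le> \<theta>2 B\<close> A(2)[of a] A(1) a by (auto simp: lf_def bt_def)
      have lfa: "lf \<le> \<rho>1 a0" using 1[of a0] \<open>a0 \<le> A\<close> by auto
      have 2: "lf \<le> \<rho>2 b \<and> \<rho>2 b \<le> \<rho>1 A \<and> bt \<le> \<theta>2 b - N \<and> \<theta>2 b - N \<le> \<theta>2 B - N" if b: "b \<in> {b1..B}" for b
        using rb[OF b] lfa bR[OF b] \<open>\<rho>2 bR \<le> \<rho>1 A\<close> q[OF b] B(2)[of b] B(1) b by (auto simp: bt_def)
      show "path_image F \<subseteq> cbox (pt lf bt) (pt (\<rho>1 A) (\<theta>2 B - N))"
        using Fim 1 1[of a0] \<open>a0 \<le> A\<close> by (fastforce simp: mem_box_cart forall_2)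
      show "path_image H \<subseteq> cbox (pt lf bt) (pt (\<rho>1 A) (\<theta>2 B - N))"
        using Him 2 2[of b1] \<open>b1 \<le> B\<close> by (fastforce simp: mem_box_cart forall_2)
      show "pathstart F $ 1 = pt lf bt $ 1" by (simp add: F_def)
      show "pathfinish F $ 1 = pt (\<rho>1 A) (\<theta>2 B - N) $ 1" using F1(3) by (simp add: F_def)
      show "pathstart H $ 2 = pt lf bt $ 2" by (simp add: H_def)
      show "pathfinish H $ 2 = pt (\<rho>1 A) (\<theta>2 B - N) $ 2" using H1(3) by (simp add: H_def)
    qed
    have zH: "\<rho>1 a0 + 1 \<le> z $ 1" using Him z(2) rb \<open>b1 \<le> B\<close> by fastforce
    then obtain a where a: "a \<in> {a0..A}" "z = pt (\<rho>1 a) (- \<theta>1 a)" using Fim z(1) by fastforce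
    from Him z(2) consider "z $ 1 = \<rho>2 b1" "z $ 2 \<le> \<theta>2 b1 - N"
      | b where "b \<in> {b1..B}" "z = pt (\<rho>2 b) (\<theta>2 b - N)" by fastforce
    then show ?thesis
    proof cases
      case 1
      then have "\<rho>1 a = \<rho>2 b1" "- \<theta>1 a \<le> \<theta>2 b1 - N" using a by auto
      then have "a \<in> {a0..a1}" using a1(2)[of a] a by force
      then have "\<theta>1 a \<le> \<theta>1 aC" by (rule C)
      then show ?thesis using \<open>- \<theta>1 a \<le> \<theta>2 b1 - N\<close> N by simp
    next
      case 2
      then have "\<rho>1 a = \<rho>2 b" "- \<theta>1 a = \<theta>2 b - N" using a by (auto simp: pt_eq)
      then show ?thesis using a 2 b1(1) by (intro exI[of _ a] exI[of _ b] conjI) auto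
    qed
  qed
  then show ?thesis by blast
qed

section \<open>Gluing at the midpoint\<close>

lemma equal_derivatives_imp_equal:
  fixes f h :: "real \<Rightarrow> real"
  assumes f: "\<And>x. x \<in> {a..b} \<Longrightarrow> (f has_real_derivative d x) (at x within {a..b})"
    and h: "\<And>x. x \<in> {a..b} \<Longrightarrow> (h has_real_derivative d x) (at x within {a..b})"
    and c: "c \<in> {a..b}" "f c = h c" and x: "x \<in> {a..b}"
  shows "f x = h x"
proof -
  have "\<exists>k. \<forall>x\<in>{a..b}. f x - h x = k"
  proof (rule has_derivative_zero_constant)
    fix x assume "x \<in> {a..b}"
    then have "((\<lambda>x. f x - h x) has_real_derivative d x - d x) (at x within {a..b})"
      by (intro DERIV_diff f h)
    then show "((\<lambda>x. f x - h x) has_derivative (\<lambda>h. 0)) (at x within {a..b})"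
      by (simp add: has_field_derivative_def lambda_zero)
  qed simp
  then have "f x - h x = f c - h c" using c(1) x by metis
  then show ?thesis using c(2) by simp
qed

lemma two_primitives:
  fixes q :: "real \<Rightarrow> real"
  assumes q: "continuous_on UNIV q"
  obtains y y1 where "y 0 = u" "y1 0 = v"
    "\<And>z. z \<in> {-1..2} \<Longrightarrow> (y has_real_derivative y1 z) (at z within {-1..2})"
    "\<And>z. z \<in> {-1..2} \<Longrightarrow> (y1 has_real_derivative q z) (at z within {-1..2})"
proof -
  have prim: "\<exists>P. P 0 = w \<and> (\<forall>z\<in>{-1..2}. (P has_real_derivative p z) (at z within {-1..2}))"
    if p: "continuous_on {-1..2} p" for p :: "real \<Rightarrow> real" and w
  proof -
    obtain P where P: "\<And>x. x \<in> {-1..2} \<Longrightarrow> (P has_vector_derivative p x) (at x within {-1..2})"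
      using antiderivative_continuous[OF p] by blast
    have "((\<lambda>x. P x - P 0 + w) has_real_derivative p z) (at z within {-1..2})" if "z \<in> {-1..2}" for z
      using P[OF that] unfolding has_real_derivative_iff_has_vector_derivative[symmetric]
      by (auto intro!: derivative_eq_intros)
    then show ?thesis by (intro exI[of _ "\<lambda>x. P x - P 0 + w"]) auto
  qed
  obtain y1 where y1: "y1 0 = v" "\<forall>z\<in>{-1..2}. (y1 has_real_derivative q z) (at z within {-1..2})"
    using prim[of q v] continuous_on_subset[OF q] by blast
  have "continuous_on {-1..2} y1"
    using y1(2) by (meson DERIV_continuous continuous_on_eq_continuous_within)
  then obtain y where "y 0 = u" "\<forall>z\<in>{-1..2}. (y has_real_derivative y1 z) (at z within {-1..2})"
    using prim[of y1 u] by blast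
  then show thesis using that y1 by blast
qed

lemma reflect_DERIV:
  fixes f :: "real \<Rightarrow> real"
  assumes "\<And>z. z \<in> {0..1/2} \<Longrightarrow> (f has_real_derivative f' z) (at z within {0..1/2})" "z \<in> {1/2..1}"
  shows "((\<lambda>z. f (1 - z)) has_real_derivative - f' (1 - z)) (at z within {1/2..1})"
proof -
  have "((f \<circ> (\<lambda>z. 1 - z)) has_real_derivative f' (1 - z) * (-1)) (at z within {1/2..1})"
  proof (rule DERIV_image_chain)
    have "(\<lambda>z. 1 - z) ` {1/2..1} \<subseteq> {0..1/2::real}" by auto
    then show "(f has_real_derivative f' (1 - z)) (at (1 - z) within (\<lambda>z. 1 - z) ` {1/2..1})"
      using assms(1)[of "1 - z"] assms(2) by (intro DERIV_subset[OF assms(1)]) auto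
    show "((\<lambda>z. 1 - z) has_real_derivative -1) (at z within {1/2..1})" by (auto intro!: derivative_eq_intros)
  qed
  then show ?thesis by (simp add: o_def)
qed

lemma (in jacobi_shooting) D2_slice_cont: "continuous_on {0..1/2} (D2 (Y a))"
proof -
  have "continuous_on {0..1/2} (\<lambda>z. (a, z))" by (intro continuous_intros)
  moreover have "(\<lambda>z. (a, z)) ` {0..1/2} \<subseteq> UNIV \<times> {0..1/2}" by auto
  ultimately show ?thesis using continuous_on_compose2[OF D2_joint_cont, of "{0..1/2}" "\<lambda>z. (a, z)"] by simp
qed

text \<open>The left half is \<open>- Y a\<close> for the parameters \<open>(\<alpha>, \<beta>)\<close>, the right half the reflection \<open>z \<mapsto> 1 - z\<close> of
  \<open>Y b\<close> for \<open>(\<beta>, \<alpha>)\<close>.  Values and slopes match at \<open>z = 1/2\<close> iff the radii in the phase plane agree and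
  the angles add up to an odd multiple of \<open>pi\<close>, which \<open>spirals_meet\<close> achieves with \<open>a\<close> and \<open>b\<close>
  large.  The equation makes the second derivatives match as well.  Integrating the common second
  derivative \<open>q\<close>, extended by constants beyond the end points, gives a profile with two-sided
  derivatives at \<open>0\<close> and \<open>1\<close>.\<close>

lemma sign_changing_profile:
  assumes "jacobi_shooting \<alpha> \<beta> \<kappa> r" and "jacobi_shooting \<beta> \<alpha> \<kappa> r"
  shows "\<exists>y y1 y2 :: real \<Rightarrow> real. y 0 < - K \<and> K < y 1 \<and> continuous_on UNIV y2 \<and>
     (\<forall>z\<in>{-1<..<2}. (y has_real_derivative y1 z) (at z) \<and> (y1 has_real_derivative y2 z) (at z)) \<and>
     (\<forall>z\<in>{0..1}. z * (1 - z) * y2 z + (\<alpha> - (\<alpha> + \<beta>) * z) * y1 z + \<kappa> * (\<bar>y z\<bar> powr r * y z - y z) = 0)"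
proof -
  interpret L: jacobi_shooting \<alpha> \<beta> \<kappa> r by fact
  interpret R: jacobi_shooting \<beta> \<alpha> \<kappa> r by fact
  obtain A0 \<rho>1 \<theta>1 where 1: "continuous_on {A0..} \<rho>1" "continuous_on {A0..} \<theta>1"
      "filterlim \<rho>1 at_top at_top" "filterlim \<theta>1 at_top at_top"
    and Lp: "\<And>a. A0 \<le> a \<Longrightarrow> L.Y a (1/2) = exp (\<rho>1 a) * cos (\<theta>1 a)"
      "\<And>a. A0 \<le> a \<Longrightarrow> L.D1 (L.Y a) (1/2) = - exp (\<rho>1 a) * sin (\<theta>1 a)"
    using L.shooting_curve by blast
  obtain B0 \<rho>2 \<theta>2 where 2: "continuous_on {B0..} \<rho>2" "continuous_on {B0..} \<theta>2"
      "filterlim \<rho>2 at_top at_top" "filterlim \<theta>2 at_top at_top"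
    and Rp: "\<And>b. B0 \<le> b \<Longrightarrow> R.Y b (1/2) = exp (\<rho>2 b) * cos (\<theta>2 b)"
      "\<And>b. B0 \<le> b \<Longrightarrow> R.D1 (R.Y b) (1/2) = - exp (\<rho>2 b) * sin (\<theta>2 b)"
    using R.shooting_curve by blast
  obtain N0 where N0: "\<And>N. N0 \<le> N \<Longrightarrow> \<exists>a\<ge>max A0 (K + 1). \<exists>b\<ge>max B0 (K + 1). \<rho>1 a = \<rho>2 b \<and> \<theta>1 a + \<theta>2 b = N"
  proof -
    have sub: "{max A0 (K + 1)..} \<subseteq> {A0..}" "{max B0 (K + 1)..} \<subseteq> {B0..}" by auto
    show thesis
      using spirals_meet[OF continuous_on_subset[OF 1(1) sub(1)] continuous_on_subset[OF 1(2) sub(1)]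
          continuous_on_subset[OF 2(1) sub(2)] continuous_on_subset[OF 2(2) sub(2)] 1(3,4) 2(3,4)] that
      by (elim exE) blast
  qed
  obtain k :: nat where k: "N0 \<le> real k" using real_arch_simple by blast
  have "real k * 1 \<le> real (2 * k + 1) * pi" using pi_ge_two by (intro mult_mono) auto
  then obtain a b where a: "A0 \<le> a" "K + 1 \<le> a" and b: "B0 \<le> b" "K + 1 \<le> b" and \<rho>: "\<rho>1 a = \<rho>2 b"
    and \<theta>: "\<theta>1 a + \<theta>2 b = real (2 * k + 1) * pi"
    using N0[of "real (2 * k + 1) * pi"] k by auto
  have t2: "\<theta>2 b = (pi - \<theta>1 a) + 2 * real k * pi" using \<theta> by (simp add: algebra_simps)
  have "cos (\<theta>2 b) = cos (pi - \<theta>1 a)" "sin (\<theta>2 b) = sin (pi - \<theta>1 a)"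
    unfolding t2 by (simp_all only: cos_add[of _ "2 * real k * pi"] sin_add[of _ "2 * real k * pi"]
        cos_2npi sin_2npi mult_1_right mult_zero_right diff_zero add_0_right)
  then have cs: "cos (\<theta>2 b) = - cos (\<theta>1 a)" "sin (\<theta>2 b) = sin (\<theta>1 a)" by simp_all
  have v: "- L.Y a (1/2) = R.Y b (1/2)" and d: "- L.D1 (L.Y a) (1/2) = - R.D1 (R.Y b) (1/2)"
    unfolding Lp[OF a(1)] Rp[OF b(1)] cs \<rho> by simp_all
  have Lode: "z * (1 - z) * L.D2 (L.Y a) z + (\<alpha> - (\<alpha> + \<beta>) * z) * L.D1 (L.Y a) z
      + \<kappa> * (\<bar>L.Y a z\<bar> powr r * L.Y a z - L.Y a z) = 0" if "z \<in> {0..1/2}" for z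
    using L.sol_ode[OF L.half L.Y_solves that] by (simp add: L.g_def)
  have Rode: "z * (1 - z) * R.D2 (R.Y b) z + (\<beta> - (\<beta> + \<alpha>) * z) * R.D1 (R.Y b) z
      + \<kappa> * (\<bar>R.Y b z\<bar> powr r * R.Y b z - R.Y b z) = 0" if "z \<in> {0..1/2}" for z
    using R.sol_ode[OF R.half R.Y_solves that] by (simp add: R.g_def)
  have dd: "- L.D2 (L.Y a) (1/2) = R.D2 (R.Y b) (1/2)"
  proof -
    have h: "(1/2::real) \<in> {0..1/2}" by simp
    have e: "R.Y b (1/2) = - L.Y a (1/2)" "R.D1 (R.Y b) (1/2) = L.D1 (L.Y a) (1/2)" using v d by simp_all
    show ?thesis using Lode[OF h] Rode[OF h] unfolding e by (simp add: field_simps)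
  qed
  define q where "q z = (if z \<le> 1/2 then - L.D2 (L.Y a) (max 0 z) else R.D2 (R.Y b) (max 0 (1 - z)))" for z
  have "continuous_on UNIV q"
    unfolding q_def
  proof (rule continuous_on_cases_le)
    show "continuous_on {t \<in> UNIV. t \<le> 1/2} (\<lambda>z. - L.D2 (L.Y a) (max 0 z))"
      by (intro continuous_on_minus continuous_on_compose2[OF L.D2_slice_cont] continuous_intros) auto
    show "continuous_on {t \<in> UNIV. 1/2 \<le> t} (\<lambda>z. R.D2 (R.Y b) (max 0 (1 - z)))"
      by (intro continuous_on_compose2[OF R.D2_slice_cont] continuous_intros) (auto simp: max_def)
    fix t :: real assume "t = 1/2"
    then have t: "max 0 t = 1/2" "max 0 (1 - t) = 1/2" by auto
    show "- L.D2 (L.Y a) (max 0 t) = R.D2 (R.Y b) (max 0 (1 - t))" by (simp only: t dd)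
  qed (rule continuous_on_id)
  then obtain y y1 where y0: "y 0 = - a" "y1 0 = - L.D1 (L.Y a) 0"
    and y: "\<And>z. z \<in> {-1..2} \<Longrightarrow> (y has_real_derivative y1 z) (at z within {-1..2})"
    and y1: "\<And>z. z \<in> {-1..2} \<Longrightarrow> (y1 has_real_derivative q z) (at z within {-1..2})"
    using two_primitives[of q "- a" "- L.D1 (L.Y a) 0"] by metis
  have y1l: "y1 z = - L.D1 (L.Y a) z" if z: "z \<in> {0..1/2}" for z
  proof (rule equal_derivatives_imp_equal[where f = y1 and h = "\<lambda>z. - L.D1 (L.Y a) z" and d = q and c = 0, OF _ _ _ _ z])
    fix x :: real assume x: "x \<in> {0..1/2}"
    show "(y1 has_real_derivative q x) (at x within {0..1/2})" using y1[of x] x by (auto elim: DERIV_subset)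
    have "q x = - L.D2 (L.Y a) x" using x by (simp add: q_def)
    then show "((\<lambda>z. - L.D1 (L.Y a) z) has_real_derivative q x) (at x within {0..1/2})"
      using DERIV_minus[OF L.D1_DERIV[OF L.half L.Y_solves x]] by simp
  qed (use y0 in auto)
  have yl: "y z = - L.Y a z" if z: "z \<in> {0..1/2}" for z
  proof (rule equal_derivatives_imp_equal[where f = y and h = "\<lambda>z. - L.Y a z" and d = y1 and c = 0, OF _ _ _ _ z])
    fix x :: real assume x: "x \<in> {0..1/2}"
    show "(y has_real_derivative y1 x) (at x within {0..1/2})" using y[of x] x by (auto elim: DERIV_subset)
    show "((\<lambda>z. - L.Y a z) has_real_derivative y1 x) (at x within {0..1/2})"
      using DERIV_minus[OF L.sol_DERIV[OF L.half L.Y_solves x]] y1l[OF x] by simp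
  next
    show "y 0 = - L.Y a 0" using y0 L.sol_0[OF L.half L.Y_solves] by simp
  qed auto
  have y1r: "y1 z = - R.D1 (R.Y b) (1 - z)" if z: "z \<in> {1/2..1}" for z
  proof (rule equal_derivatives_imp_equal[where f = y1 and h = "\<lambda>z. - R.D1 (R.Y b) (1 - z)" and d = q and c = "1/2", OF _ _ _ _ z])
    fix x :: real assume x: "x \<in> {1/2..1}"
    show "(y1 has_real_derivative q x) (at x within {1/2..1})" using y1[of x] x by (auto elim: DERIV_subset)
    have "q x = R.D2 (R.Y b) (1 - x)"
    proof (cases "x = 1/2")
      case True
      have "q (1/2) = R.D2 (R.Y b) (1 - 1/2)" using dd by (simp add: q_def)
      then show ?thesis by (simp only: True)
    next
      case False
      then show ?thesis using x by (simp add: q_def)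
    qed
    then show "((\<lambda>z. - R.D1 (R.Y b) (1 - z)) has_real_derivative q x) (at x within {1/2..1})"
      using DERIV_minus[OF reflect_DERIV[OF R.D1_DERIV[OF R.half R.Y_solves] x]] by simp
  next
    show "y1 (1/2) = - R.D1 (R.Y b) (1 - 1/2)" using y1l[of "1/2"] d by simp
  qed auto
  have yr: "y z = R.Y b (1 - z)" if z: "z \<in> {1/2..1}" for z
  proof (rule equal_derivatives_imp_equal[where f = y and h = "\<lambda>z. R.Y b (1 - z)" and d = y1 and c = "1/2", OF _ _ _ _ z])
    fix x :: real assume x: "x \<in> {1/2..1}"
    show "(y has_real_derivative y1 x) (at x within {1/2..1})" using y[of x] x by (auto elim: DERIV_subset)
    show "((\<lambda>z. R.Y b (1 - z)) has_real_derivative y1 x) (at x within {1/2..1})"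
      using reflect_DERIV[OF R.sol_DERIV[OF R.half R.Y_solves] x] y1r[OF x] by simp
  next
    show "y (1/2) = R.Y b (1 - 1/2)" using yl[of "1/2"] v by simp
  qed auto
  have "z * (1 - z) * q z + (\<alpha> - (\<alpha> + \<beta>) * z) * y1 z + \<kappa> * (\<bar>y z\<bar> powr r * y z - y z) = 0"
    if z: "z \<in> {0..1}" for z
  proof (cases "z \<le> 1/2")
    case True
    then have zl: "z \<in> {0..1/2}" using z by simp
    have qz: "q z = - L.D2 (L.Y a) z" using zl by (simp add: q_def)
    show ?thesis using Lode[OF zl] unfolding qz yl[OF zl] y1l[OF zl] by (simp add: algebra_simps)
  next
    case False
    then have zr: "z \<in> {1/2..1}" "1 - z \<in> {0..1/2}" using z by auto
    have qz: "q z = R.D2 (R.Y b) (1 - z)" using False z by (simp add: q_def)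
    show ?thesis using Rode[OF zr(2)] unfolding qz yr[OF zr(1)] y1r[OF zr(1)] by (simp add: algebra_simps)
  qed
  moreover have "y 0 < - K" using y0 a by simp
  moreover have "K < y 1" using yr[of 1] R.sol_0[OF R.half R.Y_solves] b by simp
  moreover have "(y has_real_derivative y1 z) (at z) \<and> (y1 has_real_derivative q z) (at z)" if "z \<in> {-1<..<2}" for z
    using y[of z] y1[of z] that at_within_Icc_at[of "-1" z 2] by auto
  ultimately show ?thesis using \<open>continuous_on UNIV q\<close> by blast
qed

section \<open>Hessians of polynomials\<close>

text \<open>\<open>F' x v\<close> is the first derivative in the direction \<open>v\<close>, \<open>F'' x u v\<close> the second one in the directions
  \<open>u\<close> and \<open>v\<close>.  Symmetry and continuity are included because sums and products preserve the whole
  bundle, so that it holds for polynomials by induction.\<close>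

definition second_order_derivatives ::
  "('a::real_normed_vector \<Rightarrow> real) \<Rightarrow> ('a \<Rightarrow> 'a \<Rightarrow> real) \<Rightarrow> ('a \<Rightarrow> 'a \<Rightarrow> 'a \<Rightarrow> real) \<Rightarrow> bool" where
  "second_order_derivatives F F' F'' \<longleftrightarrow> (\<forall>x. (F has_derivative F' x) (at x)) \<and>
    (\<forall>x v. ((\<lambda>x. F' x v) has_derivative (\<lambda>u. F'' x u v)) (at x)) \<and>
    (\<forall>x u v. F'' x u v = F'' x v u) \<and> (\<forall>u v. continuous_on UNIV (\<lambda>x. F'' x u v))"

lemma second_order_derivativesD:
  assumes "second_order_derivatives F F' F''"
  shows "(F has_derivative F' x) (at x)" "((\<lambda>x. F' x v) has_derivative (\<lambda>u. F'' x u v)) (at x)"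
    "F'' x u v = F'' x v u" "continuous_on UNIV (\<lambda>x. F'' x u v)"
  using assms unfolding second_order_derivatives_def by blast+

lemma second_order_derivatives_add:
  assumes f: "second_order_derivatives f f' f''" and h: "second_order_derivatives h h' h''"
  shows "second_order_derivatives (\<lambda>x. f x + h x) (\<lambda>x v. f' x v + h' x v) (\<lambda>x u v. f'' x u v + h'' x u v)"
  unfolding second_order_derivatives_def
proof (intro conjI allI)
  show "f'' x u v + h'' x u v = f'' x v u + h'' x v u" for x u v
    using second_order_derivativesD(3)[OF f, of x u v] second_order_derivativesD(3)[OF h, of x u v] by simp
qed (intro has_derivative_add continuous_on_add second_order_derivativesD(1,2,4)[OF f]
    second_order_derivativesD(1,2,4)[OF h])+

lemma second_order_derivatives_mult:
  assumes f: "second_order_derivatives f f' f''" and h: "second_order_derivatives h h' h''"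
  shows "second_order_derivatives (\<lambda>x. f x * h x) (\<lambda>x v. f x * h' x v + f' x v * h x)
    (\<lambda>x u v. (f x * h'' x u v + f' x u * h' x v) + (f' x v * h' x u + f'' x u v * h x))"
  unfolding second_order_derivatives_def
proof (intro conjI allI)
  note f = second_order_derivativesD[OF f] and h = second_order_derivativesD[OF h]
  have c: "continuous_on UNIV f" "continuous_on UNIV h"
    "continuous_on UNIV (\<lambda>x. f' x v)" "continuous_on UNIV (\<lambda>x. h' x v)" for v
    using has_derivative_continuous[OF f(1)] has_derivative_continuous[OF h(1)]
      has_derivative_continuous[OF f(2)] has_derivative_continuous[OF h(2)]
    by (simp_all only: continuous_on_eq_continuous_at[OF open_UNIV] ball_UNIV simp_thms)
  show "((\<lambda>x. f x * h x) has_derivative (\<lambda>v. f x * h' x v + f' x v * h x)) (at x)" for x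
    by (rule has_derivative_mult[OF f(1) h(1)])
  show "((\<lambda>x. f x * h' x v + f' x v * h x) has_derivative
      (\<lambda>u. (f x * h'' x u v + f' x u * h' x v) + (f' x v * h' x u + f'' x u v * h x))) (at x)" for x v
    by (intro has_derivative_add has_derivative_mult f(1,2) h(1,2))
  show "(f x * h'' x u v + f' x u * h' x v) + (f' x v * h' x u + f'' x u v * h x)
      = (f x * h'' x v u + f' x v * h' x u) + (f' x u * h' x v + f'' x v u * h x)" for x u v
    using f(3)[of x u v] h(3)[of x u v] by simp
  show "continuous_on UNIV (\<lambda>x. (f x * h'' x u v + f' x u * h' x v) + (f' x v * h' x u + f'' x u v * h x))" for u v
    by (intro continuous_on_add continuous_on_mult c f(4) h(4))
qed

lemma real_polynomial_function_second_derivative: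
  assumes "real_polynomial_function F"
  shows "\<exists>F' F''. second_order_derivatives F F' F''"
  using assms
proof induction
  case (linear f)
  have "second_order_derivatives f (\<lambda>x. f) (\<lambda>x u v. 0)"
    unfolding second_order_derivatives_def
    by (simp add: bounded_linear_imp_has_derivative linear)
  then show ?case by blast
next
  case (const c)
  have "second_order_derivatives (\<lambda>x. c) (\<lambda>x v. 0) (\<lambda>x u v. 0)"
    unfolding second_order_derivatives_def by simp
  then show ?case by blast
qed (blast intro: second_order_derivatives_add second_order_derivatives_mult)+

lemma real_polynomial_function_Hessian:
  fixes F :: "'a::euclidean_space \<Rightarrow> real"
  assumes "real_polynomial_function F"
  obtains g H where "\<And>x. (F has_derivative (\<lambda>h. h \<bullet> g x)) (at x)"
    "\<And>x. (g has_derivative H x) (at x)" "\<And>x u v. H x u \<bullet> v = H x v \<bullet> u"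
    "\<And>v. continuous_on UNIV (\<lambda>x. H x v)"
proof -
  obtain F' F'' where "second_order_derivatives F F' F''"
    using real_polynomial_function_second_derivative[OF assms] by blast
  note F = second_order_derivativesD[OF this]
  define g where "g x = (\<Sum>b\<in>Basis. F' x b *\<^sub>R b)" for x
  define H where "H x u = (\<Sum>b\<in>Basis. F'' x u b *\<^sub>R b)" for x u
  have lin: "linear (F' x)" for x using F(1) by (rule has_derivative_linear)
  have g: "h \<bullet> g x = F' x h" for x h
  proof -
    have "F' x h = F' x (\<Sum>b\<in>Basis. (h \<bullet> b) *\<^sub>R b)" by (simp add: euclidean_representation)
    also have "\<dots> = (\<Sum>b\<in>Basis. (h \<bullet> b) * F' x b)"
      by (simp add: linear_sum[OF lin] linear_cmul[OF lin])
    also have "\<dots> = h \<bullet> g x" by (simp add: g_def inner_sum_right mult.commute)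
    finally show ?thesis by simp
  qed
  have dg: "(g has_derivative H x) (at x)" for x
    unfolding g_def[abs_def] H_def[abs_def]
    by (intro has_derivative_sum has_derivative_scaleR_left F(2))
  have Hb: "H x u \<bullet> v = F'' x u v" for x u v
  proof -
    have "((\<lambda>x. v \<bullet> g x) has_derivative (\<lambda>u. v \<bullet> H x u)) (at x)"
      by (rule has_derivative_inner_right[OF dg])
    then have "((\<lambda>x. F' x v) has_derivative (\<lambda>u. v \<bullet> H x u)) (at x)" by (simp only: g)
    from has_derivative_unique[OF this F(2)] show ?thesis by (metis inner_commute)
  qed
  show thesis
  proof (rule that[of g H])
    show "(F has_derivative (\<lambda>h. h \<bullet> g x)) (at x)" for x using F(1)[of x] by (simp add: g)
    show "continuous_on UNIV (\<lambda>x. H x v)" for v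
      unfolding H_def by (intro continuous_on_sum continuous_on_scaleR F(4) continuous_on_const)
    show "H x u \<bullet> v = H x v \<bullet> u" for x u v using F(3)[of x u v] by (simp add: Hb)
  qed (rule dg)
qed

section \<open>Derivatives on the sphere\<close>

text \<open>For a unit vector \<open>x\<close> the orthogonal projection onto the tangent space of the unit sphere at \<open>x\<close>.\<close>

definition tangential :: "'a::real_inner \<Rightarrow> 'a \<Rightarrow> 'a" where "tangential x h = h - (h \<bullet> x) *\<^sub>R x"

lemma tangential_orthogonal: "norm x = 1 \<Longrightarrow> tangential x h \<bullet> x = 0"
  by (simp add: tangential_def inner_diff_left dot_square_norm)

lemma tangential_id: "h \<bullet> x = 0 \<Longrightarrow> tangential x h = h"
  by (simp add: tangential_def)

definition great_circle :: "'a::real_inner \<Rightarrow> 'a \<Rightarrow> real \<Rightarrow> 'a" where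
  "great_circle x v t = cos t *\<^sub>R x + sin t *\<^sub>R v"

lemma great_circle_in_sphere:
  assumes "norm x = 1" "norm v = 1" "v \<bullet> x = 0"
  shows "great_circle x v t \<in> sphere 0 1"
proof -
  have x: "x \<bullet> x = 1" and v: "v \<bullet> v = 1" using assms by (simp_all only: norm_eq_1)
  have "(norm (great_circle x v t))\<^sup>2 = (cos t)\<^sup>2 + (sin t)\<^sup>2"
    using assms(3) x v unfolding power2_norm_eq_inner great_circle_def
    by (simp add: inner_add_left inner_add_right inner_commute[of x v] power2_eq_square)
  then have "(norm (great_circle x v t))\<^sup>2 = 1\<^sup>2" by simp
  then have "norm (great_circle x v t) = 1" by (rule power2_eq_imp_eq) auto
  then show ?thesis by simp
qed

lemma great_circle_0 [simp]: "great_circle x v 0 = x" by (simp add: great_circle_def)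

lemma great_circle_DERIV: "(great_circle x v has_derivative (\<lambda>t. t *\<^sub>R v)) (at 0)"
  unfolding great_circle_def[abs_def] by (auto intro!: derivative_eq_intros)

text \<open>Both derivatives compute the velocity of \<open>f\<close> along the great circle through \<open>x\<close> in the direction
  \<open>v\<close>.\<close>

lemma sphere_derivative_unique:
  fixes f :: "'a::real_inner \<Rightarrow> 'b::real_normed_vector"
  assumes D: "(f has_derivative D) (at x within sphere 0 1)" and E: "(f has_derivative E) (at x within sphere 0 1)"
    and x: "norm x = 1" and v: "v \<bullet> x = 0"
  shows "D v = E v"
proof (cases "v = 0")
  case True
  then show ?thesis using has_derivative_linear[OF D] has_derivative_linear[OF E] by (simp add: linear_0)
next
  case False
  define w where "w = v /\<^sub>R norm v"
  have w: "norm w = 1" "w \<bullet> x = 0" using False v by (auto simp: w_def)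
  have img: "great_circle x w ` UNIV \<subseteq> sphere 0 1" using great_circle_in_sphere[OF x w] by blast
  have comp: "((\<lambda>t. f (great_circle x w t)) has_derivative (\<lambda>t. D (t *\<^sub>R w))) (at 0)"
    if D: "(f has_derivative D) (at x within sphere 0 1)" for D
    using diff_chain_within[of "great_circle x w" "\<lambda>t. t *\<^sub>R w" 0 UNIV f D]
      great_circle_DERIV[of x w] has_derivative_subset[OF D img] by (simp add: o_def)
  have "(\<lambda>t. D (t *\<^sub>R w)) = (\<lambda>t. E (t *\<^sub>R w))" by (rule has_derivative_unique[OF comp[OF D] comp[OF E]])
  then have "D (norm v *\<^sub>R w) = E (norm v *\<^sub>R w)" by (rule fun_cong)
  then show ?thesis using False by (simp add: w_def)
qed

text \<open>On the sphere \<open>y \<bullet> x - 1 = - (norm (y - x))\<^sup>2 / 2\<close> vanishes to second order at \<open>x\<close>, so its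
  Euclidean derivative \<open>h \<bullet> x\<close> may be subtracted with any coefficient.\<close>

lemma sphere_derivative_tangential:
  fixes f :: "'a::real_inner \<Rightarrow> 'b::real_normed_vector"
  assumes D: "(f has_derivative D) (at x within sphere 0 1)" and x: "norm x = 1"
  shows "(f has_derivative (\<lambda>h. D (tangential x h))) (at x within sphere 0 1)"
proof -
  let ?\<phi> = "\<lambda>y. (y \<bullet> x - 1) *\<^sub>R D x"
  have lin: "linear D" using D by (rule has_derivative_linear)
  have 1: "(?\<phi> has_derivative (\<lambda>h. (h \<bullet> x) *\<^sub>R D x)) (at x within sphere 0 1)"
    by (auto intro!: derivative_eq_intros)
  have "((\<lambda>y. (- ((y - x) \<bullet> (y - x)) / 2) *\<^sub>R D x) has_derivative (\<lambda>h. 0)) (at x within sphere 0 1)"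
    by (auto intro!: derivative_eq_intros)
  then have 2: "(?\<phi> has_derivative (\<lambda>h. 0)) (at x within sphere 0 1)"
  proof (rule has_derivative_transform[rotated 2])
    show "x \<in> sphere 0 1" using x by simp
    fix y :: 'a assume "y \<in> sphere 0 1"
    then have "y \<bullet> y = 1" "x \<bullet> x = 1" using x by (simp_all add: dot_square_norm)
    then have "- ((y - x) \<bullet> (y - x)) / 2 = y \<bullet> x - 1"
      by (simp add: inner_diff_left inner_diff_right inner_commute[of x y])
    then show "?\<phi> y = (- ((y - x) \<bullet> (y - x)) / 2) *\<^sub>R D x" by simp
  qed
  have "((\<lambda>y. (f y - ?\<phi> y) + ?\<phi> y) has_derivative (\<lambda>h. (D h - (h \<bullet> x) *\<^sub>R D x) + 0)) (at x within sphere 0 1)"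
    by (intro has_derivative_add has_derivative_diff D 1 2)
  moreover have "D h - (h \<bullet> x) *\<^sub>R D x = D (tangential x h)" for h
    by (simp add: tangential_def linear_diff[OF lin] linear_cmul[OF lin])
  ultimately show ?thesis by simp
qed

lemma sphere_local_max_gradient:
  fixes \<phi> :: "'a::real_inner \<Rightarrow> real"
  assumes D: "(\<phi> has_derivative (\<lambda>h. h \<bullet> w)) (at x)" and x: "norm x = 1" and d: "0 < d"
    and mx: "\<And>y. y \<in> sphere 0 1 \<Longrightarrow> dist y x < d \<Longrightarrow> \<phi> y \<le> \<phi> x"
  shows "tangential x w = 0"
proof (rule ccontr)
  assume nz: "tangential x w \<noteq> 0"
  define v where "v = tangential x w /\<^sub>R norm (tangential x w)"
  have v: "norm v = 1" "v \<bullet> x = 0" using nz tangential_orthogonal[OF x, of w] by (auto simp: v_def)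
  have "((\<lambda>t. \<phi> (great_circle x v t)) has_derivative (\<lambda>t. (t *\<^sub>R v) \<bullet> w)) (at 0)"
    using diff_chain_at[OF great_circle_DERIV, of \<phi> "\<lambda>h. h \<bullet> w" x v] D by (simp add: o_def)
  then have D0: "((\<lambda>t. \<phi> (great_circle x v t)) has_real_derivative v \<bullet> w) (at 0)"
    by (simp add: has_field_derivative_def mult_commute_abs)
  have "continuous (at 0) (great_circle x v)" by (rule has_derivative_continuous[OF great_circle_DERIV])
  then have "\<exists>e>0. \<forall>t. dist t 0 < e \<longrightarrow> dist (great_circle x v t) (great_circle x v 0) < d"
    using d by (simp only: continuous_at_eps_delta)
  then obtain e where e: "e > 0" "\<And>t. dist t 0 < e \<Longrightarrow> dist (great_circle x v t) (great_circle x v 0) < d"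
    by blast
  have "v \<bullet> w = 0"
  proof (rule DERIV_local_max[OF D0 e(1)], intro allI impI)
    fix t :: real assume "\<bar>0 - t\<bar> < e"
    then show "\<phi> (great_circle x v t) \<le> \<phi> (great_circle x v 0)"
      using mx[OF great_circle_in_sphere[OF x v], of t] e(2)[of t] by (simp add: dist_real_def)
  qed
  moreover have "v \<bullet> w = norm (tangential x w)"
  proof -
    have "tangential x w \<bullet> tangential x w = tangential x w \<bullet> w"
      using tangential_orthogonal[OF x, of w]
      by (simp add: tangential_def[of x w] inner_diff_right)
    then have "tangential x w \<bullet> w = norm (tangential x w) * norm (tangential x w)"
      by (simp add: dot_square_norm power2_eq_square)
    then show ?thesis using nz by (simp add: v_def)
  qed
  ultimately show False using nz by simp
qed

section \<open>Traces of symmetric projections\<close>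

text \<open>Idempotence is required as an identity of quadratic forms, the shape in which a second order
  expansion delivers it.\<close>

locale symmetric_projection =
  fixes Q :: "'a::euclidean_space \<Rightarrow> 'a"
  assumes lin: "linear Q" and sym: "\<And>u v. Q u \<bullet> v = u \<bullet> Q v" and idem: "\<And>u. Q u \<bullet> Q u = Q u \<bullet> u"
begin

lemma polarized: "Q u \<bullet> Q v = Q u \<bullet> v"
proof -
  have "Q u \<bullet> Q u + Q v \<bullet> Q u + (Q u \<bullet> Q v + Q v \<bullet> Q v) = Q u \<bullet> u + Q v \<bullet> u + (Q u \<bullet> v + Q v \<bullet> v)"
    using idem[of "u + v"] unfolding linear_add[OF lin] inner_add_left inner_add_right .
  moreover have "Q v \<bullet> Q u = Q u \<bullet> Q v" by (rule inner_commute)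
  moreover have "Q v \<bullet> u = Q u \<bullet> v" unfolding sym[of u v] by (rule inner_commute)
  ultimately show ?thesis using idem[of u] idem[of v] by linarith
qed

lemma idempotent: "Q (Q u) = Q u"
proof -
  have "(Q (Q u) - Q u) \<bullet> v = 0" for v
    using polarized[of u v] sym[of "Q u" v] by (simp add: inner_diff_left)
  then show ?thesis by (metis inner_eq_zero_iff eq_iff_diff_eq_0)
qed

definition trace :: real where "trace = (\<Sum>b\<in>Basis. Q b \<bullet> b)"

text \<open>By \<open>idem\<close> the trace is the sum of the \<open>Q b \<bullet> Q b\<close>, and Bessel's inequality for the orthonormal pair
  \<open>p\<close>, \<open>v\<close> in the range of \<open>Q\<close> bounds it below by \<open>(norm p)\<^sup>2 + (norm v)\<^sup>2\<close>.\<close>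

lemma trace_ge_2:
  assumes p: "Q p = p" "norm p = 1" and v: "Q v = v" "norm v = 1" and pv: "p \<bullet> v = 0"
  shows "2 \<le> trace"
proof -
  have e1: "p \<bullet> p = 1" "v \<bullet> v = 1" using p(2) v(2) by (simp_all only: norm_eq_1)
  have e2: "v \<bullet> p = 0" using pv inner_commute[of v p] by simp
  have bessel: "(p \<bullet> w)\<^sup>2 + (v \<bullet> w)\<^sup>2 \<le> w \<bullet> w" for w
  proof -
    have "0 \<le> (w - (p \<bullet> w) *\<^sub>R p - (v \<bullet> w) *\<^sub>R v) \<bullet> (w - (p \<bullet> w) *\<^sub>R p - (v \<bullet> w) *\<^sub>R v)"
      by (rule inner_ge_zero)
    also have "\<dots> = w \<bullet> w - (p \<bullet> w)\<^sup>2 - (v \<bullet> w)\<^sup>2"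
    proof -
      have e: "w \<bullet> p = p \<bullet> w" "w \<bullet> v = v \<bullet> w" by (rule inner_commute)+
      show ?thesis
        unfolding inner_diff_left inner_diff_right inner_scaleR_left inner_scaleR_right e e1 e2 pv by algebra
    qed
    finally show ?thesis by simp
  qed
  have "2 = p \<bullet> p + v \<bullet> v" unfolding e1 by simp
  also have "\<dots> = (\<Sum>b\<in>Basis. (p \<bullet> b)\<^sup>2 + (v \<bullet> b)\<^sup>2)"
    by (simp only: sum.distrib euclidean_inner[of p p] euclidean_inner[of v v] power2_eq_square)
  also have "\<dots> = (\<Sum>b\<in>Basis. (p \<bullet> Q b)\<^sup>2 + (v \<bullet> Q b)\<^sup>2)"
    by (simp only: sym[symmetric] p(1) v(1))
  also have "\<dots> \<le> (\<Sum>b\<in>Basis. Q b \<bullet> Q b)" by (rule sum_mono) (rule bessel)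
  also have "\<dots> = trace" by (simp add: trace_def idem)
  finally show ?thesis .
qed

text \<open>Cauchy-Schwarz for \<open>Q u\<close> against each \<open>Q b\<close>, summed over the basis.\<close>

lemma trace_ge_1:
  assumes "Q u \<noteq> 0"
  shows "1 \<le> trace"
proof -
  let ?e = "Q u"
  have "?e \<bullet> ?e = (\<Sum>b\<in>Basis. (?e \<bullet> b) * (?e \<bullet> b))" by (rule euclidean_inner)
  also have "\<dots> = (\<Sum>b\<in>Basis. (?e \<bullet> Q b)\<^sup>2)"
    by (simp only: sym[of ?e, symmetric] idempotent power2_eq_square)
  also have "\<dots> \<le> (\<Sum>b\<in>Basis. (?e \<bullet> ?e) * (Q b \<bullet> Q b))" by (rule sum_mono) (rule Cauchy_Schwarz_ineq)
  also have "\<dots> = (?e \<bullet> ?e) * trace" by (simp add: trace_def idem sum_distrib_left)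
  finally have "(?e \<bullet> ?e) * 1 \<le> (?e \<bullet> ?e) * trace" by simp
  moreover have "0 < ?e \<bullet> ?e" using assms by simp
  ultimately show ?thesis by (rule mult_left_le_imp_le)
qed

lemma complement: "symmetric_projection (\<lambda>u. u - Q u)"
proof (rule symmetric_projection.intro)
  show "linear (\<lambda>u. u - Q u)" by (intro linear_compose_sub linear_id[unfolded id_def] lin)
  show "(u - Q u) \<bullet> v = u \<bullet> (v - Q v)" for u v by (simp only: inner_diff_left inner_diff_right sym)
  show "(u - Q u) \<bullet> (u - Q u) = (u - Q u) \<bullet> u" for u
    using idem[of u] unfolding inner_diff_left inner_diff_right inner_commute[of u "Q u"] by simp
qed

lemma trace_le:
  assumes p: "Q p = 0" "norm p = 1" and v: "Q v = 0" "norm v = 1" and pv: "p \<bullet> v = 0"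
  shows "trace \<le> DIM('a) - 2"
proof -
  interpret C: symmetric_projection "\<lambda>u. u - Q u" by (rule complement)
  have "2 \<le> C.trace" by (rule C.trace_ge_2) (use assms in auto)
  also have "C.trace = real DIM('a) - trace"
    by (simp add: C.trace_def trace_def inner_diff_left sum_subtractf)
  finally show ?thesis by simp
qed

end

section \<open>The Laplacian of the sphere\<close>

lemma sum_Basis_tangential_norm:
  fixes x :: "'a::euclidean_space"
  assumes "norm x = 1"
  shows "(\<Sum>b\<in>Basis. tangential x b \<bullet> tangential x b) = real DIM('a) - 1"
proof -
  have x: "x \<bullet> x = 1" using assms by (simp only: norm_eq_1)
  have "tangential x b \<bullet> tangential x b = 1 - (b \<bullet> x) * (b \<bullet> x)" if "b \<in> Basis" for b
  proof -
    have bb: "b \<bullet> b = 1" using that by (simp add: inner_same_Basis)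
    show ?thesis
      unfolding tangential_def inner_diff_left inner_diff_right inner_scaleR_left inner_scaleR_right
        bb x inner_commute[of x b] by algebra
  qed
  then have "(\<Sum>b\<in>Basis. tangential x b \<bullet> tangential x b) = (\<Sum>b\<in>Basis. 1 - (x \<bullet> b) * (x \<bullet> b))"
    by (intro sum.cong refl) (simp only: inner_commute[of _ x])
  also have "\<dots> = real DIM('a) - x \<bullet> x"
    by (simp add: sum_subtractf euclidean_inner[of x x])
  finally show ?thesis by (simp add: x)
qed

lemma sphere_grad_eq:
  fixes u :: "'a::euclidean_space \<Rightarrow> real"
  assumes D: "(u has_derivative (\<lambda>h. h \<bullet> w)) (at x)" and x: "norm x = 1"
  shows "sphere_grad u x = tangential x w"
  unfolding sphere_grad_def
proof (rule the_equality)
  have "(u has_derivative (\<lambda>h. tangential x h \<bullet> w)) (at x within sphere 0 1)"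
    by (rule sphere_derivative_tangential[OF has_derivative_at_withinI[OF D] x])
  moreover have "tangential x h \<bullet> w = h \<bullet> tangential x w" for h
    by (simp add: tangential_def inner_diff_left inner_diff_right inner_commute)
  ultimately show "tangential x w \<bullet> x = 0 \<and> (u has_derivative (\<lambda>h. h \<bullet> tangential x w)) (at x within sphere 0 1)"
    using tangential_orthogonal[OF x] by simp
  fix v assume v: "v \<bullet> x = 0 \<and> (u has_derivative (\<lambda>h. h \<bullet> v)) (at x within sphere 0 1)"
  let ?d = "v - tangential x w"
  have d: "?d \<bullet> x = 0" using v tangential_orthogonal[OF x] by (simp add: inner_diff_left)
  have "?d \<bullet> v = ?d \<bullet> w"
    using sphere_derivative_unique[OF conjunct2[OF v] has_derivative_at_withinI[OF D] x d] .
  moreover have "?d \<bullet> w = ?d \<bullet> tangential x w"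
    using d by (simp add: tangential_def[of x w] inner_diff_right)
  ultimately have "?d \<bullet> ?d = 0" by (simp add: inner_diff_right)
  then show "v = tangential x w" by simp
qed

text \<open>The gradient on the sphere is \<open>w y - (w y \<bullet> y) y\<close>.  Differentiating the normal part in a tangent
  direction \<open>h\<close> leaves the tangential contribution \<open>(w x \<bullet> x) h\<close>, whose trace over the tangent space is
  the last term: the mean curvature of the sphere times the normal derivative.\<close>

lemma sphere_laplacian_eq:
  fixes u :: "'a::euclidean_space \<Rightarrow> real"
  assumes U: "open U" "sphere 0 1 \<subseteq> U" and D: "\<And>y. y \<in> U \<Longrightarrow> (u has_derivative (\<lambda>h. h \<bullet> w y)) (at y)"
    and K: "(w has_derivative K) (at x)" and x: "norm x = 1"
  shows "sphere_laplacian u x = (\<Sum>b\<in>Basis. K (tangential x b) \<bullet> tangential x b) - (real DIM('a) - 1) * (w x \<bullet> x)"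
proof -
  let ?X = "\<lambda>y. tangential y (w y)"
  let ?D = "\<lambda>h. K h - ((w x \<bullet> h + K h \<bullet> x) *\<^sub>R x + (w x \<bullet> x) *\<^sub>R h)"
  let ?S = "\<lambda>D. \<Sum>b\<in>Basis. D (tangential x b) \<bullet> tangential x b"
  have xs: "x \<in> sphere 0 1" using x by simp
  have "(?X has_derivative ?D) (at x)"
    unfolding tangential_def by (auto intro!: derivative_eq_intros K simp: algebra_simps)
  then have "(?X has_derivative ?D) (at x within sphere 0 1)" by (rule has_derivative_at_withinI)
  then have X: "(sphere_grad u has_derivative ?D) (at x within sphere 0 1)"
  proof (rule has_derivative_transform[OF xs, rotated])
    fix y :: 'a assume y: "y \<in> sphere 0 1"
    then have "norm y = 1" "y \<in> U" using U by auto
    then show "sphere_grad u y = tangential y (w y)" using sphere_grad_eq[OF D] by blast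
  qed
  have S: "?S E = ?S ?D" if "(sphere_grad u has_derivative E) (at x within sphere 0 1)" for E
    using sphere_derivative_unique[OF that X x tangential_orthogonal[OF x]] by simp
  have "sphere_laplacian u x = ?S ?D"
    unfolding sphere_laplacian_def sphere_div_def tangential_def[symmetric]
    by (rule the_equality) (use X S in blast)+
  also have "\<dots> = (\<Sum>b\<in>Basis. K (tangential x b) \<bullet> tangential x b
      - (w x \<bullet> x) * (tangential x b \<bullet> tangential x b))"
    using tangential_orthogonal[OF x]
    by (intro sum.cong refl) (simp add: inner_diff_left inner_add_left inner_commute[of x])
  also have "\<dots> = (\<Sum>b\<in>Basis. K (tangential x b) \<bullet> tangential x b)
      - (w x \<bullet> x) * (\<Sum>b\<in>Basis. tangential x b \<bullet> tangential x b)"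
    by (simp only: sum_subtractf sum_distrib_left)
  finally show ?thesis by (simp add: sum_Basis_tangential_norm[OF x])
qed

section \<open>Cartan--Muenzner polynomials\<close>

text \<open>A Cartan-Muenzner polynomial with its gradient \<open>g\<close> and Hessian \<open>H\<close>, the latter as a linear map.\<close>

locale muenzner =
  fixes F :: "'a::euclidean_space \<Rightarrow> real" and g :: "'a \<Rightarrow> 'a" and H :: "'a \<Rightarrow> 'a \<Rightarrow> 'a"
    and l :: nat and c :: real
  assumes dF: "\<And>x. (F has_derivative (\<lambda>h. h \<bullet> g x)) (at x)"
    and dg: "\<And>x. (g has_derivative H x) (at x)"
    and sym: "\<And>x u v. H x u \<bullet> v = H x v \<bullet> u"
    and H_cont: "\<And>v. continuous_on UNIV (\<lambda>x. H x v)"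
    and homogeneous: "\<And>t x. F (t *\<^sub>R x) = t ^ l * F x"
    and l: "1 \<le> l"
    and eikonal: "\<And>x. g x \<bullet> g x = (real l)\<^sup>2 * (x \<bullet> x) ^ (l - 1)"
    and laplacian: "\<And>x. norm x = 1 \<Longrightarrow> (\<Sum>b\<in>Basis. H x b \<bullet> b) = c"
    and nonconstant: "\<not> F constant_on sphere 0 1"
    and dim: "2 \<le> DIM('a)"
begin

lemma euler: "x \<bullet> g x = real l * F x"
proof -
  have "((\<lambda>t. F (t *\<^sub>R x)) has_derivative (\<lambda>t. (t *\<^sub>R x) \<bullet> g (1 *\<^sub>R x))) (at 1)"
    by (rule diff_chain_at[of "\<lambda>t. t *\<^sub>R x" _ 1 F, unfolded o_def, OF _ dF]) (auto intro!: derivative_eq_intros)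
  then have "((\<lambda>t. F (t *\<^sub>R x)) has_real_derivative x \<bullet> g x) (at 1)"
    by (simp add: has_field_derivative_def mult_commute_abs)
  moreover have "((\<lambda>t. F (t *\<^sub>R x)) has_real_derivative real l * F x) (at 1)"
    unfolding homogeneous by (auto intro!: derivative_eq_intros)
  ultimately show ?thesis by (rule DERIV_unique)
qed

lemma euler_gradient: "H x x = (real l - 1) *\<^sub>R g x"
proof -
  have "((\<lambda>y. y \<bullet> g y) has_derivative (\<lambda>h. x \<bullet> H x h + h \<bullet> g x)) (at x)"
    by (rule has_derivative_inner[OF has_derivative_ident dg])
  moreover have "((\<lambda>y. y \<bullet> g y) has_derivative (\<lambda>h. real l * (h \<bullet> g x))) (at x)"
    unfolding euler by (rule has_derivative_mult_right[OF dF])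
  ultimately have eq: "(\<lambda>h. x \<bullet> H x h + h \<bullet> g x) = (\<lambda>h. real l * (h \<bullet> g x))" by (rule has_derivative_unique)
  have "(H x x - (real l - 1) *\<^sub>R g x) \<bullet> h = 0" for h
  proof -
    have "H x x \<bullet> h = x \<bullet> H x h" using sym[of x x h] by (simp only: inner_commute)
    then show ?thesis using fun_cong[OF eq, of h]
      by (simp add: inner_diff_left inner_commute[of "g x" h] algebra_simps)
  qed
  then show ?thesis by (metis inner_eq_zero_iff eq_iff_diff_eq_0)
qed

lemma norm_gradient: "norm x = 1 \<Longrightarrow> g x \<bullet> g x = (real l)\<^sup>2"
  using eikonal[of x] by (simp only: norm_eq_1) simp

lemma tangential_gradient_norm:
  assumes "norm x = 1"
  shows "tangential x (g x) \<bullet> tangential x (g x) = (real l)\<^sup>2 * (1 - (F x)\<^sup>2)"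
proof -
  have x: "x \<bullet> x = 1" using assms by (simp only: norm_eq_1)
  have e: "g x \<bullet> x = real l * F x" using euler[of x] by (simp only: inner_commute)
  show ?thesis
    unfolding tangential_def inner_diff_left inner_diff_right inner_scaleR_left inner_scaleR_right
      inner_commute[of x "g x"] x e norm_gradient[OF assms] by algebra
qed

lemma F_bounds:
  assumes "norm x = 1"
  shows "- 1 \<le> F x" "F x \<le> 1"
proof -
  have "0 \<le> (real l)\<^sup>2 * (1 - (F x)\<^sup>2)"
    unfolding tangential_gradient_norm[OF assms, symmetric] by (rule inner_ge_zero)
  then have "(F x)\<^sup>2 \<le> 1" using l by (simp add: zero_le_mult_iff)
  then have "\<bar>F x\<bar> \<le> 1" by (simp only: abs_square_le_1)
  then show "- 1 \<le> F x" "F x \<le> 1" by auto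
qed

lemma F_cont: "continuous_on S F"
  using dF has_derivative_continuous continuous_at_imp_continuous_on by blast

text \<open>A maximum of \<open>F\<close> on the sphere is a critical point of the restriction, where \<open>F\<^sup>2 = 1\<close> by the eikonal
  equation; the maximum \<open>- 1\<close> would make \<open>F\<close> constant.\<close>

lemma focal_set_nonempty: "\<exists>x. norm x = 1 \<and> F x = 1"
proof -
  have critical: "(F x)\<^sup>2 = 1" if x: "norm x = 1" and t: "tangential x (g x) = 0" for x
  proof -
    have "0 = (real l)\<^sup>2 * (1 - (F x)\<^sup>2)" using tangential_gradient_norm[OF x] t by simp
    then show ?thesis using l by simp
  qed
  have ne: "sphere (0::'a) 1 \<noteq> {}" by simp
  obtain x where x: "x \<in> sphere 0 1" "\<And>y. y \<in> sphere 0 1 \<Longrightarrow> F y \<le> F x"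
    using continuous_attains_sup[OF compact_sphere ne F_cont] by blast
  have x1: "norm x = 1" using x by simp
  have "tangential x (g x) = 0"
    by (rule sphere_local_max_gradient[OF dF x1 zero_less_one]) (use x(2) in blast)
  then have "(F x)\<^sup>2 = 1" by (rule critical[OF x1])
  then consider "F x = 1" | "F x = -1" by (auto simp: power2_eq_1_iff)
  then show ?thesis
  proof cases
    case 1 then show ?thesis using x1 by blast
  next
    case 2
    have "F y = -1" if "y \<in> sphere 0 1" for y
      using x(2)[OF that] F_bounds(1)[of y] that 2 by simp
    then have "F constant_on sphere 0 1" unfolding constant_on_def by blast
    then show ?thesis using nonconstant by simp
  qed
qed

lemma H_linear: "linear (H x)" using dg by (rule has_derivative_linear)

context
  fixes p assumes p: "norm p = 1" and Fp: "F p = 1"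
begin

lemma pp: "p \<bullet> p = 1" using p by (simp only: norm_eq_1)

text \<open>Equality in the Cauchy-Schwarz inequality: \<open>g p \<bullet> p = l\<close> is the norm of \<open>g p\<close>.\<close>

lemma gp: "g p = real l *\<^sub>R p"
proof -
  have e: "g p \<bullet> p = real l" using euler[of p] unfolding Fp inner_commute[of p] by simp
  have "(g p - real l *\<^sub>R p) \<bullet> (g p - real l *\<^sub>R p) = 0"
    unfolding inner_diff_left inner_diff_right inner_scaleR_left inner_scaleR_right
      inner_commute[of p "g p"] e pp norm_gradient[OF p] by algebra
  then show ?thesis by simp
qed

lemma Hp: "H p p = ((real l - 1) * real l) *\<^sub>R p"
  using euler_gradient[of p] by (simp add: gp)

text \<open>By the eikonal equation and Euler's identity,
  \<open>\<bar>g x - l x\<bar>\<^sup>2 = l\<^sup>2 (\<bar>x\<bar>\<^sup>2\<^sup>l\<^sup>-\<^sup>2 + \<bar>x\<bar>\<^sup>2 - 2 F x)\<close>.  Both sides are of second order along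
  \<open>x = p + t h\<close>, because \<open>g p = l p\<close>.  Divided by \<open>t\<^sup>2\<close>, the left-hand side tends to the left-hand side
  of the claim, and the limit of the right-hand side follows from l'Hospital's rule.\<close>

lemma Hessian_quadratic:
  assumes h: "h \<bullet> p = 0" "norm h = 1"
  shows "(H p h - real l *\<^sub>R h) \<bullet> (H p h - real l *\<^sub>R h) = (real l)\<^sup>2 * (real l - H p h \<bullet> h)"
proof -
  have hh: "h \<bullet> h = 1" and ph: "p \<bullet> h = 0" using h by (simp_all only: norm_eq_1 inner_commute)
  define x where "x t = p + t *\<^sub>R h" for t :: real
  have dx: "(x has_derivative (\<lambda>s. s *\<^sub>R h)) (at t)" for t
    unfolding x_def[abs_def] by (auto intro!: derivative_eq_intros)
  have x0: "x 0 = p" by (simp add: x_def)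
  have xx: "x t \<bullet> x t = 1 + t\<^sup>2" for t
    unfolding x_def inner_add_left inner_add_right inner_scaleR_left inner_scaleR_right hh pp ph h(1) by algebra
  define A where "A t = g (x t) - real l *\<^sub>R x t" for t
  define \<rho> where "\<rho> t = (real l)\<^sup>2 * ((1 + t\<^sup>2) ^ (l - 1) + (1 + t\<^sup>2) - 2 * F (x t))" for t
  define \<rho>' where "\<rho>' t = (real l)\<^sup>2 * (real (l - 1) * (1 + t\<^sup>2) ^ (l - 2) * (2 * t) + 2 * t - 2 * (h \<bullet> g (x t)))" for t
  have A\<rho>: "A t \<bullet> A t = \<rho> t" for t
  proof -
    have e: "x t \<bullet> g (x t) = real l * F (x t)" by (rule euler)
    have e2: "g (x t) \<bullet> g (x t) = (real l)\<^sup>2 * (1 + t\<^sup>2) ^ (l - 1)" unfolding eikonal xx ..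
    show ?thesis
      unfolding A_def \<rho>_def inner_diff_left inner_diff_right inner_scaleR_left inner_scaleR_right
        inner_commute[of "g (x t)" "x t"] e e2 xx by algebra
  qed
  define v where "v = H p h - real l *\<^sub>R h"
  have dgx: "((\<lambda>t. g (x t)) has_derivative (\<lambda>s. s *\<^sub>R H p h)) (at 0)"
    using diff_chain_at[OF dx dg, of 0] by (simp add: o_def x0 linear_cmul[OF H_linear])
  have dA: "(A has_derivative (\<lambda>s. s *\<^sub>R H p h - real l *\<^sub>R (s *\<^sub>R h))) (at 0)"
    unfolding A_def[abs_def] by (intro has_derivative_diff has_derivative_scaleR_right dgx dx)
  have A0: "A 0 = 0" by (simp add: A_def x0 gp)
  have lim1: "((\<lambda>t. (A t /\<^sub>R t) \<bullet> (A t /\<^sub>R t)) \<longlongrightarrow> v \<bullet> v) (at 0)"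
  proof -
    have "((\<lambda>t. (A t \<bullet> b) / t) \<longlongrightarrow> v \<bullet> b) (at 0)" for b
    proof -
      have "((\<lambda>t. A t \<bullet> b) has_derivative (\<lambda>s. (s *\<^sub>R H p h - real l *\<^sub>R (s *\<^sub>R h)) \<bullet> b)) (at 0)"
        by (rule has_derivative_inner_left[OF dA])
      moreover have "(\<lambda>s. (s *\<^sub>R H p h - real l *\<^sub>R (s *\<^sub>R h)) \<bullet> b) = (*) (v \<bullet> b)"
        by (rule ext) (simp add: v_def inner_diff_left algebra_simps)
      ultimately have "((\<lambda>t. A t \<bullet> b) has_real_derivative v \<bullet> b) (at 0)"
        by (simp only: has_field_derivative_def)
      then show ?thesis by (simp add: DERIV_def A0)
    qed
    then have "((\<lambda>t. \<Sum>b\<in>Basis. (A t \<bullet> b) / t * ((A t \<bullet> b) / t)) \<longlongrightarrow> (\<Sum>b\<in>Basis. (v \<bullet> b) * (v \<bullet> b))) (at 0)"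
      by (intro tendsto_sum tendsto_mult)
    moreover have "(A t /\<^sub>R t) \<bullet> (A t /\<^sub>R t) = (\<Sum>b\<in>Basis. (A t \<bullet> b) / t * ((A t \<bullet> b) / t))" for t
      by (subst euclidean_inner) (simp only: inner_scaleR_left divide_inverse mult.commute)
    ultimately show ?thesis by (simp only: euclidean_inner[of v v])
  qed
  have dFx: "((\<lambda>t. F (x t)) has_real_derivative h \<bullet> g (x t)) (at t)" for t
    using diff_chain_at[OF dx dF] by (simp add: o_def has_field_derivative_def mult_commute_abs)
  have d\<rho>: "(\<rho> has_real_derivative \<rho>' t) (at t)" for t
    unfolding \<rho>_def[abs_def] \<rho>'_def
    by (auto intro!: derivative_eq_intros dFx simp: numeral_2_eq_2)
  have d\<rho>': "(\<rho>' has_real_derivative (real l)\<^sup>2 * (2 * (real l - 1) + 2 - 2 * (H p h \<bullet> h))) (at 0)"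
  proof -
    have "((\<lambda>t. h \<bullet> g (x t)) has_derivative (\<lambda>s. h \<bullet> (s *\<^sub>R H p h))) (at 0)"
      by (rule has_derivative_inner_right[OF dgx])
    then have "((\<lambda>t. h \<bullet> g (x t)) has_real_derivative H p h \<bullet> h) (at 0)"
      by (simp add: has_field_derivative_def mult_commute_abs inner_commute)
    then show ?thesis
      unfolding \<rho>'_def[abs_def] using l
      by (auto intro!: derivative_eq_intros simp: of_nat_diff algebra_simps)
  qed
  have \<rho>'0: "\<rho>' 0 = 0" by (simp add: \<rho>'_def x0 gp h)
  have "((\<lambda>t. \<rho>' t / (2 * t)) \<longlongrightarrow> (real l)\<^sup>2 * (2 * (real l - 1) + 2 - 2 * (H p h \<bullet> h)) / 2) (at 0)"
  proof -
    have "((\<lambda>t. \<rho>' t / t / 2) \<longlongrightarrow> (real l)\<^sup>2 * (2 * (real l - 1) + 2 - 2 * (H p h \<bullet> h)) / 2) (at 0)"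
      using d\<rho>' \<rho>'0 unfolding DERIV_def by (intro tendsto_divide tendsto_const) simp_all
    then show ?thesis by (simp add: mult.commute)
  qed
  then have lim2: "((\<lambda>t. \<rho> t / t\<^sup>2) \<longlongrightarrow> (real l)\<^sup>2 * (2 * (real l - 1) + 2 - 2 * (H p h \<bullet> h)) / 2) (at 0)"
  proof (rule lhopital[rotated -1])
    have "\<rho> 0 = 0" using A\<rho>[of 0] A0 by simp
    then show "(\<rho> \<longlongrightarrow> 0) (at 0)" using DERIV_isCont[OF d\<rho>, of 0] by (simp add: isCont_def)
    show "((\<lambda>t::real. t\<^sup>2) \<longlongrightarrow> 0) (at 0)" by (auto intro!: tendsto_eq_intros)
    show "\<forall>\<^sub>F t in at (0::real). t\<^sup>2 \<noteq> 0" "\<forall>\<^sub>F t in at (0::real). 2 * t \<noteq> 0"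
      by (auto simp: eventually_at_filter)
    show "\<forall>\<^sub>F t in at 0. (\<rho> has_real_derivative \<rho>' t) (at t)" using d\<rho> by simp
    show "\<forall>\<^sub>F t in at 0. ((\<lambda>t::real. t\<^sup>2) has_real_derivative 2 * t) (at t)"
      by (auto intro!: derivative_eq_intros always_eventually)
  qed
  have "(\<lambda>t. (A t /\<^sub>R t) \<bullet> (A t /\<^sub>R t)) = (\<lambda>t. \<rho> t / t\<^sup>2)"
    by (rule ext) (simp add: A\<rho> power2_eq_square divide_inverse mult_ac)
  then have "((\<lambda>t. (A t /\<^sub>R t) \<bullet> (A t /\<^sub>R t)) \<longlongrightarrow> (real l)\<^sup>2 * (2 * (real l - 1) + 2 - 2 * (H p h \<bullet> h)) / 2) (at 0)"
    using lim2 by (simp only:)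
  from tendsto_unique[OF trivial_limit_at lim1 this]
  have "v \<bullet> v = (real l)\<^sup>2 * (2 * (real l - 1) + 2 - 2 * (H p h \<bullet> h)) / 2" .
  also have "\<dots> = (real l)\<^sup>2 * (real l - H p h \<bullet> h)" by (simp add: field_simps)
  finally show ?thesis by (simp only: v_def)
qed

lemma Hessian_quadratic_scaled:
  assumes h: "h \<bullet> p = 0"
  shows "(H p h - real l *\<^sub>R h) \<bullet> (H p h - real l *\<^sub>R h) = (real l)\<^sup>2 * (real l * (h \<bullet> h) - H p h \<bullet> h)"
proof (cases "h = 0")
  case True
  then show ?thesis by (simp add: linear_0[OF H_linear])
next
  case False
  define k where "k = norm h"
  define w where "w = h /\<^sub>R k"
  have k: "k \<noteq> 0" using False by (simp add: k_def)
  have w: "w \<bullet> p = 0" "norm w = 1" using h k by (simp_all add: w_def k_def)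
  have hw: "h = k *\<^sub>R w" using k by (simp add: w_def)
  have ww: "w \<bullet> w = 1" using w(2) by (simp only: norm_eq_1)
  have e: "H p h - real l *\<^sub>R h = k *\<^sub>R (H p w - real l *\<^sub>R w)"
    unfolding hw by (simp add: linear_cmul[OF H_linear] algebra_simps)
  have "H p h \<bullet> h = k\<^sup>2 * (H p w \<bullet> w)"
    unfolding hw by (simp add: linear_cmul[OF H_linear] power2_eq_square)
  moreover have "h \<bullet> h = k\<^sup>2" by (simp only: k_def power2_norm_eq_inner)
  moreover have "(H p h - real l *\<^sub>R h) \<bullet> (H p h - real l *\<^sub>R h)
      = k\<^sup>2 * ((real l)\<^sup>2 * (real l - H p w \<bullet> w))"
    unfolding e inner_scaleR_left inner_scaleR_right Hessian_quadratic[OF w] by algebra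
  ultimately show ?thesis by algebra
qed

text \<open>Up to the factor \<open>- l\<^sup>2\<close> the Hessian at \<open>p\<close> of the restriction of \<open>F\<close> to the sphere, as a map of the
  tangent space extended by \<open>0\<close> to the multiples of \<open>p\<close>.  By \<open>Hessian_quadratic\<close> it is an orthogonal
  projection; geometrically, onto the normal space in the sphere of the focal submanifold.\<close>

definition focal_projection :: "'a \<Rightarrow> 'a" where
  "focal_projection h = (real l *\<^sub>R tangential p h - H p (tangential p h)) /\<^sub>R (real l)\<^sup>2"

lemma l_pos: "0 < real l" using l by simp

lemma Hessian_tangential: "h \<bullet> p = 0 \<Longrightarrow> H p h \<bullet> p = 0"
  using sym[of p h p] by (simp add: Hp inner_commute)

lemma tangential_inner: "w \<bullet> p = 0 \<Longrightarrow> w \<bullet> v = w \<bullet> tangential p v"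
  by (simp add: tangential_def inner_diff_right)

lemma focal_projection_inner:
  "focal_projection u \<bullet> v = (real l * (tangential p u \<bullet> tangential p v) - H p (tangential p u) \<bullet> tangential p v) / (real l)\<^sup>2"
proof -
  have t: "tangential p u \<bullet> p = 0" by (rule tangential_orthogonal[OF p])
  have "tangential p u \<bullet> v = tangential p u \<bullet> tangential p v" by (rule tangential_inner[OF t])
  moreover have "H p (tangential p u) \<bullet> v = H p (tangential p u) \<bullet> tangential p v"
    by (rule tangential_inner[OF Hessian_tangential[OF t]])
  ultimately show ?thesis
    by (simp only: focal_projection_def inner_scaleR_left inner_diff_left divide_inverse mult.commute)
qed

lemma symmetric_projection_focal: "symmetric_projection focal_projection"
proof (rule symmetric_projection.intro)
  have "linear (tangential p)"
    unfolding tangential_def[abs_def] by (rule linearI) (simp_all add: inner_add_left algebra_simps)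
  then show "linear focal_projection"
    unfolding focal_projection_def[abs_def]
    by (intro linearI)
       (simp_all add: linear_add linear_cmul linear_add[OF H_linear] linear_cmul[OF H_linear] algebra_simps)
  show "focal_projection u \<bullet> v = u \<bullet> focal_projection v" for u v
    unfolding inner_commute[of u] focal_projection_inner
      inner_commute[of "tangential p v" "tangential p u"] sym[of p "tangential p v" "tangential p u"] ..
  show "focal_projection u \<bullet> focal_projection u = focal_projection u \<bullet> u" for u
  proof -
    define h where "h = tangential p u"
    have h: "h \<bullet> p = 0" unfolding h_def by (rule tangential_orthogonal[OF p])
    have "focal_projection u = - ((H p h - real l *\<^sub>R h) /\<^sub>R (real l)\<^sup>2)"
      unfolding focal_projection_def h_def[symmetric] by (simp add: scaleR_diff_right)
    then have "focal_projection u \<bullet> focal_projection u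
        = ((H p h - real l *\<^sub>R h) \<bullet> (H p h - real l *\<^sub>R h)) / ((real l)\<^sup>2 * (real l)\<^sup>2)"
      by (simp only: inner_minus_left inner_minus_right minus_minus inner_scaleR_left inner_scaleR_right
          divide_inverse inverse_mult_distrib mult_ac)
    also have "\<dots> = focal_projection u \<bullet> u"
    proof -
      have "(real l)\<^sup>2 \<noteq> 0" using l by simp
      then show ?thesis
        unfolding Hessian_quadratic_scaled[OF h] focal_projection_inner h_def[symmetric]
        by (rule mult_divide_mult_cancel_left)
    qed
    finally show ?thesis .
  qed
qed

end

lemma sum_tangential_trace:
  assumes K: "linear K" and sym: "\<And>u v. K u \<bullet> v = K v \<bullet> u" and x: "norm x = 1"
  shows "(\<Sum>b\<in>Basis. K (tangential x b) \<bullet> tangential x b) = (\<Sum>b\<in>Basis. K b \<bullet> b) - K x \<bullet> (x::'a)"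
proof -
  have "K (tangential x b) \<bullet> tangential x b = K b \<bullet> b - 2 * ((K x \<bullet> b) * (x \<bullet> b)) + (K x \<bullet> x) * ((x \<bullet> b) * (x \<bullet> b))" for b
  proof -
    have "K (tangential x b) = K b - (b \<bullet> x) *\<^sub>R K x"
      by (simp add: tangential_def linear_diff[OF K] linear_cmul[OF K])
    then have "K (tangential x b) \<bullet> tangential x b = (K b - (b \<bullet> x) *\<^sub>R K x) \<bullet> (b - (b \<bullet> x) *\<^sub>R x)"
      by (simp only: tangential_def)
    also have "\<dots> = K b \<bullet> b - 2 * ((K x \<bullet> b) * (x \<bullet> b)) + (K x \<bullet> x) * ((x \<bullet> b) * (x \<bullet> b))"
      unfolding inner_diff_left inner_diff_right inner_scaleR_left inner_scaleR_right
        inner_commute[of b x] sym[of b x] by algebra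
    finally show ?thesis .
  qed
  then have "(\<Sum>b\<in>Basis. K (tangential x b) \<bullet> tangential x b)
      = (\<Sum>b\<in>Basis. K b \<bullet> b) - 2 * (K x \<bullet> x) + (K x \<bullet> x) * (x \<bullet> x)"
    unfolding euclidean_inner[of "K x" x] euclidean_inner[of x x]
    by (simp only: sum.distrib sum_subtractf sum_distrib_left)
  moreover have "x \<bullet> x = 1" using x by (simp only: norm_eq_1)
  ultimately show ?thesis by simp
qed

text \<open>Twice this number is the trace of the focal projection, that is, the codimension in the sphere of the
  focal submanifold \<open>F = 1\<close>.  The one for \<open>F = - 1\<close> arises by replacing \<open>c\<close> by \<open>- c\<close>.\<close>

definition multiplicity_parameter :: real where
  "multiplicity_parameter = (real l * (real DIM('a) + real l - 2) - c) / (2 * (real l)\<^sup>2)"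

lemma trace_focal_projection:
  assumes p: "norm p = 1" "F p = 1"
  shows "(\<Sum>b\<in>Basis. focal_projection p b \<bullet> b) = 2 * multiplicity_parameter"
proof -
  have "H p p \<bullet> p = (real l - 1) * real l"
    using Hp[OF p] p(1) by (simp add: dot_square_norm)
  then have "(\<Sum>b\<in>Basis. H p (tangential p b) \<bullet> tangential p b) = c - (real l - 1) * real l"
    using sum_tangential_trace[OF H_linear[of p] sym[of p] p(1)] laplacian[OF p(1)] by simp
  then have "(\<Sum>b\<in>Basis. focal_projection p b \<bullet> b)
      = (real l * (real DIM('a) - 1) - (c - (real l - 1) * real l)) / (real l)\<^sup>2"
    unfolding focal_projection_inner[OF p] sum_divide_distrib[symmetric] sum_subtractf sum_distrib_left[symmetric]
    by (simp only: sum_Basis_tangential_norm[OF p(1)])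
  also have "\<dots> = 2 * multiplicity_parameter"
    unfolding multiplicity_parameter_def using l by (simp add: field_simps)
  finally show ?thesis .
qed

text \<open>The focal set is closed, nonempty and not everything, so in the connected sphere it is not open.\<close>

lemma boundary_focal_point:
  obtains p where "norm p = 1" "F p = 1" "\<And>r. 0 < r \<Longrightarrow> \<exists>x. norm x = 1 \<and> dist x p < r \<and> F x < 1"
proof -
  let ?S = "sphere (0::'a) 1" and ?M = "{x \<in> sphere (0::'a) 1. F x = 1}"
  have "closedin (top_of_set ?S) ?M"
    by (rule continuous_closedin_preimage_constant[OF F_cont])
  moreover have "?M \<noteq> {}" using focal_set_nonempty by auto
  moreover have "?M \<noteq> ?S" using nonconstant unfolding constant_on_def by blast
  ultimately have "\<not> openin (top_of_set ?S) ?M"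
    using connected_sphere[OF dim, of 0 1] unfolding connected_clopen by blast
  then obtain p where p: "p \<in> ?M" "\<And>e. e > 0 \<Longrightarrow> \<exists>x\<in>?S. dist x p < e \<and> x \<notin> ?M"
    unfolding openin_euclidean_subtopology_iff by blast
  show thesis
  proof (rule that[of p])
    show "norm p = 1" "F p = 1" using p(1) by auto
    fix r :: real assume "0 < r"
    then obtain x where x: "x \<in> ?S" "dist x p < r" "x \<notin> ?M" using p(2) by blast
    then have "norm x = 1" "F x \<noteq> 1" by auto
    then show "\<exists>x. norm x = 1 \<and> dist x p < r \<and> F x < 1" using x(2) F_bounds(2)[of x] by force
  qed
qed

lemma tangential_gradient_DERIV:
  assumes p: "norm p = 1" "F p = 1"
  shows "((\<lambda>y. tangential y (g y)) has_derivative (\<lambda>h. - ((real l)\<^sup>2 *\<^sub>R focal_projection p h))) (at p within sphere 0 1)"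
proof -
  let ?D = "\<lambda>h. H p h - ((g p \<bullet> h + H p h \<bullet> p) *\<^sub>R p + (g p \<bullet> p) *\<^sub>R h)"
  have "((\<lambda>y. tangential y (g y)) has_derivative ?D) (at p)"
    unfolding tangential_def by (auto intro!: derivative_eq_intros dg simp: algebra_simps)
  then have "((\<lambda>y. tangential y (g y)) has_derivative ?D) (at p within sphere 0 1)" by (rule has_derivative_at_withinI)
  then have "((\<lambda>y. tangential y (g y)) has_derivative (\<lambda>h. ?D (tangential p h))) (at p within sphere 0 1)"
    by (rule sphere_derivative_tangential[OF _ p(1)])
  moreover have "?D (tangential p h) = - ((real l)\<^sup>2 *\<^sub>R focal_projection p h)" for h
  proof -
    let ?t = "tangential p h"
    have t: "?t \<bullet> p = 0" by (rule tangential_orthogonal[OF p(1)])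
    have "g p \<bullet> ?t = 0" "g p \<bullet> p = real l" using t pp[OF p] by (simp_all add: gp[OF p] inner_commute)
    then show ?thesis
      using Hessian_tangential[OF p t] l_pos[OF p] by (simp add: focal_projection_def[OF p])
  qed
  ultimately show ?thesis by (simp only:)
qed

end

section \<open>The dimensions of the focal sets\<close>

lemma continuous_on_has_derivative_at:
  "(\<And>x. (f has_derivative f' x) (at x)) \<Longrightarrow> continuous_on S f"
  by (rule continuous_at_imp_continuous_on, rule ballI, rule has_derivative_continuous) assumption

context muenzner
begin

text \<open>Take a boundary point \<open>p\<close> of the focal set.  If the projection vanished, the tangential gradient \<open>X\<close>
  of \<open>F\<close> would be of smaller order than the distance from \<open>p\<close>.  On the other hand the eikonal
  equation \<open>\<bar>X\<bar>\<^sup>2 = l\<^sup>2 (1 - F\<^sup>2)\<close> forces \<open>1 - F\<close> to grow quadratically: let \<open>y\<close> maximise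
  \<open>- F y - \<bar>y - x0\<bar>\<^sup>2 / 8\<close> over a cap of radius \<open>r\<close> around a point \<open>x0\<close> close to \<open>p\<close> with \<open>F x0 < 1\<close>,
  so that \<open>1 - F y > \<bar>y - x0\<bar>\<^sup>2 / 8\<close>.  At an interior maximum \<open>\<bar>X\<bar> \<le> \<bar>y - x0\<bar> / 4\<close>, which contradicts the
  eikonal equation.  At a maximum on the boundary of the cap, \<open>1 - F y > r\<^sup>2 / 8\<close>, so that
  \<open>\<bar>X\<bar>\<^sup>2 > l\<^sup>2 r\<^sup>2 / 8\<close> at a point at distance less than \<open>2 r\<close> from \<open>p\<close>, against the smallness of \<open>X\<close>.\<close>

lemma focal_projection_nonzero:
  "\<exists>p u. norm p = 1 \<and> F p = 1 \<and> focal_projection p u \<noteq> 0"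
proof -
  obtain p where p: "norm p = 1" "F p = 1" and near: "\<And>r. 0 < r \<Longrightarrow> \<exists>x. norm x = 1 \<and> dist x p < r \<and> F x < 1"
    using boundary_focal_point by blast
  let ?X = "\<lambda>y. tangential y (g y)"
  have "\<exists>u. focal_projection p u \<noteq> 0"
  proof (rule ccontr)
    assume "\<not> (\<exists>u. focal_projection p u \<noteq> 0)"
    then have "(\<lambda>h. - ((real l)\<^sup>2 *\<^sub>R focal_projection p h)) = (\<lambda>h. 0)" by simp
    then have D: "(?X has_derivative (\<lambda>h. 0)) (at p within sphere 0 1)"
      using tangential_gradient_DERIV[OF p] by (simp only:)
    have Xp: "?X p = 0" by (simp add: gp[OF p] tangential_def pp[OF p])
    have "\<forall>e>0. \<exists>d>0. \<forall>y\<in>sphere 0 1. norm (y - p) < d \<longrightarrow> norm (?X y - ?X p - 0) \<le> e * norm (y - p)"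
      using D unfolding has_derivative_within_alt by blast
    moreover have "0 < real l / 8" using l by simp
    ultimately obtain d1 where d1: "0 < d1"
      "\<And>y. \<lbrakk>y \<in> sphere 0 1; norm (y - p) < d1\<rbrakk> \<Longrightarrow> norm (?X y) \<le> real l / 8 * norm (y - p)"
      unfolding Xp diff_zero by blast
    have "continuous (at p) F" using dF by (rule has_derivative_continuous)
    then have "\<exists>d>0. \<forall>y. dist y p < d \<longrightarrow> dist (F y) (F p) < 1"
      by (simp only: continuous_at_eps_delta zero_less_one)
    then obtain d2 where d2: "0 < d2" "\<And>y. dist y p < d2 \<Longrightarrow> dist (F y) (F p) < 1" by blast
    have Fpos: "0 < F y" if "dist y p < d2" for y using d2(2)[OF that] p(2) by (simp add: dist_real_def abs_less_iff)
    define r where "r = min d1 d2 / 4"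
    have r: "0 < r" "2 * r < d1" "2 * r < d2" 
    proof -
      have "min d1 d2 \<le> d1" "min d1 d2 \<le> d2" "0 < min d1 d2" using d1(1) d2(1) by auto
      then show "0 < r" "2 * r < d1" "2 * r < d2" unfolding r_def by linarith+
    qed
    obtain x0 where x0: "norm x0 = 1" "dist x0 p < r" "F x0 < 1" using near[OF r(1)] by blast
    define m where "m y = - F y - (1/8) * ((y - x0) \<bullet> (y - x0))" for y
    have dm: "(m has_derivative (\<lambda>h. h \<bullet> (- g y - (1/4) *\<^sub>R (y - x0)))) (at y)" for y
      unfolding m_def[abs_def]
      by (auto intro!: derivative_eq_intros dF simp: inner_diff_right inner_commute algebra_simps)
    let ?S = "sphere 0 1 \<inter> cball x0 r"
    have "compact ?S" by (intro compact_Int_closed compact_sphere closed_cball)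
    moreover have "?S \<noteq> {}" using x0(1) r(1) by (auto intro!: exI[of _ x0])
    moreover have "continuous_on ?S m"
      by (rule continuous_on_has_derivative_at[OF dm])
    ultimately obtain y where y: "y \<in> ?S" and mx: "\<And>z. z \<in> ?S \<Longrightarrow> m z \<le> m y"
      using continuous_attains_sup[of ?S m] by blast
    have y1: "norm y = 1" "y \<in> sphere 0 1" and yr: "dist y x0 \<le> r" using y by (auto simp: dist_commute)
    define q where "q = (y - x0) \<bullet> (y - x0)"
    have qd: "q = (dist y x0)\<^sup>2" by (simp add: q_def dist_norm power2_norm_eq_inner)
    have yp: "dist y p < 2 * r" using dist_triangle[of y p x0] yr x0(2) by simp
    have "m x0 \<le> m y" using mx[of x0] x0(1) r(1) by simp
    then have up: "q / 8 < 1 - F y" using x0(3) by (simp add: m_def q_def)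
    have Xy: "?X y \<bullet> ?X y = (real l)\<^sup>2 * (1 - (F y)\<^sup>2)" by (rule tangential_gradient_norm[OF y1(1)])
    have "0 < F y" using Fpos[of y] yp r by simp
    have "0 \<le> 1 - F y" using F_bounds(2)[OF y1(1)] by simp
    then have "1 * (1 - F y) \<le> (1 + F y) * (1 - F y)" using \<open>0 < F y\<close> by (intro mult_right_mono) auto
    then have FF: "1 - F y \<le> 1 - (F y)\<^sup>2" by (simp add: algebra_simps power2_eq_square)
    then have Xlow: "(real l)\<^sup>2 * (1 - F y) \<le> ?X y \<bullet> ?X y" unfolding Xy by (intro mult_left_mono) auto
    have l2: "1 \<le> (real l)\<^sup>2" using l by simp
    show False
    proof (cases "dist y x0 < r")
      case True
      have "tangential y (- g y - (1/4) *\<^sub>R (y - x0)) = 0"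
      proof (rule sphere_local_max_gradient[OF dm y1(1)])
        show "0 < r - dist y x0" using True by simp
        fix z assume "z \<in> sphere 0 1" "dist z y < r - dist y x0"
        then show "m z \<le> m y" using mx[of z] dist_triangle[of z x0 y] by (simp add: dist_commute)
      qed
      then have "?X y = - ((1/4) *\<^sub>R tangential y (y - x0))"
        by (simp add: tangential_def inner_diff_left inner_add_left algebra_simps)
      then have "?X y \<bullet> ?X y = (1/16) * (tangential y (y - x0) \<bullet> tangential y (y - x0))" by simp
      also have "tangential y (y - x0) \<bullet> tangential y (y - x0) \<le> q"
      proof -
        have yy: "y \<bullet> y = 1" using y1(1) by (simp only: norm_eq_1)
        have "tangential y h \<bullet> tangential y h = h \<bullet> h - (h \<bullet> y)\<^sup>2" for h
          unfolding tangential_def inner_diff_left inner_diff_right inner_scaleR_left inner_scaleR_right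
            yy inner_commute[of y h] by algebra
        then show ?thesis by (simp add: q_def)
      qed
      finally have "?X y \<bullet> ?X y \<le> q / 16" by simp
      then have "(real l)\<^sup>2 * (1 - F y) \<le> q / 16" using Xlow by linarith
      moreover have "1 * (1 - F y) \<le> (real l)\<^sup>2 * (1 - F y)" using l2 \<open>0 \<le> 1 - F y\<close> by (rule mult_right_mono)
      ultimately have "1 - F y \<le> q / 16" by simp
      moreover have "0 \<le> q" by (simp add: q_def)
      ultimately show False using up by linarith
    next
      case False
      then have qr: "q = r\<^sup>2" using yr qd by simp
      have "norm (?X y) \<le> real l / 8 * norm (y - p)"
        by (rule d1(2)[OF y1(2)]) (use yp r in \<open>simp add: dist_norm\<close>)
      also have "\<dots> \<le> real l / 8 * (2 * r)" using yp by (intro mult_left_mono) (auto simp: dist_norm)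
      finally have "(norm (?X y))\<^sup>2 \<le> (real l / 8 * (2 * r))\<^sup>2" by (rule power_mono) simp
      then have "?X y \<bullet> ?X y \<le> (real l)\<^sup>2 * (r\<^sup>2 / 16)"
        by (simp add: power2_norm_eq_inner power_mult_distrib power_divide mult.commute)
      then have "(real l)\<^sup>2 * (1 - F y) \<le> (real l)\<^sup>2 * (r\<^sup>2 / 16)" using Xlow by linarith
      then have "1 - F y \<le> r\<^sup>2 / 16" using l by simp
      moreover have "0 < r\<^sup>2" using r(1) by simp
      ultimately show False using up qr by simp
    qed
  qed
  then show ?thesis using p by blast
qed

lemma multiplicity_parameter_ge: "1/2 \<le> multiplicity_parameter"
proof -
  obtain p u where p: "norm p = 1" "F p = 1" and u: "focal_projection p u \<noteq> 0"
    using focal_projection_nonzero by blast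
  interpret Q: symmetric_projection "focal_projection p" by (rule symmetric_projection_focal[OF p])
  have "1 \<le> 2 * multiplicity_parameter"
    using Q.trace_ge_1[OF u] unfolding Q.trace_def trace_focal_projection[OF p] .
  then show ?thesis by simp
qed

text \<open>The kernel of the focal projection contains the orthogonal vectors \<open>p\<close> and \<open>v\<close>.\<close>

lemma multiplicity_parameter_le:
  assumes p: "norm p = 1" "F p = 1" and v: "v \<noteq> 0" "v \<bullet> p = 0" "H p v = real l *\<^sub>R v"
  shows "2 * multiplicity_parameter \<le> real DIM('a) - 2"
proof -
  interpret Q: symmetric_projection "focal_projection p" by (rule symmetric_projection_focal[OF p])
  have "tangential p p = 0" by (simp add: tangential_def pp[OF p])
  then have "focal_projection p p = 0" by (simp add: focal_projection_def[OF p] linear_0[OF H_linear])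
  moreover have "focal_projection p v = 0"
    using v by (simp add: focal_projection_def[OF p] tangential_id)
  then have "focal_projection p (v /\<^sub>R norm v) = 0" by (simp add: linear_cmul[OF Q.lin])
  moreover have "norm (v /\<^sub>R norm v) = 1" "p \<bullet> (v /\<^sub>R norm v) = 0" using v by (simp_all add: inner_commute)
  ultimately have "Q.trace \<le> real (DIM('a) - 2)" using Q.trace_le[of p "v /\<^sub>R norm v"] p(1) dim by simp
  then show ?thesis unfolding Q.trace_def trace_focal_projection[OF p] using dim by simp
qed

text \<open>A line in the model subspace is mapped by the inverse chart to a curve \<open>\<gamma>\<close> in the focal set through
  \<open>p\<close>, with velocity \<open>v \<noteq> 0\<close> because the chart is a diffeomorphism.  The two properties of \<open>v\<close> are the
  derivatives of \<open>\<gamma> \<bullet> \<gamma> = 1\<close> and of \<open>g \<gamma> = l \<gamma>\<close>, which holds at focal points.\<close>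

lemma submanifold_tangent_vector:
  assumes M: "smooth_submanifold d {x \<in> sphere 0 1. F x = 1}" and d: "0 < d"
    and p: "norm p = 1" "F p = 1"
  shows "\<exists>v. v \<noteq> 0 \<and> v \<bullet> p = 0 \<and> H p v = real l *\<^sub>R v"
proof -
  let ?M = "{x \<in> sphere 0 1. F x = 1}"
  have pM: "p \<in> ?M" using p by simp
  obtain U V T \<phi> \<psi> where U: "open U" "p \<in> U" and V: "open (V :: 'a set)" and T: "subspace T" "dim T = d"
    and hom: "homeomorphism U V \<phi> \<psi>" and s: "smooth_on \<phi> U" "smooth_on \<psi> V" and img: "\<phi> ` (U \<inter> ?M) = V \<inter> T"
    using M pM unfolding smooth_submanifold_def by meson
  have diff: "f differentiable at x" if "smooth_on f W" "open W" "x \<in> W" for f :: "'a \<Rightarrow> 'a" and W x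
  proof -
    have "Ck_on (Suc 0) f W" using that(1) by (simp only: smooth_on_def)
    then have "f differentiable_on W" by simp
    then show ?thesis using that by (simp add: differentiable_on_eq_differentiable_at)
  qed
  have "T \<noteq> {0}" using T(2) d by auto
  then obtain t where t: "t \<in> T" "t \<noteq> 0" using T(1) subspace_0 by fastforce
  let ?q = "\<phi> p"
  have q: "?q \<in> V" "?q \<in> T" "\<psi> ?q = p" using img U(2) pM hom unfolding homeomorphism_def by blast+
  obtain D\<psi> where D\<psi>: "(\<psi> has_derivative D\<psi>) (at ?q)" using diff[OF s(2) V q(1)] by (auto simp: differentiable_def)
  obtain D\<phi> where D\<phi>: "(\<phi> has_derivative D\<phi>) (at p)" using diff[OF s(1) U] by (auto simp: differentiable_def)
  define c' where "c' s = ?q + s *\<^sub>R t" for s :: real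
  define W where "W = c' -` V"
  have c'_cont: "continuous_on UNIV c'" unfolding c'_def by (intro continuous_intros)
  have W: "open W" "0 \<in> W" unfolding W_def using V q by (auto simp: c'_def intro: open_vimage c'_cont)
  have dc': "(c' has_derivative (\<lambda>s. s *\<^sub>R t)) (at 0)" unfolding c'_def[abs_def] by (auto intro!: derivative_eq_intros)
  define \<gamma> where "\<gamma> s = \<psi> (c' s)" for s
  define v where "v = D\<psi> t"
  have c'0: "c' 0 = ?q" by (simp add: c'_def)
  have \<gamma>0: "\<gamma> 0 = p" by (simp add: \<gamma>_def c'0 q)
  have \<gamma>: "norm (\<gamma> s) = 1 \<and> F (\<gamma> s) = 1" if "s \<in> W" for s
  proof -
    have "c' s \<in> V \<inter> T" using that q t T(1) by (auto simp: W_def c'_def intro: subspace_add subspace_mul)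
    then obtain x where x: "x \<in> U" "x \<in> ?M" "c' s = \<phi> x" using img by blast
    then have "\<gamma> s = x" using hom by (simp add: \<gamma>_def homeomorphism_def)
    then show ?thesis using x by simp
  qed
  have d\<gamma>: "(\<gamma> has_derivative (\<lambda>s. s *\<^sub>R v)) (at 0)"
  proof -
    have "((\<psi> \<circ> c') has_derivative (D\<psi> \<circ> (\<lambda>s. s *\<^sub>R t))) (at 0)"
      by (rule diff_chain_at[OF dc']) (simp only: c'0 D\<psi>)
    then show ?thesis
      using has_derivative_linear[OF D\<psi>] by (simp add: \<gamma>_def[abs_def] o_def v_def linear_cmul)
  qed
  have "v \<noteq> 0"
  proof
    assume "v = 0"
    have "((\<phi> \<circ> \<gamma>) has_derivative (D\<phi> \<circ> (\<lambda>s. s *\<^sub>R v))) (at 0)"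
      by (rule diff_chain_at[OF d\<gamma>]) (simp only: \<gamma>0 D\<phi>)
    then have "((\<phi> \<circ> \<gamma>) has_derivative (\<lambda>s. 0)) (at 0)"
      using \<open>v = 0\<close> linear_0[OF has_derivative_linear[OF D\<phi>]] by (simp add: o_def)
    moreover have "((\<phi> \<circ> \<gamma>) has_derivative (\<lambda>s. s *\<^sub>R t)) (at 0)"
    proof (rule has_derivative_transform_within_open[OF dc' W])
      fix s assume "s \<in> W"
      then show "c' s = (\<phi> \<circ> \<gamma>) s" using hom by (simp add: W_def \<gamma>_def homeomorphism_def)
    qed
    ultimately have "(\<lambda>s. 0) = (\<lambda>s::real. s *\<^sub>R t)" by (rule has_derivative_unique)
    then have "0 = (1::real) *\<^sub>R t" by (rule fun_cong)
    then show False using t by simp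
  qed
  moreover have "v \<bullet> p = 0"
  proof -
    have "((\<lambda>s. \<gamma> s \<bullet> \<gamma> s) has_derivative (\<lambda>s. p \<bullet> (s *\<^sub>R v) + (s *\<^sub>R v) \<bullet> p)) (at 0)"
      using has_derivative_inner[OF d\<gamma> d\<gamma>] by (simp only: \<gamma>0)
    moreover have "((\<lambda>s. \<gamma> s \<bullet> \<gamma> s) has_derivative (\<lambda>s. 0)) (at 0)"
    proof (rule has_derivative_transform_within_open[OF has_derivative_const W])
      fix s assume "s \<in> W"
      then have "norm (\<gamma> s) = 1" using \<gamma> by blast
      then show "1 = \<gamma> s \<bullet> \<gamma> s" by (simp only: norm_eq_1)
    qed
    ultimately have "(\<lambda>s. p \<bullet> (s *\<^sub>R v) + (s *\<^sub>R v) \<bullet> p) = (\<lambda>s::real. 0)" by (rule has_derivative_unique)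
    then have "p \<bullet> (1 *\<^sub>R v) + (1 *\<^sub>R v) \<bullet> p = 0" by (rule fun_cong)
    then show ?thesis by (simp add: inner_commute)
  qed
  moreover have "H p v = real l *\<^sub>R v"
  proof -
    have "((\<lambda>s. g (\<gamma> s)) has_derivative (\<lambda>s. H p (s *\<^sub>R v))) (at 0)"
      using diff_chain_at[OF d\<gamma> dg] by (simp add: o_def \<gamma>0)
    moreover have "((\<lambda>s. g (\<gamma> s)) has_derivative (\<lambda>s. real l *\<^sub>R (s *\<^sub>R v))) (at 0)"
      by (rule has_derivative_transform_within_open[OF has_derivative_scaleR_right[OF d\<gamma>] W])
         (use \<gamma> gp in auto)
    ultimately have "(\<lambda>s. H p (s *\<^sub>R v)) = (\<lambda>s::real. real l *\<^sub>R (s *\<^sub>R v))" by (rule has_derivative_unique)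
    then have "H p (1 *\<^sub>R v) = real l *\<^sub>R (1 *\<^sub>R v)" by (rule fun_cong)
    then show ?thesis by simp
  qed
  ultimately show ?thesis by blast
qed

lemma multiplicity_parameter_le_submanifold:
  assumes "smooth_submanifold d {x \<in> sphere 0 1. F x = 1}" "0 < d"
  shows "2 * multiplicity_parameter \<le> real DIM('a) - 2"
proof -
  obtain p where p: "norm p = 1" "F p = 1" using focal_set_nonempty by blast
  obtain v where "v \<noteq> 0" "v \<bullet> p = 0" "H p v = real l *\<^sub>R v"
    using submanifold_tangent_vector[OF assms p] by blast
  then show ?thesis by (rule multiplicity_parameter_le[OF p])
qed

lemma muenzner_uminus: "muenzner (\<lambda>x. - F x) (\<lambda>x. - g x) (\<lambda>x u. - H x u) l (- c)"
proof (rule muenzner.intro)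
  show "((\<lambda>x. - F x) has_derivative (\<lambda>h. h \<bullet> - g x)) (at x)" for x
    using has_derivative_minus[OF dF[of x]] by simp
  show "((\<lambda>x. - g x) has_derivative (\<lambda>u. - H x u)) (at x)" for x
    by (rule has_derivative_minus[OF dg])
  show "- H x u \<bullet> v = - H x v \<bullet> u" for x u v using sym[of x u v] by simp
  show "continuous_on UNIV (\<lambda>x. - H x v)" for v by (rule continuous_on_minus[OF H_cont])
  show "- F (t *\<^sub>R x) = t ^ l * - F x" for t x by (simp add: homogeneous)
  show "- g x \<bullet> - g x = (real l)\<^sup>2 * (x \<bullet> x) ^ (l - 1)" for x using eikonal[of x] by simp
  show "(\<Sum>b\<in>Basis. - H x b \<bullet> b) = - c" if "norm x = 1" for x using laplacian[OF that] by (simp add: sum_negf)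
  show "\<not> (\<lambda>x. - F x) constant_on sphere 0 1"
    using nonconstant unfolding constant_on_def by (metis minus_minus)
qed (rule l, rule dim)

section \<open>Functions of a Cartan--Muenzner polynomial\<close>

text \<open>With \<open>z = (1 - t) / 2\<close> this is \<open>l\<^sup>2 (z (1 - z) y'' + (\<alpha> - (\<alpha> + \<beta>) z) y')\<close>, where \<open>\<alpha>\<close> and \<open>\<beta>\<close> are
  the multiplicity parameters of \<open>F\<close> and \<open>- F\<close>; their sum is \<open>(DIM('a) + l - 2) / l\<close>.\<close>

definition profile_laplacian where
  "profile_laplacian y1 y2 t = (real l)\<^sup>2 * ((1 - t\<^sup>2) / 4 * y2 + (multiplicity_parameter - (real DIM('a) + real l - 2) / real l * ((1 - t) / 2)) * y1)"

text \<open>The chain rule, with \<open>\<bar>\<nabla>F\<bar>\<^sup>2 = l\<^sup>2 (1 - F\<^sup>2)\<close> and \<open>\<Delta>F = c - l (l + n - 1) F\<close> for the gradient and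
  the Laplacian of the sphere, whose dimension is \<open>n = DIM('a) - 1\<close>.\<close>

lemma laplacian_of_profile:
  fixes y y1 y2 :: "real \<Rightarrow> real"
  assumes y: "\<And>z. z \<in> {-1<..<2} \<Longrightarrow> (y has_real_derivative y1 z) (at z)"
    and y1: "\<And>z. z \<in> {-1<..<2} \<Longrightarrow> (y1 has_real_derivative y2 z) (at z)"
    and y2: "continuous_on UNIV y2"
  defines "u \<equiv> \<lambda>x. y ((1 - F x) / 2)"
  shows "Ck_on_sphere 2 u"
    and "norm x = 1 \<Longrightarrow> sphere_laplacian u x = profile_laplacian (y1 ((1 - F x) / 2)) (y2 ((1 - F x) / 2)) (F x)"
proof -
  \<comment> \<open>On this neighbourhood of the sphere \<open>(1 - F x) / 2\<close> stays in the
    interval where the profile is differentiable.\<close>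
  define U where "U = {x. F x \<in> {-3<..<3}}"
  define z where "z x = (1 - F x) / 2" for x
  have U: "open U"
    unfolding U_def using open_vimage[OF open_greaterThanLessThan F_cont, of "-3" 3] by (simp add: vimage_def)
  have SU: "sphere 0 1 \<subseteq> U" using F_bounds by (force simp: U_def)
  have zU: "z x \<in> {-1<..<2}" if "x \<in> U" for x using that by (auto simp: U_def z_def)
  have dz: "(z has_derivative (\<lambda>h. (- (1/2)) * (h \<bullet> g x))) (at x)" for x
    unfolding z_def[abs_def] by (auto intro!: derivative_eq_intros dF)
  have comp: "((\<lambda>x. f (z x)) has_derivative (\<lambda>h. f' * ((- (1/2)) * (h \<bullet> g x)))) (at x)"
    if "(f has_real_derivative f') (at (z x))" for f f' x
    using diff_chain_at[OF dz that[unfolded has_field_derivative_def]] by (simp add: o_def)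
  define w where "w x = (- (1/2) * y1 (z x)) *\<^sub>R g x" for x
  define K where "K x h = (1/4 * y2 (z x) * (h \<bullet> g x)) *\<^sub>R g x + (- (1/2) * y1 (z x)) *\<^sub>R H x h" for x h
  have du: "(u has_derivative (\<lambda>h. h \<bullet> w x)) (at x)" if "x \<in> U" for x
    using comp[OF y[OF zU[OF that]]] unfolding u_def z_def[symmetric] w_def by (simp add: mult_ac)
  have dw: "(w has_derivative K x) (at x)" if "x \<in> U" for x
  proof -
    have "((\<lambda>x. - (1/2) * y1 (z x)) has_derivative (\<lambda>h. - (1/2) * (y2 (z x) * ((- (1/2)) * (h \<bullet> g x))))) (at x)"
      by (rule has_derivative_mult_right[OF comp[OF y1[OF zU[OF that]]]])
    from has_derivative_scaleR[OF this dg]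
    show ?thesis unfolding w_def[abs_def] K_def by (simp add: algebra_simps)
  qed
  have Fd: "frechet_derivative u (at x) v = v \<bullet> w x" if "x \<in> U" for x v
    using frechet_derivative_at[OF du[OF that]] by (metis (no_types))
  have dFd: "((\<lambda>x. frechet_derivative u (at x) v) has_derivative (\<lambda>h. v \<bullet> K x h)) (at x)" if "x \<in> U" for x v
    by (rule has_derivative_transform_within_open[OF has_derivative_inner_right[OF dw[OF that]] U that])
       (simp add: Fd)
  have Fd2: "frechet_derivative (\<lambda>x. frechet_derivative u (at x) v) (at x) v' = v \<bullet> K x v'" if "x \<in> U" for x v v'
    using frechet_derivative_at[OF dFd[OF that]] by (metis (no_types))
  have g_cont: "continuous_on U g" by (rule continuous_on_has_derivative_at[OF dg])
  have z_cont: "continuous_on U z" by (rule continuous_on_has_derivative_at[OF dz])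
  have y1_cont: "continuous_on U (\<lambda>x. y1 (z x))"
  proof (rule continuous_on_compose2[of "{-1<..<2}" y1 U z])
    show "continuous_on {-1<..<2} y1" 
      by (rule DERIV_continuous_on[OF has_field_derivative_at_within[OF y1]])
  qed (use z_cont zU in auto)
  have y2_cont: "continuous_on U (\<lambda>x. y2 (z x))" by (rule continuous_on_compose2[OF y2 z_cont]) auto
  have K_cont: "continuous_on U (\<lambda>x. v \<bullet> K x v')" for v v'
    unfolding K_def
    by (intro continuous_on_inner continuous_on_const continuous_on_add continuous_on_scaleR continuous_on_mult
        y1_cont y2_cont g_cont continuous_on_subset[OF H_cont]) auto
  have "Ck_on 2 u U"
  proof -
    have "continuous_on U (\<lambda>x. frechet_derivative (\<lambda>x. frechet_derivative u (at x) v) (at x) v')" for v v'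
      using K_cont[of v v'] by (rule continuous_on_eq) (simp add: Fd2)
    moreover have "u differentiable_on U"
      using du by (meson differentiable_at_imp_differentiable_on differentiable_def)
    moreover have "(\<lambda>x. frechet_derivative u (at x) v) differentiable_on U" for v
      using dFd by (meson differentiable_at_imp_differentiable_on differentiable_def)
    ultimately show ?thesis by (simp add: numeral_2_eq_2)
  qed
  then show "Ck_on_sphere 2 u" unfolding Ck_on_sphere_def using U SU by blast
  assume x: "norm x = 1"
  then have xU: "x \<in> U" using SU by auto
  have xx: "x \<bullet> x = 1" using x by (simp only: norm_eq_1)
  have gx: "g x \<bullet> x = real l * F x" using euler[of x] by (simp only: inner_commute)
  have Hx: "H x x \<bullet> x = (real l - 1) * (real l * F x)" by (simp add: euler_gradient gx)
  have Ksym: "K x a \<bullet> b = K x b \<bullet> a" for a b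
    unfolding K_def inner_add_left inner_scaleR_left sym[of x a b] inner_commute[of "g x"] by algebra
  have "(\<Sum>b\<in>Basis. K x b \<bullet> b) = 1/4 * y2 (z x) * (\<Sum>b\<in>Basis. (g x \<bullet> b) * (g x \<bullet> b)) + (- (1/2) * y1 (z x)) * (\<Sum>b\<in>Basis. H x b \<bullet> b)"
    unfolding K_def inner_add_left inner_scaleR_left sum.distrib sum_distrib_left inner_commute[of _ "g x"]
    by (simp only: mult.assoc)
  then have tr: "(\<Sum>b\<in>Basis. K x b \<bullet> b) = 1/4 * y2 (z x) * (real l)\<^sup>2 + (- (1/2) * y1 (z x)) * c"
    unfolding euclidean_inner[of "g x" "g x", symmetric] norm_gradient[OF x] laplacian[OF x] .
  have "sphere_laplacian u x = (\<Sum>b\<in>Basis. K x (tangential x b) \<bullet> tangential x b) - (real DIM('a) - 1) * (w x \<bullet> x)"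
    by (rule sphere_laplacian_eq[OF U SU du dw[OF xU] x])
  also have "(\<Sum>b\<in>Basis. K x (tangential x b) \<bullet> tangential x b) = (\<Sum>b\<in>Basis. K x b \<bullet> b) - K x x \<bullet> x"
    by (rule sum_tangential_trace[OF has_derivative_linear[OF dw[OF xU]] Ksym x])
  also have "K x x \<bullet> x = 1/4 * y2 (z x) * (real l * F x) * (real l * F x) + (- (1/2) * y1 (z x)) * ((real l - 1) * (real l * F x))"
    unfolding K_def inner_add_left inner_scaleR_left Hx inner_commute[of x "g x"] gx ..
  also have "w x \<bullet> x = (- (1/2) * y1 (z x)) * (real l * F x)" by (simp add: w_def gx)
  finally have "sphere_laplacian u x = 1/4 * y2 (z x) * (real l)\<^sup>2 * (1 - (F x)\<^sup>2)
      - (1/2) * y1 (z x) * (c - (real l - 1) * (real l * F x) - (real DIM('a) - 1) * (real l * F x))"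
    unfolding tr by (simp add: field_simps power2_eq_square)
  also have "\<dots> = profile_laplacian (y1 (z x)) (y2 (z x)) (F x)"
    unfolding profile_laplacian_def multiplicity_parameter_def using l
    by (simp add: field_simps power2_eq_square)
  finally show "sphere_laplacian u x = profile_laplacian (y1 ((1 - F x) / 2)) (y2 ((1 - F x) / 2)) (F x)"
    by (simp only: z_def)
qed

end

lemma cartan_muenzner_polynomial_imp_muenzner:
  fixes F :: "'a::euclidean_space \<Rightarrow> real"
  assumes F: "cartan_muenzner_polynomial l F" and dim: "2 \<le> DIM('a)"
  shows "\<exists>g H c. muenzner F g H l c"
proof -
  obtain g H where dF: "\<And>x. (F has_derivative (\<lambda>h. h \<bullet> g x)) (at x)"
    and dg: "\<And>x. (g has_derivative H x) (at x)" and sym: "\<And>x u v. H x u \<bullet> v = H x v \<bullet> u"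
    and cont: "\<And>v. continuous_on UNIV (\<lambda>x. H x v)"
    using F real_polynomial_function_Hessian unfolding cartan_muenzner_polynomial_def by metis
  have hom: "F (t *\<^sub>R x) = t ^ l * F x" for t x using F by (simp add: cartan_muenzner_polynomial_def)
  have nc: "\<not> F constant_on sphere 0 1" using F by (simp add: cartan_muenzner_polynomial_def)
  have l: "1 \<le> l"
  proof (rule ccontr)
    assume "\<not> 1 \<le> l"
    then have "l = 0" by simp
    then have "F x = F 0" for x using hom[of 0 x] by simp
    then show False using nc unfolding constant_on_def by blast
  qed
  have grad: "gradient F x = g x" for x
    unfolding gradient_def
  proof (rule the_equality)
    show "GDERIV F x :> g x" using dF[of x] by (simp add: gderiv_def)
    fix v assume "GDERIV F x :> v"
    then have "(\<lambda>h. h \<bullet> v) = (\<lambda>h. h \<bullet> g x)" using dF[of x] has_derivative_unique by (auto simp: gderiv_def)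
    then have "(v - g x) \<bullet> v = (v - g x) \<bullet> g x" by (rule fun_cong)
    then have "(v - g x) \<bullet> (v - g x) = 0" by (simp add: inner_diff_right)
    then show "v = g x" by simp
  qed
  have eik: "g x \<bullet> g x = (real l)\<^sup>2 * (x \<bullet> x) ^ (l - 1)" for x
  proof -
    have "(norm (g x))\<^sup>2 = (real l)\<^sup>2 * norm x powi (2 * int l - 2)"
      using F by (simp add: cartan_muenzner_polynomial_def grad)
    also have "2 * int l - 2 = int (2 * (l - 1))" using l by simp
    also have "norm x powi int (2 * (l - 1)) = ((norm x)\<^sup>2) ^ (l - 1)"
      by (simp only: power_int_of_nat power_mult)
    finally show ?thesis by (simp only: power2_norm_eq_inner)
  qed
  have Fd: "frechet_derivative F (at y) = (\<lambda>h. h \<bullet> g y)" for y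
    using frechet_derivative_at[OF dF] by simp
  have lap: "laplacian F x = (\<Sum>b\<in>Basis. H x b \<bullet> b)" for x
  proof -
    have "frechet_derivative (\<lambda>y. frechet_derivative F (at y) b) (at x) = (\<lambda>h. b \<bullet> H x h)" for b
      unfolding Fd by (rule frechet_derivative_at[OF has_derivative_inner_right[OF dg], symmetric])
    then show ?thesis unfolding laplacian_def by (simp add: inner_commute)
  qed
  obtain c where c: "\<And>x. laplacian F x = c * norm x powi (int l - 2)"
    using F unfolding cartan_muenzner_polynomial_def by blast
  have "(\<Sum>b\<in>Basis. H x b \<bullet> b) = c" if "norm x = 1" for x using c[of x] lap[of x] that by simp
  then have "muenzner F g H l c" using dF dg sym cont hom l eik nc dim by (intro muenzner.intro)
  then show ?thesis by blast
qed

section \<open>Sign-changing solutions blowing up on the focal submanifolds\<close>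

theorem corollary1p2:
  fixes n :: nat and S Mminus Mplus :: "'a::euclidean_space set"
  assumes "n \<ge> 3" and "DIM('a) = n + 1"
    and "isoparametric_hypersurface S"
    and "focal_submanifolds S Mminus Mplus"
    and "\<exists>d>0. smooth_submanifold d Mminus"
    and "\<exists>d>0. smooth_submanifold d Mplus"
  shows "\<exists>u :: nat \<Rightarrow> 'a \<Rightarrow> real.
    (\<forall>k. yamabe_solution n (u k) \<and> sign_changing_on_sphere (u k)) \<and>
    (\<forall>x\<in>Mminus. filterlim (\<lambda>k. u k x) at_top sequentially) \<and>
    (\<forall>x\<in>Mplus. filterlim (\<lambda>k. u k x) at_bot sequentially)"
proof -
  note n = assms(1) and DIM = assms(2)
  obtain l F where cm: "cartan_muenzner_polynomial l F"
    and Mm: "Mminus = {x \<in> sphere 0 1. F x = -1}" and Mp: "Mplus = {x \<in> sphere 0 1. F x = 1}"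
    using assms(4) unfolding focal_submanifolds_def by blast
  have dim: "2 \<le> DIM('a)" using n DIM by simp
  obtain g H c where "muenzner F g H l c" using cartan_muenzner_polynomial_imp_muenzner[OF cm dim] by blast
  then interpret P: muenzner F g H l c .
  interpret N: muenzner "\<lambda>x. - F x" "\<lambda>x. - g x" "\<lambda>x u. - H x u" l "- c" by (rule P.muenzner_uminus)
  define \<alpha> where "\<alpha> = P.multiplicity_parameter"
  define \<beta> where "\<beta> = N.multiplicity_parameter"
  define r where "r = 4 / (real n - 2)"
  define \<kappa> where "\<kappa> = real n * (real n - 2) / 4 / (real l)\<^sup>2"
  have n2: "0 < real n - 2" using n by simp
  have l: "0 < real l" using P.l by simp
  have r: "0 < r" and \<kappa>: "0 < \<kappa>" using n2 n l by (simp_all add: r_def \<kappa>_def)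
  have sum: "\<alpha> + \<beta> = (real DIM('a) + real l - 2) / real l"
    unfolding \<alpha>_def \<beta>_def P.multiplicity_parameter_def N.multiplicity_parameter_def
    using l by (simp add: field_simps power2_eq_square)
  have lower: "1/2 \<le> \<alpha>" "1/2 \<le> \<beta>"
    unfolding \<alpha>_def \<beta>_def by (rule P.multiplicity_parameter_ge N.multiplicity_parameter_ge)+
  have upper: "2 * \<alpha> \<le> real n - 1" "2 * \<beta> \<le> real n - 1"
  proof -
    obtain d where "0 < d" "smooth_submanifold d {x \<in> sphere 0 1. F x = 1}" using assms(6) Mp by blast
    then have "2 * \<alpha> \<le> real DIM('a) - 2" unfolding \<alpha>_def by (intro P.multiplicity_parameter_le_submanifold)
    then show "2 * \<alpha> \<le> real n - 1" using DIM by simp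
    have "Mminus = {x \<in> sphere 0 1. - F x = 1}" unfolding Mm by auto
    then obtain d where "0 < d" "smooth_submanifold d {x \<in> sphere 0 1. - F x = 1}" using assms(5) by auto
    then have "2 * \<beta> \<le> real DIM('a) - 2" unfolding \<beta>_def by (intro N.multiplicity_parameter_le_submanifold)
    then show "2 * \<beta> \<le> real n - 1" using DIM by simp
  qed
  \<comment> \<open>With \<open>r = 4 / (n - 2)\<close> the condition \<open>\<alpha> * r < r + 2\<close>
    says \<open>2 * \<alpha> < n\<close>: the codimension of the focal submanifold is less than
    \<open>n\<close>, so its dimension is positive.\<close>
  have subcritical: "a * r < r + 2" if "2 * a \<le> real n - 1" for a
  proof -
    have "a * r \<le> (real n - 1) / 2 * r" using that r by (intro mult_right_mono) auto
    also have "\<dots> < r + 2" using n2 by (simp add: r_def field_simps)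
    finally show ?thesis .
  qed
  have J1: "jacobi_shooting \<alpha> \<beta> \<kappa> r" and J2: "jacobi_shooting \<beta> \<alpha> \<kappa> r"
    by (unfold_locales; use lower \<kappa> r subcritical upper in simp)+
  have "\<forall>k::nat. \<exists>y. y 0 < - real k \<and> real k < y 1 \<and> (\<exists>y1 y2. continuous_on UNIV y2 \<and>
     (\<forall>z\<in>{-1<..<2}. (y has_real_derivative y1 z) (at z) \<and> (y1 has_real_derivative y2 z) (at z)) \<and>
     (\<forall>z\<in>{0..1}. z * (1 - z) * y2 z + (\<alpha> - (\<alpha> + \<beta>) * z) * y1 z + \<kappa> * (\<bar>y z\<bar> powr r * y z - y z) = 0))"
    using sign_changing_profile[OF J1 J2] by blast
  then obtain y where y0: "\<And>k. y k 0 < - real k" and y1: "\<And>k. real k < y k 1"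
    and y: "\<And>k. \<exists>y1 y2. continuous_on UNIV y2 \<and>
     (\<forall>z\<in>{-1<..<2}. (y k has_real_derivative y1 z) (at z) \<and> (y1 has_real_derivative y2 z) (at z)) \<and>
     (\<forall>z\<in>{0..1}. z * (1 - z) * y2 z + (\<alpha> - (\<alpha> + \<beta>) * z) * y1 z + \<kappa> * (\<bar>y k z\<bar> powr r * y k z - y k z) = 0)"
    by (auto dest!: choice)
  define u where "u k x = y k ((1 - F x) / 2)" for k x
  have exponent: "critical_exponent n - 1 = r"
    using n2 by (simp add: critical_exponent_def r_def field_simps)
  have yamabe: "yamabe_solution n (u k)" for k
  proof -
    obtain y1 y2 where y2: "continuous_on UNIV y2"
      and d: "\<And>z. z \<in> {-1<..<2} \<Longrightarrow> (y k has_real_derivative y1 z) (at z)"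
        "\<And>z. z \<in> {-1<..<2} \<Longrightarrow> (y1 has_real_derivative y2 z) (at z)"
      and ode: "\<And>z. z \<in> {0..1} \<Longrightarrow> z * (1 - z) * y2 z + (\<alpha> - (\<alpha> + \<beta>) * z) * y1 z
        + \<kappa> * (\<bar>y k z\<bar> powr r * y k z - y k z) = 0"
      using y[of k] by blast
    have "- sphere_laplacian (u k) x + real n * (real n - 2) / 4 * u k x
        = real n * (real n - 2) / 4 * (\<bar>u k x\<bar> powr (critical_exponent n - 1) * u k x)"
      if x: "x \<in> sphere 0 1" for x
    proof -
      define z where "z = (1 - F x) / 2"
      have x1: "norm x = 1" using x by simp
      have z: "z \<in> {0..1}" using P.F_bounds[OF x1] by (simp add: z_def)
      have Fz: "(1 - (F x)\<^sup>2) / 4 = z * (1 - z)" by (simp add: z_def field_simps power2_eq_square)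
      have uz: "u k x = y k z" by (simp add: u_def z_def)
      have "sphere_laplacian (u k) x = P.profile_laplacian (y1 z) (y2 z) (F x)"
        unfolding u_def[abs_def] z_def by (rule P.laplacian_of_profile(2)[OF d y2 x1])
      also have "\<dots> = (real l)\<^sup>2 * (z * (1 - z) * y2 z + (\<alpha> - (\<alpha> + \<beta>) * z) * y1 z)"
        unfolding P.profile_laplacian_def Fz sum \<alpha>_def[symmetric] z_def[symmetric] ..
      also have "z * (1 - z) * y2 z + (\<alpha> - (\<alpha> + \<beta>) * z) * y1 z
          = - (\<kappa> * (\<bar>y k z\<bar> powr r * y k z - y k z))"
        using ode[OF z] by linarith
      also have "(real l)\<^sup>2 * \<dots> = - ((real l)\<^sup>2 * \<kappa>) * (\<bar>y k z\<bar> powr r * y k z - y k z)" by simp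
      also have "(real l)\<^sup>2 * \<kappa> = real n * (real n - 2) / 4" using l by (simp add: \<kappa>_def)
      finally show ?thesis unfolding uz exponent by (simp only: right_diff_distrib mult_minus_left)
    qed
    moreover have "Ck_on_sphere 2 (u k)" unfolding u_def[abs_def] by (rule P.laplacian_of_profile(1)[OF d y2])
    ultimately show ?thesis unfolding yamabe_solution_def by blast
  qed
  have plus: "u k x < - real k" if "x \<in> Mplus" for k x using that y0[of k] by (simp add: Mp u_def)
  have minus: "real k < u k x" if "x \<in> Mminus" for k x using that y1[of k] by (simp add: Mm u_def)
  have "sign_changing_on_sphere (u k)" for k
  proof -
    obtain p q where "norm p = 1" "F p = 1" "norm q = 1" "- F q = 1"
      using P.focal_set_nonempty N.focal_set_nonempty by blast
    then have "p \<in> Mplus" "q \<in> Mminus" by (simp_all add: Mp Mm)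
    then have "u k p < 0" "0 < u k q" using plus[of p k] minus[of q k] by linarith+
    then show ?thesis using \<open>norm p = 1\<close> \<open>norm q = 1\<close> unfolding sign_changing_on_sphere_def by auto
  qed
  moreover have "filterlim (\<lambda>k. u k x) at_top sequentially" if "x \<in> Mminus" for x
    by (rule filterlim_at_top_mono[OF filterlim_real_sequentially])
       (use minus[OF that] in \<open>auto intro: always_eventually less_imp_le\<close>)
  moreover have "filterlim (\<lambda>k. u k x) at_bot sequentially" if "x \<in> Mplus" for x
  proof -
    have "filterlim (\<lambda>k. - u k x) at_top sequentially"
      by (rule filterlim_at_top_mono[OF filterlim_real_sequentially])
         (use plus[OF that] in \<open>auto intro!: always_eventually simp: less_imp_le minus_less_iff less_minus_iff\<close>)
    then show ?thesis by (simp add: filterlim_uminus_at_top)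
  qed
  ultimately show ?thesis using yamabe by blast
qed

end
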